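(* Let $\mathfrak g$ be a complex semisimple Lie algebra with Cartan subalgebra $\mathfrak t$, and let $\mathbf S$ be the spin module associated with $\mathfrak h=\mathfrak t$. Let $\mu\in\Lambda(\mathbf S)$ and let $A\subset\Phi^+$ be a subset such that $\mu=\mu(A)$. The following conditions are equivalent: (i) $\mathrm{mult}_{\mathbf S}(\mu)=1$; (ii) $A$ is saturated; (iii) there is $w\in W$ such that $\mu=w(\rho(\mathfrak g))$.
   Context: $\Phi$ is the set of $\mathfrak t$-roots of $\mathfrak g$, $\Phi^+$ a positive system, $W$ the Weyl group of $\Phi$, $\rho(\mathfrak g)=\frac12\sum_{\alpha\in\Phi^+}\alpha$. The spin module for $\mathfrak h=\mathfrak t$ is $\mathbf S=\bigwedge\mathfrak u^+$ with $\mathfrak u^+=\bigoplus_{\alpha\in\Phi^+}\mathfrak g_\alpha$ and $\mathfrak t$ acting through $\mathfrak t\xrightarrow{\mathrm{ad}}\mathfrak{so}(\mathfrak q)\subset\mathbf C(\mathfrak q)\to\mathrm{End}(\mathbf S)$ (Clifford multiplication), where $\mathfrak q=\bigoplus_{\alpha\in\Phi}\mathfrak g_\alpha$. Its set of weights is $\Lambda(\mathbf S)=\{\mu(A):A\subset\Phi^+\}$ with $\mu(A)=\frac12\big(\sum_{\alpha\in\Phi^+\setminus A}\alpha-\sum_{\alpha\in A}\alpha\big)$, and $\mathrm{mult}_{\mathbf S}(\mu)=\#\{A\subset\Phi^+:\mu(A)=\mu\}$. A subset $A\subset\Phi^+$ is saturated if: for all $\alpha,\beta\in A$, $\alpha+\beta\in\Phi$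 implies $\alpha+\beta\in A$; and for all $\gamma,\delta\in\Phi^+\setminus A$, $\gamma+\delta\in\Phi$ implies $\gamma+\delta\notin A$. *)

theory Defs
  imports Complex_Main "HOL-Library.Function_Algebras"
begin

section \<open>Complex-valued functions as a vector space\<close>

definition fscale :: "complex \<Rightarrow> ('a \<Rightarrow> complex) \<Rightarrow> 'a \<Rightarrow> complex" where
  "fscale c f = (\<lambda>x. c * f x)"

global_interpretation fun_vs: vector_space fscale
  by standard (auto simp: fscale_def fun_eq_iff algebra_simps)


section \<open>Linear algebra and exterior algebra\<close>

locale complex_vector_space = vector_space scale
  for scale :: "complex \<Rightarrow> 'v::ab_group_add \<Rightarrow> 'v" (infixr \<open>*s\<close> 75)
begin

definition diagonalizable :: "('v \<Rightarrow> 'v) \<Rightarrow> bool" where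
  "diagonalizable f \<longleftrightarrow> span {x. \<exists>c. f x = c *s x} = UNIV"

text \<open>The trace is computed in a chosen basis of the (finite-dimensional) space.\<close>

definition op_trace :: "('v \<Rightarrow> 'v) \<Rightarrow> complex" where
  "op_trace f =
     (let B = (SOME B. independent B \<and> span B = UNIV)
      in \<Sum>b\<in>B. representation B (f b) b)"

text \<open>The dual of a subspace \<open>V\<close> consists of linear functionals on \<open>V\<close>, normalised to
  vanish outside \<open>V\<close> so that two of them are equal as soon as they agree on \<open>V\<close>.\<close>

definition dual :: "'v set \<Rightarrow> ('v \<Rightarrow> complex) set" where
  "dual V = {\<phi>. (\<forall>x\<in>V. \<forall>y\<in>V. \<phi> (x + y) = \<phi> x + \<phi> y) \<and>
                (\<forall>c. \<forall>x\<in>V. \<phi> (c *s x) = c * \<phi> x) \<and>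
                (\<forall>x. x \<notin> V \<longrightarrow> \<phi> x = 0)}"

text \<open>For finite-dimensional \<open>V\<close>, the space \<open>\<And>\<^sup>k V\<close> is identified with the alternating
  \<open>k\<close>-linear forms on the dual of \<open>V\<close>, where \<open>u\<^sub>1 \<and> \<dots> \<and> u\<^sub>k\<close> corresponds to
  \<open>(\<phi>\<^sub>1, \<dots>, \<phi>\<^sub>k) \<mapsto> det (\<phi>\<^sub>j u\<^sub>i)\<close>.  An element of the full exterior algebra is a function on
  lists whose restriction to lists of length \<open>k\<close> is its component of degree \<open>k\<close>;
  components of degree larger than the dimension of \<open>V\<close> vanish automatically.\<close>

definition exterior :: "'v set \<Rightarrow> (('v \<Rightarrow> complex) list \<Rightarrow> complex) set" where
  "exterior V = {\<omega>.
     (\<forall>\<phi>s. \<not> set \<phi>s \<subseteq> dual V \<longrightarrow> \<omega> \<phi>s = 0) \<and>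
     (\<forall>xs ys \<phi> \<psi>. set xs \<union> set ys \<union> {\<phi>, \<psi>} \<subseteq> dual V \<longrightarrow>
        \<omega> (xs @ (\<phi> + \<psi>) # ys) = \<omega> (xs @ \<phi> # ys) + \<omega> (xs @ \<psi> # ys)) \<and>
     (\<forall>xs ys c \<phi>. set xs \<union> set ys \<union> {\<phi>} \<subseteq> dual V \<longrightarrow>
        \<omega> (xs @ fscale c \<phi> # ys) = c * \<omega> (xs @ \<phi> # ys)) \<and>
     (\<forall>\<phi>s. \<not> distinct \<phi>s \<longrightarrow> \<omega> \<phi>s = 0)}"

text \<open>Left exterior multiplication by \<open>u \<in> V\<close> (expansion of the determinant along its first
  row), and contraction by \<open>\<phi>\<close> in the dual of \<open>V\<close>, i.e.\ the antiderivation sending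
  \<open>u\<^sub>1 \<and> \<dots> \<and> u\<^sub>k\<close> to
  \<open>\<Sum>i. (-1)\<^sup>i\<^sup>-\<^sup>1 \<phi>(u\<^sub>i) u\<^sub>1 \<and> \<dots> \<and> u\<^sub>i\<^sub>-\<^sub>1 \<and> u\<^sub>i\<^sub>+\<^sub>1 \<and> \<dots> \<and> u\<^sub>k\<close>
  (expansion along the first column).\<close>

definition wedge :: "'v set \<Rightarrow> 'v \<Rightarrow> (('v \<Rightarrow> complex) list \<Rightarrow> complex)
    \<Rightarrow> ('v \<Rightarrow> complex) list \<Rightarrow> complex" where
  "wedge V u \<omega> = (\<lambda>\<phi>s. if set \<phi>s \<subseteq> dual V
     then \<Sum>i<length \<phi>s. (- 1) ^ i * (\<phi>s ! i) u * \<omega> (take i \<phi>s @ drop (Suc i) \<phi>s)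
     else 0)"

definition contract :: "('v \<Rightarrow> complex) \<Rightarrow> (('v \<Rightarrow> complex) list \<Rightarrow> complex)
    \<Rightarrow> ('v \<Rightarrow> complex) list \<Rightarrow> complex" where
  "contract \<phi> \<omega> = (\<lambda>\<phi>s. \<omega> (\<phi> # \<phi>s))"

end


section \<open>Complex semisimple Lie algebras\<close>

locale complex_lie_algebra = complex_vector_space scale
  for scale :: "complex \<Rightarrow> 'g::ab_group_add \<Rightarrow> 'g" (infixr \<open>*s\<close> 75) +
  fixes bracket :: "'g \<Rightarrow> 'g \<Rightarrow> 'g"
  assumes finite_dimensional: "\<exists>B. finite B \<and> span B = UNIV"
    and bracket_add_left: "bracket (x + y) z = bracket x z + bracket y z"
    and bracket_add_right: "bracket x (y + z) = bracket x y + bracket x z"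
    and bracket_scale_left: "bracket (c *s x) y = c *s bracket x y"
    and bracket_scale_right: "bracket x (c *s y) = c *s bracket x y"
    and bracket_self: "bracket x x = 0"
    and jacobi: "bracket x (bracket y z) + bracket y (bracket z x) + bracket z (bracket x y) = 0"
begin

definition lie_ideal :: "'g set \<Rightarrow> bool" where
  "lie_ideal I \<longleftrightarrow> subspace I \<and> (\<forall>x. \<forall>y\<in>I. bracket x y \<in> I)"

fun derived_series :: "'g set \<Rightarrow> nat \<Rightarrow> 'g set" where
  "derived_series I 0 = I"
| "derived_series I (Suc n) =
     span {bracket x y |x y. x \<in> derived_series I n \<and> y \<in> derived_series I n}"

definition solvable :: "'g set \<Rightarrow> bool" where
  "solvable I \<longleftrightarrow> (\<exists>n. derived_series I n = {0})"

definition semisimple :: bool where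
  "semisimple \<longleftrightarrow> (\<forall>I. lie_ideal I \<and> solvable I \<longrightarrow> I = {0})"

definition abelian_subalgebra :: "'g set \<Rightarrow> bool" where
  "abelian_subalgebra a \<longleftrightarrow> subspace a \<and> (\<forall>x\<in>a. \<forall>y\<in>a. bracket x y = 0)"

text \<open>Cartan subalgebras in the sense used for complex semisimple Lie algebras: maximal abelian
  subalgebras all of whose elements are ad-semisimple, i.e.\ ad-diagonalisable.\<close>

definition cartan_subalgebra :: "'g set \<Rightarrow> bool" where
  "cartan_subalgebra t \<longleftrightarrow> abelian_subalgebra t \<and>
     (\<forall>s. abelian_subalgebra s \<and> t \<subseteq> s \<longrightarrow> s = t) \<and>
     (\<forall>h\<in>t. diagonalizable (bracket h))"

definition killing :: "'g \<Rightarrow> 'g \<Rightarrow> complex" where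
  "killing x y = op_trace (bracket x \<circ> bracket y)"


section \<open>Roots, Weyl group, positive systems\<close>

definition root_space :: "'g set \<Rightarrow> ('g \<Rightarrow> complex) \<Rightarrow> 'g set" where
  "root_space t \<alpha> = {x. \<forall>h\<in>t. bracket h x = \<alpha> h *s x}"

definition roots :: "'g set \<Rightarrow> ('g \<Rightarrow> complex) set" where
  "roots t = {\<alpha> \<in> dual t. \<alpha> \<noteq> 0 \<and> root_space t \<alpha> \<noteq> {0}}"

definition dual_vector :: "'g set \<Rightarrow> ('g \<Rightarrow> complex) \<Rightarrow> 'g" where
  "dual_vector t \<xi> = (THE h. h \<in> t \<and> (\<forall>h'\<in>t. killing h h' = \<xi> h'))"

text \<open>The form on the dual of \<open>t\<close> induced by the Killing form.\<close>

definition dual_form :: "'g set \<Rightarrow> ('g \<Rightarrow> complex) \<Rightarrow> ('g \<Rightarrow> complex) \<Rightarrow> complex" where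
  "dual_form t \<xi> \<mu> = killing (dual_vector t \<xi>) (dual_vector t \<mu>)"

definition root_reflection ::
    "'g set \<Rightarrow> ('g \<Rightarrow> complex) \<Rightarrow> ('g \<Rightarrow> complex) \<Rightarrow> 'g \<Rightarrow> complex" where
  "root_reflection t \<alpha> \<xi> = \<xi> - fscale (2 * dual_form t \<xi> \<alpha> / dual_form t \<alpha> \<alpha>) \<alpha>"

text \<open>The Weyl group as a set of transformations of the dual of \<open>t\<close> (values outside that dual are
  irrelevant).  Since the generating reflections are involutions, closing under composition
  already yields a group.\<close>

inductive_set weyl_group :: "'g set \<Rightarrow> (('g \<Rightarrow> complex) \<Rightarrow> 'g \<Rightarrow> complex) set"
  for t :: "'g set"
where
  weyl_id: "id \<in> weyl_group t"
| weyl_reflection: "w \<in> weyl_group t \<Longrightarrow> \<alpha> \<in> roots t \<Longrightarrow> root_reflection t \<alpha> \<circ> w \<in> weyl_group t"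

definition positive_system :: "'g set \<Rightarrow> ('g \<Rightarrow> complex) set \<Rightarrow> bool" where
  "positive_system t P \<longleftrightarrow> P \<subseteq> roots t \<and>
     (\<forall>\<alpha>\<in>roots t. (\<alpha> \<in> P) \<noteq> (- \<alpha> \<in> P)) \<and>
     (\<forall>\<alpha>\<in>P. \<forall>\<beta>\<in>P. \<alpha> + \<beta> \<in> roots t \<longrightarrow> \<alpha> + \<beta> \<in> P)"

definition rho :: "('g \<Rightarrow> complex) set \<Rightarrow> 'g \<Rightarrow> complex" where
  "rho P = fscale (1 / 2) (\<Sum>\<alpha>\<in>P. \<alpha>)"

definition mu_of :: "('g \<Rightarrow> complex) set \<Rightarrow> ('g \<Rightarrow> complex) set \<Rightarrow> 'g \<Rightarrow> complex" where
  "mu_of P A = fscale (1 / 2) ((\<Sum>\<alpha>\<in>P - A. \<alpha>) - (\<Sum>\<alpha>\<in>A. \<alpha>))"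

definition saturated ::
    "'g set \<Rightarrow> ('g \<Rightarrow> complex) set \<Rightarrow> ('g \<Rightarrow> complex) set \<Rightarrow> bool" where
  "saturated t P A \<longleftrightarrow>
     (\<forall>\<alpha>\<in>A. \<forall>\<beta>\<in>A. \<alpha> + \<beta> \<in> roots t \<longrightarrow> \<alpha> + \<beta> \<in> A) \<and>
     (\<forall>\<gamma>\<in>P - A. \<forall>\<delta>\<in>P - A. \<gamma> + \<delta> \<in> roots t \<longrightarrow> \<gamma> + \<delta> \<notin> A)"


section \<open>The spin module\<close>

definition q_space :: "'g set \<Rightarrow> 'g set" where
  "q_space t = span (\<Union>\<alpha>\<in>roots t. root_space t \<alpha>)"

definition u_plus :: "'g set \<Rightarrow> ('g \<Rightarrow> complex) set \<Rightarrow> 'g set" where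
  "u_plus t P = span (\<Union>\<alpha>\<in>P. root_space t \<alpha>)"

definition u_minus :: "'g set \<Rightarrow> ('g \<Rightarrow> complex) set \<Rightarrow> 'g set" where
  "u_minus t P = span (\<Union>\<alpha>\<in>P. root_space t (- \<alpha>))"

definition spin_module ::
    "'g set \<Rightarrow> ('g \<Rightarrow> complex) set \<Rightarrow> (('g \<Rightarrow> complex) list \<Rightarrow> complex) set" where
  "spin_module t P = exterior (u_plus t P)"

text \<open>Component in \<open>u\<^sup>+\<close> of an element of \<open>q = u\<^sup>+ \<oplus> u\<^sup>-\<close>.\<close>

definition plus_part :: "'g set \<Rightarrow> ('g \<Rightarrow> complex) set \<Rightarrow> 'g \<Rightarrow> 'g" where
  "plus_part t P x = (THE p. p \<in> u_plus t P \<and> x - p \<in> u_minus t P)"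

text \<open>The action on \<open>\<And> u\<^sup>+\<close> of \<open>x \<in> q\<close>, regarded as an element of the Clifford algebra of \<open>q\<close>
  with relation \<open>x y + y x = 2 \<kappa>(x, y)\<close>, where \<open>\<kappa>\<close> is the Killing form: \<open>u\<^sup>+\<close> acts by exterior
  multiplication, and \<open>y \<in> u\<^sup>-\<close> by twice the contraction with \<open>\<kappa>(y, _)\<close>.\<close>

definition clifford :: "'g set \<Rightarrow> ('g \<Rightarrow> complex) set \<Rightarrow> 'g
    \<Rightarrow> (('g \<Rightarrow> complex) list \<Rightarrow> complex) \<Rightarrow> ('g \<Rightarrow> complex) list \<Rightarrow> complex" where
  "clifford t P x \<omega> =
     (let p = plus_part t P x;
          \<phi> = (\<lambda>u. if u \<in> u_plus t P then killing (x - p) u else 0)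
      in wedge (u_plus t P) p \<omega> + fscale 2 (contract \<phi> \<omega>))"

text \<open>The embedding of \<open>so(q)\<close> into the Clifford algebra sends \<open>X\<close> to
  \<open>1/4 \<Sum>\<^sub>b X(b) b\<^sup>*\<close>, where \<open>b\<close> runs through a basis of \<open>q\<close> and the \<open>b\<^sup>*\<close> form the dual basis
  with respect to \<open>\<kappa>\<close>; with the above Clifford relation it is the unique embedding into the
  span of the commutators \<open>[x, y]\<close> of vectors for which the commutator of \<open>X\<close> and \<open>v\<close> in the
  Clifford algebra is \<open>X(v)\<close>, for all \<open>v \<in> q\<close>.  It does not depend on the basis.\<close>

definition dual_basis_vector :: "'g set \<Rightarrow> 'g set \<Rightarrow> 'g \<Rightarrow> 'g" where
  "dual_basis_vector t B b =
     (THE y. y \<in> q_space t \<and> (\<forall>b'\<in>B. killing b' y = (if b' = b then 1 else 0)))"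

definition so_action :: "'g set \<Rightarrow> ('g \<Rightarrow> complex) set \<Rightarrow> ('g \<Rightarrow> 'g)
    \<Rightarrow> (('g \<Rightarrow> complex) list \<Rightarrow> complex) \<Rightarrow> ('g \<Rightarrow> complex) list \<Rightarrow> complex" where
  "so_action t P X \<omega> =
     (let B = (SOME B. independent B \<and> span B = q_space t)
      in fscale (1 / 4)
           (\<Sum>b\<in>B. clifford t P (X b) (clifford t P (dual_basis_vector t B b) \<omega>)))"

definition spin_weight_space :: "'g set \<Rightarrow> ('g \<Rightarrow> complex) set \<Rightarrow> ('g \<Rightarrow> complex)
    \<Rightarrow> (('g \<Rightarrow> complex) list \<Rightarrow> complex) set" where
  "spin_weight_space t P \<mu> =
     {\<omega> \<in> spin_module t P. \<forall>h\<in>t. so_action t P (bracket h) \<omega> = fscale (\<mu> h) \<omega>}"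

definition spin_weights :: "'g set \<Rightarrow> ('g \<Rightarrow> complex) set \<Rightarrow> ('g \<Rightarrow> complex) set" where
  "spin_weights t P = {\<mu> \<in> dual t. spin_weight_space t P \<mu> \<noteq> {0}}"

definition spin_mult :: "'g set \<Rightarrow> ('g \<Rightarrow> complex) set \<Rightarrow> ('g \<Rightarrow> complex) \<Rightarrow> nat" where
  "spin_mult t P \<mu> = fun_vs.dim (spin_weight_space t P \<mu>)"

end

end

theory Submission
  imports Defs
begin

text \<open>Writing \<open>flip P A = (P - A) \<union> -A\<close>, one has \<open>\<mu>(A) = \<rho>(flip P A)\<close>, and \<open>A\<close> is saturated exactly when
  \<open>flip P A\<close> is again a positive system.  The Weyl group is transitive on positive systems, which
  relates saturation to the orbit of \<open>\<rho>\<close>.  No nonempty sum of positive roots vanishes, so a positive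
  system is determined by \<open>\<rho>\<close> among all choices of one root from each pair \<open>\<plusminus>\<alpha>\<close>; conversely, a failure
  of saturation lets one trade \<open>\<alpha>, \<beta>\<close> for \<open>\<alpha> + \<beta>\<close> without changing \<open>\<mu>(A)\<close>.

  The structure theory behind this rests on one remark: if a space with a basis of eigenvectors of
  \<open>[x, y]\<close> is stable under \<open>x\<close> and \<open>y\<close>, then the eigenvalues sum to \<open>0\<close>.  Applied to suitable
  sums of root spaces it yields, with Engel's theorem, the nondegeneracy of the Killing form, and
  then one-dimensional root spaces and unbroken root strings with integral Cartan numbers.  In the
  spin module, \<open>h \<in> t\<close> acts by \<open>1/2 \<Sum>\<^sub>\<alpha> \<alpha>(h) (\<epsilon>\<^sub>\<alpha> \<iota>\<^sub>\<alpha> - \<iota>\<^sub>\<alpha> \<epsilon>\<^sub>\<alpha>)\<close>, summed over \<open>\<alpha> \<in> P\<close>, with \<open>\<epsilon>\<^sub>\<alpha>\<close> and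
  \<open>\<iota>\<^sub>\<alpha>\<close> exterior multiplication and contraction along a basis of root vectors.\<close>


section \<open>Traces, weights and nilpotent sets\<close>

text \<open>\<open>semisimple\<close> only excludes solvable ideals, while reflections and the
  Clifford action are built from the Killing form, so nondegeneracy has to be earned. Cartan's
  criterion is bypassed because \<open>t\<close> is ad-diagonalizable by definition: for opposite
  root vectors x, y every root takes at [x, y] a real multiple of \<alpha>([x, y]), and an isotropic
  [x, y] would make a sum of real squares vanish. The sl2-triples are exploited through traces
  alone.

  A \<open>positive_system\<close> is just a closed choice of signs, given without a linear
  functional or a base. Descent on the length of lists of roots stands in for the functional, and
  roots indecomposable in the system at hand stand in for simple roots.

  The spin action is defined through chosen bases and dual bases, so it is first rewritten in
  normalized root vectors. An element of the exterior algebra is then known from its values on lists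
  of dual basis functionals. The monomial over a subset B has weight \<mu>(P - B), the unit having
  the lowest weight; this is why complements appear in the multiplicity count.\<close>

context complex_vector_space
begin

text \<open>\<open>B\<close> may span a proper subspace: for a map that preserves
  \<open>span B\<close> this is the trace of the restriction. Traces on sums of root spaces are
  taken in this way.\<close>

definition trace_on :: "'v set \<Rightarrow> ('v \<Rightarrow> 'v) \<Rightarrow> complex" where
  "trace_on B f = (\<Sum>b\<in>B. representation B (f b) b)"

text \<open>Matrix times coordinate vector, with separate bases for source and target: equal bases
  give the trace of a composition, different ones a change of basis.\<close>

lemma representation_image:
  assumes "Vector_Spaces.linear scale scale f" "finite B" "independent B" "independent C"
    and "x \<in> span B" "f ` B \<subseteq> span C"
  shows "representation C (f x) d = (\<Sum>c\<in>B. representation B x c * representation C (f c) d)"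
proof -
  interpret f: Vector_Spaces.linear scale scale f by fact
  have "x = (\<Sum>c\<in>B. representation B x c *s c)"
    using sum_representation_eq[of B x B] assms by simp
  then have "f x = (\<Sum>c\<in>B. representation B x c *s f c)"
    by (metis (no_types, lifting) f.scale f.sum sum.cong)
  moreover have "representation C (\<Sum>c\<in>B. representation B x c *s f c) =
      (\<lambda>d. \<Sum>c\<in>B. representation C (representation B x c *s f c) d)"
    using assms by (intro representation_sum) (auto intro: span_scale)
  moreover have "representation C (representation B x c *s f c) d
      = representation B x c * representation C (f c) d" if "c \<in> B" for c
    using assms that by (subst representation_scale) auto
  ultimately show ?thesis by simp
qed

lemma trace_on_comp_commute:
  assumes "Vector_Spaces.linear scale scale f" "Vector_Spaces.linear scale scale g" "finite B" "independent B"
    and "f ` B \<subseteq> span B" "g ` B \<subseteq> span B"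
  shows "trace_on B (f \<circ> g) = trace_on B (g \<circ> f)"
proof -
  have "trace_on B (f \<circ> g) = (\<Sum>b\<in>B. \<Sum>c\<in>B. representation B (g b) c * representation B (f c) b)"
    unfolding trace_on_def using assms by (auto intro!: sum.cong simp: image_subset_iff representation_image)
  also have "\<dots> = (\<Sum>c\<in>B. \<Sum>b\<in>B. representation B (f c) b * representation B (g b) c)"
    by (subst sum.swap) (simp add: mult.commute)
  also have "\<dots> = trace_on B (g \<circ> f)"
    unfolding trace_on_def using assms by (auto intro!: sum.cong simp: image_subset_iff representation_image)
  finally show ?thesis .
qed

lemma trace_on_basis_cong:
  assumes "Vector_Spaces.linear scale scale f" "finite B" "independent B" "finite C" "independent C"
    and "span B = UNIV" "span C = UNIV"
  shows "trace_on B f = trace_on C f"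
proof -
  \<comment> \<open>The transition coefficients \<open>representation C b c\<close> form the matrix
    of the identity, so a change of basis is a product of two matrices, like the trace of a
    composition.\<close>
  have lin: "Vector_Spaces.linear scale scale (\<lambda>x. x)"
    by (rule linear_ident)
  have "trace_on B f = (\<Sum>b\<in>B. \<Sum>c\<in>C. representation C b c * representation B (f c) b)"
    unfolding trace_on_def using assms by (auto intro!: sum.cong representation_image)
  also have "\<dots> = (\<Sum>c\<in>C. \<Sum>b\<in>B. representation B (f c) b * representation C b c)"
    by (subst sum.swap) (simp add: mult.commute)
  also have "\<dots> = trace_on C f"
    unfolding trace_on_def using assms
    by (auto intro!: sum.cong representation_image[OF lin, symmetric])
  finally show ?thesis .
qed

lemma trace_on_diff:
  assumes "independent B" "f ` B \<subseteq> span B" "g ` B \<subseteq> span B"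
  shows "trace_on B (\<lambda>x. f x - g x) = trace_on B f - trace_on B g"
  unfolding trace_on_def using assms
  by (subst sum_subtractf[symmetric], intro sum.cong) (auto simp: image_subset_iff representation_diff)

lemma trace_on_eigenbasis:
  assumes "independent B" "\<And>b. b \<in> B \<Longrightarrow> f b = c b *s b"
  shows "trace_on B f = sum c B"
  unfolding trace_on_def using assms
  by (intro sum.cong) (auto simp: representation_scale span_base representation_basis)

end

section \<open>Adjoint maps, commutator traces and stable subspaces\<close>

context complex_lie_algebra
begin

definition fin_basis :: "'g set" where
  "fin_basis = (SOME B. finite B \<and> independent B \<and> span B = UNIV)"

lemma fin_basis: "finite fin_basis" "independent fin_basis" "span fin_basis = UNIV"
proof -
  obtain S where S: "finite S" "span S = UNIV" using finite_dimensional by blast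
  obtain B where "B \<subseteq> S" "independent B" "S \<subseteq> span B"
    using maximal_independent_subset by blast
  then have "finite B \<and> independent B \<and> span B = UNIV"
    using S finite_subset by (metis span_mono span_span top.extremum_uniqueI)
  then show "finite fin_basis" "independent fin_basis" "span fin_basis = UNIV"
    unfolding fin_basis_def by (metis (mono_tags, lifting) someI_ex)+
qed

sublocale finite_dimensional_vector_space scale fin_basis
  by unfold_locales (use fin_basis in auto)

lemma linear_bracket: "Vector_Spaces.linear scale scale (bracket x)"
  by unfold_locales (auto simp: bracket_add_right bracket_scale_right)

lemma linear_bracket_left: "Vector_Spaces.linear scale scale (\<lambda>x. bracket x y)"
  by unfold_locales (auto simp: bracket_add_left bracket_scale_left)

lemma linear_bracket_comp: "Vector_Spaces.linear scale scale (bracket x \<circ> bracket y)"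
  using linear_bracket Vector_Spaces.linear_compose by blast

sublocale bracket_right: Vector_Spaces.linear scale scale "bracket x" for x
  by (rule linear_bracket)

sublocale bracket_left: Vector_Spaces.linear scale scale "\<lambda>x. bracket x y" for y
  by (rule linear_bracket_left)

lemma bracket_anticommute: "bracket x y = - bracket y x"
proof -
  have "bracket x y + bracket y x = bracket (x + y) (x + y) - bracket x x - bracket y y"
    unfolding bracket_add_left bracket_add_right by simp
  then have "bracket x y + bracket y x = 0"
    by (simp add: bracket_self)
  then show ?thesis by (simp add: eq_neg_iff_add_eq_0)
qed

lemma bracket_bracket_left:
  "bracket (bracket x y) z = bracket x (bracket y z) - bracket y (bracket x z)"
  using jacobi[of x y z] bracket_anticommute[of "bracket x y" z] bracket_anticommute[of z x]
    bracket_right.neg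
  by (simp add: algebra_simps)

lemma bracket_derivation:
  "bracket x (bracket y z) = bracket (bracket x y) z + bracket y (bracket x z)"
  by (simp add: bracket_bracket_left)

lemma op_trace_eq_trace_on:
  assumes "Vector_Spaces.linear scale scale f" "independent B" "span B = UNIV"
  shows "op_trace f = trace_on B f"
proof -
  define C where "C = (SOME B. independent B \<and> span B = UNIV)"
  have C: "independent C \<and> span C = UNIV"
    unfolding C_def using fin_basis by (metis (mono_tags, lifting) someI_ex)
  have "op_trace f = trace_on C f"
    unfolding op_trace_def trace_on_def C_def[symmetric] Let_def ..
  also have "\<dots> = trace_on B f"
    using assms C by (intro trace_on_basis_cong) (auto intro: finiteI_independent)
  finally show ?thesis .
qed

text \<open>By Jacobi, ad [x, y] is the commutator of two maps that preserve \<open>span B\<close>,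
  so its trace there is 0; an eigenbasis turns this trace into the sum of the eigenvalues. Every
  relation between values of roots below is an instance.\<close>

lemma sum_eigenvalues_commutator:
  assumes "independent B" "bracket x ` B \<subseteq> span B" "bracket y ` B \<subseteq> span B"
    and "\<And>b. b \<in> B \<Longrightarrow> bracket (bracket x y) b = c b *s b"
  shows "sum c B = 0"
proof -
  have stab: "bracket z u \<in> span B" if "bracket z ` B \<subseteq> span B" "u \<in> span B" for z u
    using that bracket_right.span_image[of z B]
    by (metis image_eqI span_minimal subset_iff subspace_span)
  have "sum c B = trace_on B (bracket (bracket x y))"
    by (rule trace_on_eigenbasis[symmetric]) (use assms in auto)
  also have "\<dots> = trace_on B (\<lambda>z. (bracket x \<circ> bracket y) z - (bracket y \<circ> bracket x) z)"
    by (simp add: bracket_bracket_left[abs_def])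
  also have "\<dots> = trace_on B (bracket x \<circ> bracket y) - trace_on B (bracket y \<circ> bracket x)"
    using assms stab by (intro trace_on_diff) (auto simp: image_subset_iff)
  also have "\<dots> = 0"
    using trace_on_comp_commute[of "bracket x" "bracket y" B] assms
    by (simp add: linear_bracket finiteI_independent)
  finally show ?thesis .
qed

lemma subspace_root_space: "subspace (root_space H c)"
  unfolding root_space_def
  by (auto intro!: subspaceI simp: bracket_right.add bracket_right.scale algebra_simps)

text \<open>Separating weights one at a time, as with a Vandermonde determinant. \<open>H\<close> is
  arbitrary because the lemma serves a single operator (\<open>H = {h}\<close>) as well as all of
  \<open>t\<close>.\<close>

lemma graded_component:
  assumes "finite C" "subspace U" "\<And>h u. h \<in> H \<Longrightarrow> u \<in> U \<Longrightarrow> bracket h u \<in> U"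
    and "\<And>c d. c \<in> C \<Longrightarrow> d \<in> C \<Longrightarrow> c \<noteq> d \<Longrightarrow> \<exists>h\<in>H. c h \<noteq> d h"
    and "\<And>c. c \<in> C \<Longrightarrow> v c \<in> root_space H c" "(\<Sum>c\<in>C. v c) \<in> U" "c \<in> C"
  shows "v c \<in> U"
  using assms(1,4-)
proof (induction C arbitrary: v c rule: finite_induct)
  case empty
  then show ?case by simp
next
  case (insert d C)
  have comp: "v c \<in> U" if c: "c \<in> C" for c
  proof -
    obtain h where h: "h \<in> H" "c h \<noteq> d h" using insert.prems(1)[of c d] insert.hyps c by auto
    \<comment> \<open>Applying ad h - d(h) preserves \<open>U\<close>, kills the component at
      \<open>d\<close> and multiplies the one at \<open>c\<close> by a nonzero scalar.\<close>
    have "(\<Sum>e\<in>insert d C. (e h - d h) *s v e) = bracket h (\<Sum>e\<in>insert d C. v e) - d h *s (\<Sum>e\<in>insert d C. v e)"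
    proof -
      have "bracket h (v e) = e h *s v e" if "e \<in> insert d C" for e
        using insert.prems(2)[OF that] h by (auto simp: root_space_def)
      then show ?thesis
        unfolding bracket_right.sum scale_sum_right sum_subtractf[symmetric]
        by (intro sum.cong) (auto simp: scale_left_diff_distrib)
    qed
    also have "\<dots> \<in> U"
      using insert.prems(3) h assms(2,3) by (auto intro!: subspace_diff subspace_scale)
    finally have "(\<Sum>e\<in>C. (e h - d h) *s v e) \<in> U"
      using insert.hyps by simp
    then have "(c h - d h) *s v c \<in> U"
      using insert.prems c
      by (intro insert.IH[of "\<lambda>e. (e h - d h) *s v e" c])
        (auto intro!: subspace_scale[OF subspace_root_space])
    then have "(1 / (c h - d h)) *s (c h - d h) *s v c \<in> U"
      using assms(2) subspace_scale by blast
    then show ?thesis using h by simp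
  qed
  have "(\<Sum>e\<in>insert d C. v e) - (\<Sum>e\<in>C. v e) \<in> U"
    by (intro subspace_diff[OF assms(2) insert.prems(3)] subspace_sum[OF assms(2)] comp)
  then have "v d \<in> U" using insert.hyps by simp
  then show ?case using comp insert.prems(4) by auto
qed

text \<open>Jacobson's form of Engel's theorem: bracket-closed sets of ad-nilpotent elements suffice, no
  subalgebra is needed.  The property \<open>engel_set\<close> is a common-kernel statement modulo \<open>U\<close>
  that survives enlarging \<open>F\<close>.\<close>

definition engel_set :: "'g set \<Rightarrow> bool" where
  "engel_set F \<longleftrightarrow> (\<forall>U S. subspace U \<longrightarrow> (\<forall>f\<in>F. \<forall>u\<in>U. bracket f u \<in> U) \<longrightarrow>
     (\<forall>f\<in>F. \<forall>s\<in>S. bracket f s \<in> S) \<longrightarrow> \<not> S \<subseteq> U \<longrightarrow>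
     (\<exists>w\<in>S - U. \<forall>f\<in>F. bracket f w \<in> U))"

lemma engel_setD:
  assumes "engel_set F" "subspace U" "\<And>f u. f \<in> F \<Longrightarrow> u \<in> U \<Longrightarrow> bracket f u \<in> U"
    and "\<And>f s. f \<in> F \<Longrightarrow> s \<in> S \<Longrightarrow> bracket f s \<in> S" "\<not> S \<subseteq> U"
  shows "\<exists>w\<in>S - U. \<forall>f\<in>F. bracket f w \<in> U"
  using assms unfolding engel_set_def by simp

lemma engel_set_empty: "engel_set {}"
  unfolding engel_set_def by auto

text \<open>Since \<open>a\<close> normalizes \<open>F\<close>, the vectors of \<open>S\<close>
  killed by \<open>F\<close> modulo \<open>U\<close> are stable under ad a. Nilpotency of ad a then
  supplies one among them that ad a kills modulo \<open>U\<close> as well.\<close>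

lemma engel_set_insert:
  assumes F: "engel_set F" and a: "\<And>f. f \<in> F \<Longrightarrow> bracket f a \<in> F"
    and nil: "\<And>v. \<exists>n. (bracket a ^^ n) v = 0"
  shows "engel_set (insert a F)"
  unfolding engel_set_def
proof (intro allI impI)
  fix U S
  assume U: "subspace U" and stU: "\<forall>f\<in>insert a F. \<forall>u\<in>U. bracket f u \<in> U"
    and stS: "\<forall>f\<in>insert a F. \<forall>s\<in>S. bracket f s \<in> S" and "\<not> S \<subseteq> U"
  define T where "T = {w\<in>S. \<forall>f\<in>F. bracket f w \<in> U}"
  have "\<exists>w\<in>S - U. \<forall>f\<in>F. bracket f w \<in> U"
    using U stU stS \<open>\<not> S \<subseteq> U\<close> by (intro engel_setD[OF F]) auto
  then obtain w where w: "w \<in> T" "w \<notin> U"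
    unfolding T_def by auto
  have T_stable: "bracket a u \<in> T" if u: "u \<in> T" for u
  proof -
    have "bracket f (bracket a u) \<in> U" if f: "f \<in> F" for f
    proof -
      have "bracket (bracket f a) u \<in> U" "bracket a (bracket f u) \<in> U"
        using a f u stU unfolding T_def by auto
      then show ?thesis by (subst bracket_derivation) (use U subspace_add in blast)
    qed
    then show ?thesis using u stS unfolding T_def by auto
  qed
  have pow: "(bracket a ^^ n) w \<in> T" for n
    by (induction n) (auto simp: w T_stable)
  have ex: "\<exists>n. (bracket a ^^ n) w \<in> U"
    using nil[of w] U subspace_0 by metis
  \<comment> \<open>The witness is the last power of ad a applied to \<open>w\<close> that is still
    outside \<open>U\<close>; \<open>n\<close> is positive because \<open>w\<close> itself is
    outside.\<close>
  define n where "n = (LEAST n. (bracket a ^^ n) w \<in> U)"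
  have n: "(bracket a ^^ n) w \<in> U" unfolding n_def using ex by (rule LeastI_ex)
  with w obtain m where m: "n = Suc m" by (cases n) auto
  then have "(bracket a ^^ m) w \<notin> U"
    unfolding n_def by (metis lessI not_less_Least)
  then show "\<exists>w\<in>S - U. \<forall>f\<in>insert a F. bracket f w \<in> U"
    using pow[of m] n m unfolding T_def by (intro bexI[of _ "(bracket a ^^ m) w"]) auto
qed

text \<open>For a fixed \<open>w\<close>, sending \<open>w\<close> into \<open>U\<close> is a linear
  condition on the operator, so it passes from \<open>F\<close> to its span.\<close>

lemma engel_set_span:
  assumes F: "engel_set F" and "F \<subseteq> G" "G \<subseteq> span F"
  shows "engel_set G"
  unfolding engel_set_def
proof (intro allI impI)
  fix U S
  assume U: "subspace U" and "\<forall>f\<in>G. \<forall>u\<in>U. bracket f u \<in> U"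
    and "\<forall>f\<in>G. \<forall>s\<in>S. bracket f s \<in> S" and "\<not> S \<subseteq> U"
  then have "\<exists>w\<in>S - U. \<forall>f\<in>F. bracket f w \<in> U"
    using \<open>F \<subseteq> G\<close> by (intro engel_setD[OF F]) auto
  then obtain w where w: "w \<in> S - U" "\<forall>f\<in>F. bracket f w \<in> U"
    by blast
  have "span F \<subseteq> {f. bracket f w \<in> U}"
    using w U by (intro span_minimal bracket_left.subspace_linear_preimage) auto
  then show "\<exists>w\<in>S - U. \<forall>f\<in>G. bracket f w \<in> U"
    using w \<open>G \<subseteq> span F\<close> by blast
qed

lemma bracket_span_closed:
  assumes "\<And>x y. x \<in> X \<Longrightarrow> y \<in> Y \<Longrightarrow> bracket x y \<in> U" "subspace U"
    and "x \<in> span X" "y \<in> span Y"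
  shows "bracket x y \<in> U"
proof -
  have "span Y \<subseteq> {y. bracket x y \<in> U}" if "x \<in> X" for x
    using assms that by (intro span_minimal bracket_right.subspace_linear_preimage) auto
  then have "span X \<subseteq> {x. bracket x y \<in> U}"
    using assms by (intro span_minimal bracket_left.subspace_linear_preimage) auto
  then show ?thesis using assms by auto
qed

text \<open>Take a bracket-closed Engel subset \<open>F\<close> of \<open>E\<close> whose span has
  maximal dimension. If \<open>E\<close> were not inside that span, the Engel property of
  \<open>F\<close> itself would produce an element by which \<open>F\<close> could be
  enlarged.\<close>

lemma engel_set_nilpotent:
  assumes closed: "\<And>x y. x \<in> E \<Longrightarrow> y \<in> E \<Longrightarrow> bracket x y \<in> E"
    and nil: "\<And>x v. x \<in> E \<Longrightarrow> \<exists>n. (bracket x ^^ n) v = 0"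
  shows "engel_set E"
proof -
  define good where "good F \<longleftrightarrow> F \<subseteq> E \<and> (\<forall>x\<in>F. \<forall>y\<in>F. bracket x y \<in> F) \<and> engel_set F" for F
  have "good {}" by (simp add: good_def engel_set_empty)
  moreover have "\<forall>F. good F \<longrightarrow> dim F < Suc dimension"
    using dim_subset_UNIV by (auto simp: less_Suc_eq_le)
  ultimately obtain F where F: "good F" and max: "\<And>G. good G \<Longrightarrow> dim G \<le> dim F"
    using ex_has_greatest_nat[of good "{}" dim] by blast
  have FE: "F \<subseteq> E" and engF: "engel_set F"
    using F by (auto simp: good_def)
  have "E \<subseteq> span F"
  proof (rule ccontr)
    assume "\<not> E \<subseteq> span F"
    have span_closed: "bracket x y \<in> span F" if "x \<in> span F" "y \<in> span F" for x y
      by (rule bracket_span_closed[OF _ _ that]) (use F in \<open>simp_all add: good_def span_base\<close>)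
    \<comment> \<open>The Engel property is used with \<open>S = E\<close> and
      \<open>U = span F\<close>: the common kernel vector modulo \<open>span F\<close> is an element
      \<open>a\<close> of \<open>E\<close> that normalizes \<open>span F\<close>.\<close>
    have "\<exists>a\<in>E - span F. \<forall>f\<in>F. bracket f a \<in> span F"
      using F closed \<open>\<not> E \<subseteq> span F\<close> span_closed unfolding good_def
      by (intro engel_setD) (auto simp: span_base subset_iff)
    then obtain a where a: "a \<in> E - span F" "\<forall>f\<in>F. bracket f a \<in> span F"
      by blast
    \<comment> \<open>Brackets of \<open>F\<close> with \<open>a\<close> are only known to lie in
      \<open>span F\<close>. Cutting the span back to \<open>E\<close> gives a set that
      \<open>a\<close> normalizes and whose elements are still ad-nilpotent.\<close>
    define G where "G = E \<inter> span F"
    have aG: "bracket f a \<in> span F" if "f \<in> span F" for f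
    proof -
      have "span F \<subseteq> {f. bracket f a \<in> span F}"
        using a by (intro span_minimal bracket_left.subspace_linear_preimage) auto
      then show ?thesis using that by auto
    qed
    have FG: "F \<subseteq> G" unfolding G_def using FE span_superset by auto
    have "engel_set G"
      by (rule engel_set_span[OF engF FG]) (simp add: G_def)
    then have "engel_set (insert a G)"
      using a aG nil closed unfolding G_def by (intro engel_set_insert) auto
    moreover have "bracket a f \<in> G" if "f \<in> G" for f
    proof -
      have "bracket a f \<in> E" using that a closed unfolding G_def by auto
      moreover have "bracket a f \<in> span F"
        using that aG[of f] span_neg unfolding G_def by (subst bracket_anticommute) auto
      ultimately show ?thesis unfolding G_def by simp
    qed
    moreover have "bracket f a \<in> G" if "f \<in> G" for f
      using that a closed aG unfolding G_def by auto
    moreover have "bracket a a \<in> G"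
      using a closed[of a a] unfolding G_def by (auto simp: bracket_self span_zero)
    moreover have "bracket x y \<in> G" if "x \<in> G" "y \<in> G" for x y
      using that closed span_closed unfolding G_def by auto
    ultimately have "good (insert a G)"
      using a unfolding good_def by (simp add: G_def)
    then have "dim (insert a G) \<le> dim F" by (rule max)
    moreover have "dim (insert a F) \<le> dim (insert a G)"
      using FG by (intro dim_subset) auto
    ultimately show False
      using a by (simp add: dim_insert)
  qed
  then show ?thesis using engel_set_span[OF engF FE] by simp
qed

end


section \<open>Root space decomposition and nondegeneracy of the Killing form\<close>

context complex_vector_space
begin

lemma span_Union_sumE:
  assumes "x \<in> span (\<Union>i\<in>I. S i)" "\<And>i. i \<in> I \<Longrightarrow> subspace (S i)"
  obtains J v where "finite J" "J \<subseteq> I" "\<And>j. j \<in> J \<Longrightarrow> v j \<in> S j" "x = (\<Sum>j\<in>J. v j)"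
proof -
  have "\<exists>J v. finite J \<and> J \<subseteq> I \<and> (\<forall>j\<in>J. v j \<in> S j) \<and> x = (\<Sum>j\<in>J. v j)"
    using assms(1)
  proof (induction rule: span_induct_alt)
    case base
    show ?case by (rule exI[of _ "{}"]) simp
  next
    case (step c x y)
    then obtain J v i where J: "finite J" "J \<subseteq> I" "\<forall>j\<in>J. v j \<in> S j" "y = (\<Sum>j\<in>J. v j)"
      and i: "i \<in> I" "x \<in> S i" by auto
    define w where "w = (\<lambda>j. (if j = i then c *s x else 0) + (if j \<in> J then v j else 0))"
    have "(\<Sum>j\<in>insert i J. w j) = c *s x + y"
      unfolding w_def sum.distrib using J
      by (simp add: sum.If_cases Int_insert_left sum.delta' insert_absorb)
    moreover have "w j \<in> S j" if "j \<in> insert i J" for j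
      using that i J assms(2) unfolding w_def
      by (intro subspace_add) (auto intro: subspace_scale subspace_0)
    ultimately show ?case
      using J i by (intro exI[of _ "insert i J"] exI[of _ w]) auto
  qed
  then show ?thesis using that by blast
qed

lemma dual_zero: "0 \<in> dual V"
  by (auto simp: dual_def)

lemma dual_add: "\<phi> \<in> dual V \<Longrightarrow> \<psi> \<in> dual V \<Longrightarrow> \<phi> + \<psi> \<in> dual V"
  by (auto simp: dual_def algebra_simps)

lemma dual_fscale: "\<phi> \<in> dual V \<Longrightarrow> fscale c \<phi> \<in> dual V"
  by (auto simp: dual_def fscale_def algebra_simps)

lemma dual_uminus: "\<phi> \<in> dual V \<Longrightarrow> - \<phi> \<in> dual V"
  by (auto simp: dual_def)

lemma dual_diff: "\<phi> \<in> dual V \<Longrightarrow> \<psi> \<in> dual V \<Longrightarrow> \<phi> - \<psi> \<in> dual V"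
  by (auto simp: dual_def algebra_simps)

lemma dual_sum: "(\<And>i. i \<in> I \<Longrightarrow> f i \<in> dual V) \<Longrightarrow> sum f I \<in> dual V"
  by (induction I rule: infinite_finite_induct) (auto simp: dual_zero dual_add)

lemma dual_eqI:
  assumes "\<phi> \<in> dual V" "\<psi> \<in> dual V" "\<And>x. x \<in> V \<Longrightarrow> \<phi> x = \<psi> x"
  shows "\<phi> = \<psi>"
  using assms unfolding dual_def by (intro ext) (metis (mono_tags, lifting) mem_Collect_eq)

end

context complex_lie_algebra
begin

lemma root_space_bracket:
  assumes "x \<in> root_space H \<alpha>" "y \<in> root_space H \<beta>"
  shows "bracket x y \<in> root_space H (\<alpha> + \<beta>)"
  using assms unfolding root_space_def
  by (auto simp: bracket_derivation[of _ x y] bracket_scale_left bracket_scale_right scale_left_distrib)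

text \<open>Simultaneous diagonalization. As \<open>h\<close> commutes with \<open>H\<close>, it
  preserves each weight space of \<open>H\<close>; hence the \<open>h\<close>-eigencomponents of a
  vector in such a space stay in it.\<close>

lemma span_weight_spaces:
  assumes "finite H" "\<And>h. h \<in> H \<Longrightarrow> diagonalizable (bracket h)"
    and "\<And>h k. h \<in> H \<Longrightarrow> k \<in> H \<Longrightarrow> bracket h k = 0"
  shows "span (\<Union>c. root_space H c) = UNIV"
  using assms
proof (induction H rule: finite_induct)
  case empty
  then show ?case by (simp add: root_space_def)
next
  case (insert h H)
  have "root_space H c \<subseteq> span (\<Union>c. root_space (insert h H) c)" for c
  proof
    fix x assume x: "x \<in> root_space H c"
    define S where "S = (\<lambda>d::'g \<Rightarrow> complex. root_space {h} d)"
    \<comment> \<open>Eigenvalues of the single operator ad h are encoded as constant functions, so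
      that distinct labels differ at \<open>h\<close>, as \<open>graded_component\<close>
      demands.\<close>
    have "{x. \<exists>c. bracket h x = c *s x} \<subseteq> (\<Union>d\<in>range (\<lambda>c _. c). S d)"
      unfolding S_def by (auto simp: root_space_def)
    then have "x \<in> span (\<Union>d\<in>range (\<lambda>c _. c). S d)"
      using insert.prems(1)[of h] span_mono unfolding diagonalizable_def by blast
    then obtain J v where J: "finite J" "J \<subseteq> range (\<lambda>c _. c)" "\<And>j. j \<in> J \<Longrightarrow> v j \<in> S j"
      "x = (\<Sum>j\<in>J. v j)"
      by (rule span_Union_sumE) (auto simp: S_def subspace_root_space)
    have "v j \<in> root_space (insert h H) (c(h := j h))" if j: "j \<in> J" for j
    proof -
      have "v j \<in> root_space H c"
      proof (rule graded_component[OF J(1) subspace_root_space])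
        fix g u assume "g \<in> {h}" and u: "u \<in> root_space H c"
        then show "bracket g u \<in> root_space H c"
          using insert.prems(2) unfolding root_space_def
          by (auto simp: bracket_derivation[of _ h u] bracket_scale_right)
      next
        fix d e assume de: "d \<in> J" "e \<in> J" "d \<noteq> e"
        have "d \<in> range (\<lambda>c _. c)" "e \<in> range (\<lambda>c _. c)" using J(2) de by auto
        then show "\<exists>g\<in>{h}. d g \<noteq> e g" using de(3) by (auto simp: image_iff)
      next
        show "v j \<in> root_space {h} j" if "j \<in> J" for j using J(3)[OF that] by (simp add: S_def)
      qed (use J x j in auto)
      then show ?thesis
        using J(3)[OF j] insert.hyps unfolding S_def root_space_def by auto
    qed
    then show "x \<in> span (\<Union>c. root_space (insert h H) c)"
      unfolding J(4) by (intro span_sum span_base) auto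
  qed
  then have "span (\<Union>c. root_space H c) \<subseteq> span (\<Union>c. root_space (insert h H) c)"
    by (intro span_minimal) auto
  then show ?case using insert by auto
qed

section \<open>The Killing form: bilinearity, symmetry, invariance\<close>

lemma killing_eq_trace_on:
  assumes "independent B" "span B = UNIV"
  shows "killing x y = trace_on B (bracket x \<circ> bracket y)"
  unfolding killing_def using assms linear_bracket_comp by (rule_tac op_trace_eq_trace_on) auto

lemmas killing_eq_trace = killing_eq_trace_on[OF fin_basis(2,3)]

lemma killing_add_left: "killing (x + y) z = killing x z + killing y z"
  unfolding killing_eq_trace trace_on_def
  by (simp add: bracket_add_left representation_add fin_basis sum.distrib)

lemma killing_scale_left: "killing (c *s x) z = c * killing x z"
  unfolding killing_eq_trace trace_on_def
  by (simp add: bracket_scale_left representation_scale fin_basis sum_distrib_left)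

lemma killing_commute: "killing x y = killing y x"
  unfolding killing_eq_trace
  by (rule trace_on_comp_commute) (use linear_bracket fin_basis in auto)

lemma killing_add_right: "killing z (x + y) = killing z x + killing z y"
  by (simp add: killing_commute[of z] killing_add_left)

lemma killing_scale_right: "killing z (c *s x) = c * killing z x"
  by (simp add: killing_commute[of z] killing_scale_left)

lemma killing_zero: "killing 0 x = 0" "killing x 0 = 0"
  using killing_scale_left[of 0 0 x] by (simp_all add: killing_commute[of x])

lemma killing_uminus: "killing (- x) y = - killing x y"
  using killing_add_left[of x "- x" y] by (simp add: killing_zero add_eq_0_iff)

lemma killing_diff_left: "killing (x - y) z = killing x z - killing y z"
  using killing_add_left[of x "- y" z] by (simp add: killing_uminus)

lemma killing_sum_left: "killing (sum f I) z = (\<Sum>i\<in>I. killing (f i) z)"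
  by (induction I rule: infinite_finite_induct) (auto simp: killing_zero killing_add_left)

lemma killing_sum_right: "killing z (sum f I) = (\<Sum>i\<in>I. killing z (f i))"
  by (simp add: killing_commute[of z] killing_sum_left)

lemma killing_invariant: "killing (bracket x y) z = killing x (bracket y z)"
proof -
  let ?tr = "trace_on fin_basis"
  have "killing (bracket x y) z = ?tr (\<lambda>u. bracket x (bracket y (bracket z u)) - bracket y (bracket x (bracket z u)))"
    unfolding killing_eq_trace by (simp add: comp_def bracket_bracket_left[abs_def])
  also have "\<dots> = ?tr (\<lambda>u. bracket x (bracket y (bracket z u))) - ?tr (\<lambda>u. bracket y (bracket x (bracket z u)))"
    by (rule trace_on_diff) (auto simp: fin_basis)
  \<comment> \<open>Cyclicity of the trace moves ad y to the end, after which the difference is ad x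
    composed with ad [y, z].\<close>
  also have "?tr (\<lambda>u. bracket y (bracket x (bracket z u))) = ?tr (\<lambda>u. bracket x (bracket z (bracket y u)))"
    using trace_on_comp_commute[OF linear_bracket linear_bracket_comp, of fin_basis y x z] fin_basis
    by (simp add: comp_def)
  also have "?tr (\<lambda>u. bracket x (bracket y (bracket z u))) - \<dots>
      = ?tr (\<lambda>u. bracket x (bracket y (bracket z u)) - bracket x (bracket z (bracket y u)))"
    by (rule trace_on_diff[symmetric]) (auto simp: fin_basis)
  also have "\<dots> = killing x (bracket y z)"
    unfolding killing_eq_trace by (simp add: comp_def bracket_bracket_left[abs_def] bracket_right.diff)
  finally show ?thesis .
qed

end

section \<open>The decomposition of the Lie algebra under a Cartan subalgebra\<close>

locale cartan_lie_algebra = complex_lie_algebra scale bracket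
  for scale :: "complex \<Rightarrow> 'g::ab_group_add \<Rightarrow> 'g" (infixr \<open>*s\<close> 75)
    and bracket :: "'g \<Rightarrow> 'g \<Rightarrow> 'g" +
  fixes t :: "'g set"
  assumes is_semisimple: semisimple
    and is_cartan: "cartan_subalgebra t"
begin

abbreviation rsp :: "('g \<Rightarrow> complex) \<Rightarrow> 'g set" where
  "rsp \<equiv> root_space t"

abbreviation \<Phi> :: "('g \<Rightarrow> complex) set" where
  "\<Phi> \<equiv> roots t"

lemma subspace_cartan: "subspace t"
  and bracket_cartan: "h \<in> t \<Longrightarrow> k \<in> t \<Longrightarrow> bracket h k = 0"
  and diagonalizable_cartan: "h \<in> t \<Longrightarrow> diagonalizable (bracket h)"
  using is_cartan unfolding cartan_subalgebra_def abelian_subalgebra_def by auto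

lemma root_dual: "\<alpha> \<in> \<Phi> \<Longrightarrow> \<alpha> \<in> dual t"
  and root_nonzero: "\<alpha> \<in> \<Phi> \<Longrightarrow> \<alpha> \<noteq> 0"
  by (auto simp: roots_def)

text \<open>A vector that commutes with \<open>t\<close> spans, together with \<open>t\<close>, an
  abelian subalgebra; maximality of \<open>t\<close> absorbs it.\<close>

lemma root_space_zero: "rsp 0 = t"
proof
  show "t \<subseteq> rsp 0" by (auto simp: root_space_def bracket_cartan)
  show "rsp 0 \<subseteq> t"
  proof
    fix x assume "x \<in> rsp 0"
    then have tx: "bracket h x = 0" if "h \<in> t" for h
      using that by (auto simp: root_space_def)
    have "bracket y z \<in> {0}" if "y \<in> insert x t" "z \<in> insert x t" for y z
      using that tx bracket_cartan by (auto simp: bracket_self bracket_anticommute[of x])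
    then have "bracket y z \<in> {0}" if "y \<in> span (insert x t)" "z \<in> span (insert x t)" for y z
      using bracket_span_closed[OF _ subspace_single_0 that] by blast
    then have "abelian_subalgebra (span (insert x t))"
      unfolding abelian_subalgebra_def by auto
    moreover have "t \<subseteq> span (insert x t)"
      using span_superset by blast
    ultimately have "span (insert x t) = t"
      using is_cartan unfolding cartan_subalgebra_def by blast
    then show "x \<in> t" using span_base[of x "insert x t"] by simp
  qed
qed

text \<open>The elements of \<open>t\<close> having \<open>x\<close> as an eigenvector form a
  subspace, and the eigenvalue depends linearly on the element because \<open>x\<close> is nonzero.
  This turns labels on a finite basis \<open>H\<close> into genuine weights on
  \<open>t\<close>.\<close>

lemma weight_vector_lift:
  assumes H: "span H = t" and x: "x \<in> root_space H c" "x \<noteq> 0"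
  shows "\<exists>\<alpha>\<in>dual t. x \<in> rsp \<alpha>"
proof -
  have "subspace {h. \<exists>a. bracket h x = a *s x}"
  proof (rule subspaceI)
    show "0 \<in> {h. \<exists>a. bracket h x = a *s x}" by (auto intro!: exI[of _ 0])
  qed (auto simp: bracket_left.add bracket_left.scale scale_left_distrib[symmetric] intro: exI)
  then have "span H \<subseteq> {h. \<exists>a. bracket h x = a *s x}"
    using x by (intro span_minimal) (auto simp: root_space_def)
  then have "\<forall>h\<in>t. \<exists>a. bracket h x = a *s x"
    using H by auto
  then obtain f where f: "\<And>h. h \<in> t \<Longrightarrow> bracket h x = f h *s x"
    using bchoice[of t "\<lambda>h a. bracket h x = a *s x"] by blast
  \<comment> \<open>Members of \<open>dual t\<close> are normalized to be 0 outside
    \<open>t\<close>.\<close>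
  define \<alpha> where "\<alpha> h = (if h \<in> t then f h else 0)" for h
  have "f (h + k) = f h + f k" if "h \<in> t" "k \<in> t" for h k
  proof -
    have "f (h + k) *s x = (f h + f k) *s x"
      using that subspace_cartan by (simp add: f[symmetric] subspace_add bracket_add_left scale_left_distrib)
    then show ?thesis using x by simp
  qed
  moreover have "f (a *s h) = a * f h" if "h \<in> t" for h a
  proof -
    have "f (a *s h) *s x = (a * f h) *s x"
      using that subspace_cartan by (simp add: f[symmetric] subspace_scale bracket_scale_left flip: scale_scale)
    then show ?thesis using x by simp
  qed
  ultimately have "\<alpha> \<in> dual t"
    unfolding dual_def \<alpha>_def using subspace_cartan by (auto simp: subspace_add subspace_scale)
  moreover have "x \<in> rsp \<alpha>"
    unfolding root_space_def \<alpha>_def using f by auto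
  ultimately show ?thesis by blast
qed

lemma span_root_spaces: "span (\<Union>\<alpha>\<in>insert 0 \<Phi>. rsp \<alpha>) = UNIV"
proof -
  obtain H where H: "H \<subseteq> t" "independent H" "span H = t"
    using basis_subspace_exists[OF subspace_cartan] by metis
  have "span (\<Union>c. root_space H c) = UNIV"
    by (intro span_weight_spaces)
      (use H in \<open>auto intro: finiteI_independent diagonalizable_cartan bracket_cartan\<close>)
  moreover have "root_space H c \<subseteq> span (\<Union>\<alpha>\<in>insert 0 \<Phi>. rsp \<alpha>)" for c
  proof
    fix x assume x: "x \<in> root_space H c"
    show "x \<in> span (\<Union>\<alpha>\<in>insert 0 \<Phi>. rsp \<alpha>)"
    proof (cases "x = 0")
      case True
      then show ?thesis by (simp add: span_zero)
    next
      case False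
      then obtain \<alpha> where "\<alpha> \<in> dual t" "x \<in> rsp \<alpha>"
        using weight_vector_lift H x by blast
      then have "x \<in> (\<Union>\<alpha>\<in>insert 0 \<Phi>. rsp \<alpha>)"
        using False unfolding roots_def by auto
      then show ?thesis by (rule span_base)
    qed
  qed
  then have "span (\<Union>c. root_space H c) \<subseteq> span (\<Union>\<alpha>\<in>insert 0 \<Phi>. rsp \<alpha>)"
    by (intro span_minimal) auto
  ultimately show ?thesis by auto
qed

lemma weights_distinct:
  assumes "\<alpha> \<in> dual t" "\<beta> \<in> dual t" "\<alpha> \<noteq> \<beta>"
  shows "\<exists>h\<in>t. \<alpha> h \<noteq> \<beta> h"
  using dual_eqI assms by blast

lemma weight_unique:
  assumes "x \<in> rsp \<alpha>" "x \<in> rsp \<beta>" "x \<noteq> 0" "\<alpha> \<in> dual t" "\<beta> \<in> dual t"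
  shows "\<alpha> = \<beta>"
proof (rule dual_eqI[OF assms(4,5)])
  fix h assume "h \<in> t"
  then have "\<alpha> h *s x = \<beta> h *s x" using assms by (auto simp: root_space_def)
  then show "\<alpha> h = \<beta> h" using assms by simp
qed

lemma weight_components:
  assumes "finite C" "C \<subseteq> dual t" "\<And>c. c \<in> C \<Longrightarrow> v c \<in> rsp c"
    and "subspace U" "\<And>h u. h \<in> t \<Longrightarrow> u \<in> U \<Longrightarrow> bracket h u \<in> U" "(\<Sum>c\<in>C. v c) \<in> U" "c \<in> C"
  shows "v c \<in> U"
  by (rule graded_component[OF assms(1,4,5) _ assms(3,6,7)]) (use assms(2) in \<open>auto intro: weights_distinct\<close>)

lemma independent_weight_vectors:
  assumes "C \<subseteq> dual t" "\<And>c. c \<in> C \<Longrightarrow> v c \<in> rsp c" "\<And>c. c \<in> C \<Longrightarrow> v c \<noteq> 0"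
  shows "inj_on v C" "independent (v ` C)"
proof -
  show inj: "inj_on v C"
    using assms weight_unique by (intro inj_onI) (metis subset_iff)
  show "independent (v ` C)"
    unfolding independent_explicit_module
  proof (intro allI impI)
    fix T u x
    assume T: "finite T" "T \<subseteq> v ` C" "(\<Sum>x\<in>T. u x *s x) = 0" "x \<in> T"
    then obtain D where D: "D \<subseteq> C" "finite D" "T = v ` D"
      using finite_subset_image[OF T(1,2)] by blast
    have "(\<Sum>c\<in>D. u (v c) *s v c) = 0"
      using T(3) D inj by (simp add: sum.reindex inj_on_subset)
    \<comment> \<open>A vanishing combination lies in the stable subspace {0}, hence so does each of
      its weight components.\<close>
    then have sum0: "(\<Sum>c\<in>D. u (v c) *s v c) \<in> {0}" by simp
    have "u (v c) *s v c \<in> {0}" if "c \<in> D" for c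
    proof (rule weight_components[OF D(2) _ _ _ _ sum0 that])
      show "D \<subseteq> dual t" using D assms(1) by auto
      show "u (v c) *s v c \<in> rsp c" if "c \<in> D" for c
        using assms(2) D that by (intro subspace_scale[OF subspace_root_space]) auto
    qed auto
    then show "u x = 0" using T(4) D assms(3) by auto
  qed
qed

lemma finite_roots: "finite \<Phi>"
proof -
  have "\<exists>x. x \<in> rsp \<alpha> \<and> x \<noteq> 0" if "\<alpha> \<in> \<Phi>" for \<alpha>
    using that subspace_0[OF subspace_root_space] unfolding roots_def by blast
  then obtain v where v: "\<And>\<alpha>. \<alpha> \<in> \<Phi> \<Longrightarrow> v \<alpha> \<in> rsp \<alpha> \<and> v \<alpha> \<noteq> 0"
    by metis
  have "finite (v ` \<Phi>)" "inj_on v \<Phi>"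
    using independent_weight_vectors[of \<Phi> v] v root_dual finiteI_independent by auto
  then show ?thesis by (rule finite_imageD)
qed

lemma weight_decomposition:
  obtains v where "\<And>\<alpha>. \<alpha> \<in> insert 0 \<Phi> \<Longrightarrow> v \<alpha> \<in> rsp \<alpha>" "x = (\<Sum>\<alpha>\<in>insert 0 \<Phi>. v \<alpha>)"
proof -
  have "x \<in> span (\<Union>\<alpha>\<in>insert 0 \<Phi>. rsp \<alpha>)" unfolding span_root_spaces by simp
  then obtain J v where J: "finite J" "J \<subseteq> insert 0 \<Phi>" "\<And>j. j \<in> J \<Longrightarrow> v j \<in> rsp j" "x = (\<Sum>j\<in>J. v j)"
    by (rule span_Union_sumE) (auto simp: subspace_root_space)
  have "(\<Sum>j\<in>J. v j) = (\<Sum>\<alpha>\<in>insert 0 \<Phi>. if \<alpha> \<in> J then v \<alpha> else 0)"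
    using J finite_roots by (intro sum.mono_neutral_cong_left) auto
  then show ?thesis
    using J that[of "\<lambda>\<alpha>. if \<alpha> \<in> J then v \<alpha> else 0"] subspace_0[OF subspace_root_space] by auto
qed

lemma subspace_eq_UNIV_if_root_spaces:
  assumes "subspace U" "\<And>\<alpha>. \<alpha> \<in> insert 0 \<Phi> \<Longrightarrow> rsp \<alpha> \<subseteq> U"
  shows "U = UNIV"
proof -
  have "span (\<Union>\<alpha>\<in>insert 0 \<Phi>. rsp \<alpha>) \<subseteq> U"
    using assms by (intro span_minimal) auto
  then show ?thesis unfolding span_root_spaces by auto
qed

lemma abelian_ideal_trivial:
  assumes "lie_ideal I" "\<And>x y. x \<in> I \<Longrightarrow> y \<in> I \<Longrightarrow> bracket x y = 0"
  shows "I = {0}"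
proof -
  have "{bracket x y |x y. x \<in> I \<and> y \<in> I} \<subseteq> {0}" using assms by auto
  then have "span {bracket x y |x y. x \<in> I \<and> y \<in> I} \<subseteq> {0}"
    by (intro span_minimal) auto
  then have "derived_series I (Suc 0) = {0}"
    using span_zero by auto
  then show ?thesis
    using is_semisimple assms unfolding semisimple_def solvable_def by blast
qed

lemma center_trivial:
  assumes "\<And>x. bracket z x = 0"
  shows "z = 0"
proof -
  let ?Z = "{z. \<forall>x. bracket z x = 0}"
  have "?Z = {0}"
  proof (rule abelian_ideal_trivial)
    have "subspace ?Z"
      by (rule subspaceI) (auto simp: bracket_left.add bracket_left.scale)
    moreover have "bracket x z \<in> ?Z" if "z \<in> ?Z" for x z
      using that by (auto simp: bracket_anticommute[of x z])
    ultimately show "lie_ideal ?Z" unfolding lie_ideal_def by blast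
  qed auto
  then show ?thesis using assms by blast
qed

text \<open>Such an \<open>h\<close> acts by 0 on every root space and on \<open>t\<close>, so it is
  central, and the centre is an abelian ideal.\<close>

lemma roots_separate:
  assumes "h \<in> t" "\<And>\<alpha>. \<alpha> \<in> \<Phi> \<Longrightarrow> \<alpha> h = 0"
  shows "h = 0"
proof -
  have "{x. bracket h x = 0} = UNIV"
  proof (rule subspace_eq_UNIV_if_root_spaces)
    show "subspace {x. bracket h x = 0}" by (rule bracket_right.subspace_kernel)
    show "rsp \<alpha> \<subseteq> {x. bracket h x = 0}" if "\<alpha> \<in> insert 0 \<Phi>" for \<alpha>
      using that assms by (auto simp: root_space_def)
  qed
  then have "bracket h x = 0" for x by blast
  then show ?thesis by (rule center_trivial)
qed

lemma killing_root_space_orthogonal: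
  assumes "x \<in> rsp \<alpha>" "y \<in> rsp \<beta>" "\<alpha> \<in> dual t" "\<beta> \<in> dual t" "\<alpha> + \<beta> \<noteq> 0"
  shows "killing x y = 0"
proof -
  obtain h where h: "h \<in> t" "\<alpha> h + \<beta> h \<noteq> 0"
    using weights_distinct[of "\<alpha> + \<beta>" 0] assms dual_add dual_zero by auto
  have "\<alpha> h * killing x y = killing (bracket h x) y"
    using assms h by (simp add: root_space_def killing_scale_left)
  also have "\<dots> = - killing x (bracket h y)"
    by (simp add: bracket_anticommute[of h x] killing_uminus killing_invariant)
  also have "\<dots> = - \<beta> h * killing x y"
    using assms h by (simp add: root_space_def killing_scale_right)
  finally have "(\<alpha> h + \<beta> h) * killing x y = 0" by (simp add: algebra_simps)
  then show ?thesis using h by simp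
qed

lemma bracket_opposite_in_cartan:
  assumes "x \<in> rsp \<alpha>" "y \<in> rsp (- \<alpha>)"
  shows "bracket x y \<in> t"
  using root_space_bracket[OF assms] by (simp add: root_space_zero)

text \<open>The trace of \<open>ad [x, y]\<close> on a full \<open>\<alpha>\<close>-string of root spaces vanishes.\<close>

lemma weight_proportional:
  assumes x: "x \<in> rsp \<alpha>" and y: "y \<in> rsp (- \<alpha>)" and \<beta>: "rsp \<beta> \<noteq> {0}"
  shows "\<exists>q::real. \<beta> (bracket x y) = of_real q * \<alpha> (bracket x y)"
proof -
  define h where "h = bracket x y"
  have h: "h \<in> t" unfolding h_def using bracket_opposite_in_cartan[OF x y] .
  define wt where "wt k = \<beta> + fscale (of_int k) \<alpha>" for k :: int
  define V where "V = (\<Union>k. rsp (wt k))"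
  obtain B where B: "B \<subseteq> V" "independent B" "V \<subseteq> span B"
    using maximal_independent_subset by blast
  \<comment> \<open>Different \<open>k\<close> may give the same weight, for instance when \<alpha>
    = 0. Any choice will do, because only the eigenvalue of [x, y] on \<open>b\<close> enters the
    trace.\<close>
  then obtain k where k: "\<And>b. b \<in> B \<Longrightarrow> b \<in> rsp (wt (k b))"
    unfolding V_def by (metis (no_types, lifting) UN_E subset_iff)
  have wt_step: "\<alpha> + wt k = wt (k + 1)" "- \<alpha> + wt k = wt (k - 1)" for k
    by (auto simp: wt_def fscale_def fun_eq_iff algebra_simps)
  have "bracket x b \<in> V" "bracket y b \<in> V" if "b \<in> B" for b
    using root_space_bracket[OF x k[OF that]] root_space_bracket[OF y k[OF that]]
    unfolding V_def wt_step by blast+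
  then have "(\<Sum>b\<in>B. wt (k b) h) = 0"
    using B k h unfolding h_def
    by (intro sum_eigenvalues_commutator[of B x y]) (auto simp: root_space_def)
  \<comment> \<open>The vanishing trace is a relation with integer coefficients between \<beta>(h)
    and \<alpha>(h), and the coefficient of \<beta>(h) is the positive dimension of the
    string.\<close>
  then have *: "of_nat (card B) * \<beta> h + (\<Sum>b\<in>B. of_int (k b)) * \<alpha> h = 0"
    by (simp add: wt_def fscale_def sum.distrib sum_distrib_right)
  have "rsp \<beta> \<subseteq> V"
  proof -
    have "wt 0 = \<beta>" by (simp add: wt_def fscale_def fun_eq_iff)
    then show ?thesis unfolding V_def by blast
  qed
  then have "B \<noteq> {}"
    using \<beta> B subspace_0[OF subspace_root_space] by auto
  then have "card B \<noteq> 0" using B finiteI_independent by simp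
  then have "\<beta> h = of_real (- (\<Sum>b\<in>B. of_int (k b)) / of_nat (card B)) * \<alpha> h"
    using * by (simp add: field_simps add_eq_0_iff)
  then show ?thesis unfolding h_def by blast
qed

lemma weight_basis:
  assumes "\<alpha> \<in> insert 0 \<Phi>" "x \<in> rsp \<alpha>" "x \<noteq> 0"
  obtains B wt where "x \<in> B" "independent B" "span B = UNIV"
    "\<And>b. b \<in> B \<Longrightarrow> wt b \<in> insert 0 \<Phi> \<and> b \<in> rsp (wt b)"
proof -
  let ?V = "\<Union>\<alpha>\<in>insert 0 \<Phi>. rsp \<alpha>"
  obtain B where B: "{x} \<subseteq> B" "B \<subseteq> ?V" "independent B" "?V \<subseteq> span B"
    using maximal_independent_subset_extend[of "{x}" ?V] assms by auto
  have "\<forall>b\<in>B. \<exists>w. w \<in> insert 0 \<Phi> \<and> b \<in> rsp w" using B by blast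
  then obtain wt where "\<forall>b\<in>B. wt b \<in> insert 0 \<Phi> \<and> b \<in> rsp (wt b)" by metis
  moreover have "span B = UNIV"
    using span_minimal[OF B(4)] span_root_spaces by auto
  moreover have "x \<in> B" using B by simp
  ultimately show ?thesis by (intro that[of B wt] B) simp_all
qed

text \<open>With h = [x, y], every weight at h is a real multiple q of \<alpha>(h), so
  \<open>killing h h\<close> is \<alpha>(h)^2 times a sum of squares. If h is isotropic this forces
  \<alpha>(h) = 0, hence all roots vanish at h and h = 0. The isotropic alternative serves the
  radical, the other one shows that roots have nonzero length.\<close>

lemma isotropic_bracket_zero:
  assumes \<alpha>: "\<alpha> \<in> \<Phi>" and x: "x \<in> rsp \<alpha>" and y: "y \<in> rsp (- \<alpha>)"
    and zero: "killing (bracket x y) (bracket x y) = 0 \<or> \<alpha> (bracket x y) = 0"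
  shows "bracket x y = 0"
proof -
  define h where "h = bracket x y"
  have h: "h \<in> t" unfolding h_def using bracket_opposite_in_cartan[OF x y] .
  have ratio: "\<exists>q::real. \<beta> h = of_real q * \<alpha> h" if "rsp \<beta> \<noteq> {0}" for \<beta>
    unfolding h_def by (rule weight_proportional[OF x y that])
  have "\<alpha> h = 0"
  proof (rule ccontr)
    assume nz: "\<alpha> h \<noteq> 0"
    obtain e where e: "e \<in> rsp \<alpha>" "e \<noteq> 0"
      using \<alpha> subspace_0[OF subspace_root_space] unfolding roots_def by blast
    \<comment> \<open>A root vector of weight \<alpha> is put into the basis, where q = 1; this
      keeps the sum of squares from vanishing.\<close>
    obtain B wt where B: "e \<in> B" "independent B" "span B = UNIV"
      "\<And>b. b \<in> B \<Longrightarrow> wt b \<in> insert 0 \<Phi> \<and> b \<in> rsp (wt b)"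
      using weight_basis[OF _ e] \<alpha> by blast
    have "\<exists>q::real. wt b h = of_real q * \<alpha> h" if "b \<in> B" for b
    proof (rule ratio)
      have "b \<noteq> 0" using B(2) that dependent_zero by auto
      then show "rsp (wt b) \<noteq> {0}" using B(4)[OF that] by auto
    qed
    then obtain q :: "'g \<Rightarrow> real" where q: "\<And>b. b \<in> B \<Longrightarrow> wt b h = of_real (q b) * \<alpha> h"
      by metis
    have "killing h h = (\<Sum>b\<in>B. wt b h * wt b h)"
      unfolding killing_eq_trace_on[OF B(2,3)] using B h
      by (intro trace_on_eigenbasis) (auto simp: root_space_def bracket_scale_right)
    also have "\<dots> = of_real (\<Sum>b\<in>B. (q b)\<^sup>2) * (\<alpha> h)\<^sup>2"
      unfolding of_real_sum sum_distrib_right by (intro sum.cong) (auto simp: q power2_eq_square)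
    finally have "of_real (\<Sum>b\<in>B. (q b)\<^sup>2) = (0 :: complex)"
      using zero nz unfolding h_def by simp
    then have "(\<Sum>b\<in>B. (q b)\<^sup>2) = 0" by (simp only: of_real_eq_0_iff)
    then have "q e = 0"
      using B finiteI_independent by (subst (asm) sum_nonneg_eq_0_iff) auto
    moreover have "wt e = \<alpha>"
      using B(1) B(4)[OF B(1)] e \<alpha> by (intro weight_unique[of e]) (auto simp: root_dual dual_zero)
    ultimately show False using q[OF B(1)] nz by simp
  qed
  have "\<beta> h = 0" if "\<beta> \<in> \<Phi>" for \<beta>
    using ratio[of \<beta>] that \<open>\<alpha> h = 0\<close> unfolding roots_def by auto
  then show ?thesis using roots_separate h unfolding h_def by blast
qed

text \<open>On a root space, powers of ad x run through the pairwise different weights \<delta> + n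
  \<gamma>, and only finitely many weights occur. The exponent may depend on \<open>v\<close>, which
  is all that the Engel argument asks for.\<close>

lemma root_vector_nilpotent:
  assumes \<gamma>: "\<gamma> \<in> \<Phi>" and x: "x \<in> rsp \<gamma>"
  shows "\<exists>n. (bracket x ^^ n) v = 0"
proof -
  let ?U = "{v. \<exists>n. (bracket x ^^ n) v = 0}"
  have lin: "Vector_Spaces.linear scale scale (bracket x ^^ n)" for n
  proof (induction n)
    case (Suc n)
    then show ?case
      using Vector_Spaces.linear_compose[OF Suc linear_bracket] by (simp add: comp_def)
  qed (use linear_id in \<open>simp add: id_def\<close>)
  have later: "(bracket x ^^ (n + m)) v = 0" if "(bracket x ^^ n) v = 0" for n m v
  proof -
    have "(bracket x ^^ (m + n)) v = (bracket x ^^ m) 0"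
      using that by (simp add: funpow_add)
    also have "\<dots> = 0" by (induction m) auto
    finally show ?thesis by (simp add: add.commute)
  qed
  have "?U = UNIV"
  proof (rule subspace_eq_UNIV_if_root_spaces)
    show "subspace ?U"
    proof (rule subspaceI)
      show "0 \<in> ?U" by (auto intro: exI[of _ 0])
    next
      fix u w assume "u \<in> ?U" "w \<in> ?U"
      then obtain m n where "(bracket x ^^ m) u = 0" "(bracket x ^^ n) w = 0" by auto
      then have "(bracket x ^^ (m + n)) (u + w) = 0"
        using later[of m u n] later[of n w m]
        by (simp add: add.commute module_hom.add[OF Vector_Spaces.linear.axioms(3)[OF lin]])
      then show "u + w \<in> ?U" by blast
    next
      fix c u assume "u \<in> ?U"
      then obtain m where "(bracket x ^^ m) u = 0" by auto
      then have "(bracket x ^^ m) (c *s u) = 0"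
        by (simp add: module_hom.scale[OF Vector_Spaces.linear.axioms(3)[OF lin]])
      then show "c *s u \<in> ?U" by blast
    qed
  next
    fix \<delta> assume \<delta>: "\<delta> \<in> insert 0 \<Phi>"
    show "rsp \<delta> \<subseteq> ?U"
    proof
      fix v assume v: "v \<in> rsp \<delta>"
      define wt where "wt n = \<delta> + fscale (of_nat n) \<gamma>" for n :: nat
      have mem: "(bracket x ^^ n) v \<in> rsp (wt n)" for n
      proof (induction n)
        case 0
        then show ?case using v by (simp add: wt_def fscale_def plus_fun_def)
      next
        case (Suc n)
        have "wt (Suc n) = \<gamma> + wt n"
          by (auto simp: wt_def fscale_def fun_eq_iff algebra_simps)
        then show ?case using root_space_bracket[OF x Suc] unfolding funpow.simps o_apply by metis
      qed
      obtain h where h: "\<gamma> h \<noteq> 0" using root_nonzero[OF \<gamma>] by (auto simp: fun_eq_iff)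
      have "inj wt"
      proof (rule injI)
        fix m n assume "wt m = wt n"
        then have "wt m h = wt n h" by simp
        then show "m = n" using h by (simp add: wt_def fscale_def)
      qed
      then have "\<not> range wt \<subseteq> insert 0 \<Phi>"
        using finite_roots finite_subset finite_imageD[of wt UNIV] by (metis finite.insertI infinite_UNIV_nat)
      then obtain n where n: "wt n \<notin> insert 0 \<Phi>" by auto
      have "wt n \<in> dual t"
        unfolding wt_def using \<gamma> \<delta> by (auto intro!: dual_add dual_fscale simp: root_dual dual_zero)
      then have "rsp (wt n) = {0}" using n by (auto simp: roots_def)
      then show "v \<in> ?U" using mem[of n] by auto
    qed
  qed
  then show ?thesis by blast
qed

section \<open>Nondegeneracy of the Killing form\<close>

definition radical :: "'g set" where
  "radical = {x. \<forall>y. killing x y = 0}"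

lemma ideal_radical: "lie_ideal radical"
proof -
  have "subspace radical"
    unfolding radical_def by (rule subspaceI) (auto simp: killing_zero killing_add_left killing_scale_left)
  moreover have "bracket x y \<in> radical" if "y \<in> radical" for x y
  proof -
    have "killing (bracket x y) z = - killing y (bracket x z)" for z
      by (simp add: bracket_anticommute[of x y] killing_uminus killing_invariant)
    then show ?thesis using that unfolding radical_def by simp
  qed
  ultimately show ?thesis unfolding lie_ideal_def by blast
qed

lemma ideal_components:
  assumes "lie_ideal I" "x \<in> I"
  obtains v where "\<And>\<alpha>. \<alpha> \<in> insert 0 \<Phi> \<Longrightarrow> v \<alpha> \<in> rsp \<alpha> \<inter> I" "x = (\<Sum>\<alpha>\<in>insert 0 \<Phi>. v \<alpha>)"
proof -
  obtain v where v: "\<And>\<alpha>. \<alpha> \<in> insert 0 \<Phi> \<Longrightarrow> v \<alpha> \<in> rsp \<alpha>" "x = (\<Sum>\<alpha>\<in>insert 0 \<Phi>. v \<alpha>)"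
    using weight_decomposition by blast
  have "v \<alpha> \<in> I" if "\<alpha> \<in> insert 0 \<Phi>" for \<alpha>
    using assms v that finite_roots unfolding lie_ideal_def
    by (intro weight_components[of "insert 0 \<Phi>" v I]) (auto simp: root_dual dual_zero)
  then show ?thesis using that v by blast
qed

text \<open>If the radical R is nonzero, so is I = [R, R], as R would otherwise be an abelian ideal.
  Brackets of opposite root vectors in R vanish, so I has no part in \<open>t\<close> and is spanned
  by ad-nilpotent root vectors. Engel's theorem gives I a nonzero centre, which is an abelian ideal
  of the whole algebra: a contradiction.\<close>

lemma radical_trivial: "radical = {0}"
proof (rule ccontr)
  assume nontrivial: "radical \<noteq> {0}"
  have sub: "subspace radical" and st: "\<And>x y. y \<in> radical \<Longrightarrow> bracket x y \<in> radical"
    using ideal_radical by (auto simp: lie_ideal_def)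
  have st': "bracket x y \<in> radical" if "x \<in> radical" for x y
    using st[OF that, of y] sub by (subst bracket_anticommute) (rule subspace_neg)
  \<comment> \<open>The bracket lies in R and is therefore orthogonal to everything, in particular
    to itself.\<close>
  have opp: "bracket x y = 0" if "\<alpha> \<in> \<Phi>" "x \<in> rsp \<alpha> \<inter> radical" "y \<in> rsp (- \<alpha>)" for \<alpha> x y
  proof -
    have "bracket x y \<in> radical" using that st' by auto
    then have "killing (bracket x y) (bracket x y) = 0" by (simp add: radical_def)
    then show ?thesis using isotropic_bracket_zero that by auto
  qed
  define I where "I = span {bracket x y |x y. x \<in> radical \<and> y \<in> radical}"
  have gen: "bracket x y \<in> I" if "x \<in> radical" "y \<in> radical" for x y
    unfolding I_def using that by (intro span_base) blast
  have "subspace I" unfolding I_def by simp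
  have I_radical: "I \<subseteq> radical"
    unfolding I_def using sub st by (intro span_minimal) auto
  have "I \<noteq> {0}"
    using abelian_ideal_trivial[OF ideal_radical] gen nontrivial by blast
  have I_ideal: "lie_ideal I"
  proof -
    have "bracket z y \<in> I" if "y \<in> I" for y z
    proof -
      have "{bracket x y |x y. x \<in> radical \<and> y \<in> radical} \<subseteq> {y. bracket z y \<in> I}"
      proof clarify
        fix x y assume "x \<in> radical" "y \<in> radical"
        then show "bracket z (bracket x y) \<in> I"
          by (subst bracket_derivation) (intro subspace_add[OF \<open>subspace I\<close>] gen st)
      qed
      then have "I \<subseteq> {y. bracket z y \<in> I}"
        unfolding I_def[symmetric] using \<open>subspace I\<close>
        by (subst (1) I_def) (intro span_minimal bracket_right.subspace_linear_preimage)
      then show ?thesis using that by auto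
    qed
    then show ?thesis using \<open>subspace I\<close> unfolding lie_ideal_def by blast
  qed
  define E where "E = (\<Union>\<gamma>\<in>\<Phi>. rsp \<gamma> \<inter> I)"
  define N where "N = span (\<Union>\<gamma>\<in>\<Phi>. rsp \<gamma>)"
  \<comment> \<open>A bracket of weight 0 can arise from two elements of \<open>t\<close>, which
    commute, or from opposite root vectors in R, which commute by \<open>opp\<close>. So [R, R] has
    no component in \<open>t\<close>.\<close>
  have bracket_N: "bracket x y \<in> N" if xy: "x \<in> rsp \<alpha> \<inter> radical" "y \<in> rsp \<beta> \<inter> radical"
    "\<alpha> \<in> insert 0 \<Phi>" "\<beta> \<in> insert 0 \<Phi>" for x y \<alpha> \<beta>
  proof (cases "bracket x y = 0 \<or> \<alpha> + \<beta> \<in> \<Phi>")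
    case True
    then show ?thesis
      unfolding N_def using root_space_bracket[of x t \<alpha> y \<beta>] xy by (auto intro: span_zero span_base)
  next
    case False
    have "\<alpha> + \<beta> \<in> dual t"
      using xy by (auto intro!: dual_add simp: root_dual dual_zero)
    moreover have "rsp (\<alpha> + \<beta>) \<noteq> {0}"
      using False root_space_bracket[of x t \<alpha> y \<beta>] xy by auto
    ultimately have "\<alpha> + \<beta> = 0" using False unfolding roots_def by auto
    then have \<beta>: "\<beta> = - \<alpha>" by (simp add: eq_neg_iff_add_eq_0 add.commute)
    have "bracket x y = 0"
    proof (cases "\<alpha> = 0")
      case True
      then show ?thesis using xy \<beta> by (auto simp: root_space_zero bracket_cartan)
    next
      case False
      then show ?thesis using opp xy \<beta> by auto
    qed
    then show ?thesis using False by auto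
  qed
  have "I \<subseteq> N"
    unfolding I_def
  proof (rule span_minimal)
    show "subspace N" by (simp add: N_def)
    show "{bracket x y |x y. x \<in> radical \<and> y \<in> radical} \<subseteq> N"
    proof clarify
      fix x y assume xy: "x \<in> radical" "y \<in> radical"
      obtain v where v: "\<And>\<alpha>. \<alpha> \<in> insert 0 \<Phi> \<Longrightarrow> v \<alpha> \<in> rsp \<alpha> \<inter> radical" "x = (\<Sum>\<alpha>\<in>insert 0 \<Phi>. v \<alpha>)"
        using ideal_components[OF ideal_radical xy(1)] by blast
      obtain w where w: "\<And>\<alpha>. \<alpha> \<in> insert 0 \<Phi> \<Longrightarrow> w \<alpha> \<in> rsp \<alpha> \<inter> radical" "y = (\<Sum>\<alpha>\<in>insert 0 \<Phi>. w \<alpha>)"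
        using ideal_components[OF ideal_radical xy(2)] by blast
      show "bracket x y \<in> N"
        unfolding v(2) w(2) bracket_left.sum bracket_right.sum using v(1) w(1)
        by (intro subspace_sum[OF \<open>subspace N\<close>] bracket_N)
    qed
  qed
  have "I \<subseteq> span E"
  proof
    fix x assume x: "x \<in> I"
    then have "x \<in> span (\<Union>\<gamma>\<in>\<Phi>. rsp \<gamma>)" using \<open>I \<subseteq> N\<close> N_def by auto
    then obtain J v where J: "finite J" "J \<subseteq> \<Phi>" "\<And>j. j \<in> J \<Longrightarrow> v j \<in> rsp j" "x = (\<Sum>j\<in>J. v j)"
      by (rule span_Union_sumE) (auto simp: subspace_root_space)
    have "v j \<in> I" if "j \<in> J" for j
      using J that I_ideal x root_dual unfolding lie_ideal_def
      by (intro weight_components[of J v I]) auto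
    then show "x \<in> span E"
      unfolding J(4) E_def using J by (intro span_sum span_base) auto
  qed
  have "engel_set E"
  proof (rule engel_set_nilpotent)
    fix x y assume "x \<in> E" "y \<in> E"
    then obtain \<alpha> \<beta> where ab: "\<alpha> \<in> \<Phi>" "\<beta> \<in> \<Phi>" "x \<in> rsp \<alpha>" "y \<in> rsp \<beta>" "x \<in> I" "y \<in> I"
      unfolding E_def by auto
    have I: "bracket x y \<in> I" using ab I_ideal by (auto simp: lie_ideal_def)
    show "bracket x y \<in> E"
    proof (cases "\<alpha> + \<beta> \<in> \<Phi>")
      case True
      then show ?thesis using I root_space_bracket[OF ab(3,4)] unfolding E_def by auto
    next
      case False
      have "bracket x y = 0"
      proof (cases "\<alpha> + \<beta> = 0")
        case True
        then have "\<beta> = - \<alpha>" by (simp add: eq_neg_iff_add_eq_0 add.commute)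
        then show ?thesis using opp ab I_radical by blast
      next
        case nz: False
        have "\<alpha> + \<beta> \<in> dual t" using ab by (intro dual_add root_dual)
        then have "rsp (\<alpha> + \<beta>) = {0}" using False nz unfolding roots_def by blast
        then show ?thesis using root_space_bracket[OF ab(3,4)] by auto
      qed
      then show ?thesis
        using ab subspace_0[OF subspace_root_space] subspace_0[OF \<open>subspace I\<close>] unfolding E_def by auto
    qed
  next
    show "\<exists>n. (bracket x ^^ n) v = 0" if "x \<in> E" for x v
      using that root_vector_nilpotent unfolding E_def by auto
  qed
  then have "\<exists>z\<in>I - {0}. \<forall>f\<in>E. bracket f z \<in> {0}"
    using I_ideal \<open>I \<noteq> {0}\<close> subspace_0[OF \<open>subspace I\<close>] by (intro engel_setD) (auto simp: lie_ideal_def)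
  then obtain z where z: "z \<in> I" "z \<noteq> 0" "\<And>f. f \<in> E \<Longrightarrow> bracket f z = 0" by auto
  have "span E \<subseteq> {f. bracket f z = 0}"
    using z by (intro span_minimal bracket_left.subspace_kernel) auto
  then have zI: "bracket f z = 0" if "f \<in> I" for f
    using that \<open>I \<subseteq> span E\<close> by auto
  \<comment> \<open>The centre of an ideal is again an ideal, by Jacobi; it contains the vector
    \<open>z\<close> that Engel's theorem provides.\<close>
  define Z where "Z = {z\<in>I. \<forall>f\<in>I. bracket f z = 0}"
  have "Z = {0}"
  proof (rule abelian_ideal_trivial)
    have "subspace Z"
      unfolding Z_def using \<open>subspace I\<close>
      by (intro subspaceI) (auto simp: subspace_0 subspace_add subspace_scale bracket_right.add bracket_right.scale)
    moreover have "bracket x u \<in> Z" if u: "u \<in> Z" for x u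
    proof -
      have "bracket f (bracket x u) = 0" if "f \<in> I" for f
      proof -
        have "bracket f x \<in> I"
          using that I_ideal subspace_neg[OF \<open>subspace I\<close>] unfolding lie_ideal_def
          by (subst bracket_anticommute) auto
        then show ?thesis
          using u that by (subst bracket_derivation) (simp add: Z_def)
      qed
      then show ?thesis using u I_ideal unfolding Z_def lie_ideal_def by auto
    qed
    ultimately show "lie_ideal Z" unfolding lie_ideal_def by blast
  qed (auto simp: Z_def)
  then show False using z zI unfolding Z_def by auto
qed

lemma killing_nondegenerate:
  assumes "x \<noteq> 0"
  shows "\<exists>y. killing x y \<noteq> 0"
  using assms radical_trivial unfolding radical_def by auto

end


section \<open>Root strings\<close>

text \<open>Applied to the integers k for which \<beta> + k \<alpha> is a root. The unbroken run
  around 0 is isolated, so that the trace argument does not presuppose that root strings have no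
  gaps.\<close>

lemma int_component:
  fixes S :: "int set"
  assumes "finite S" "0 \<in> S"
  obtains p q where "p \<le> 0" "0 \<le> q" "{p..q} \<subseteq> S" "p - 1 \<notin> S" "q + 1 \<notin> S"
proof -
  \<comment> \<open>Run once with the identity and once with negation, this gives the upper and the
    lower end.\<close>
  have side: "\<exists>n. (\<forall>i\<le>n. f (int i) \<in> S) \<and> f (int n + 1) \<notin> S" if f: "inj f" "f 0 = 0" for f :: "int \<Rightarrow> int"
  proof -
    have "\<not> range (\<lambda>n. f (int n)) \<subseteq> S"
    proof
      assume "range (\<lambda>n. f (int n)) \<subseteq> S"
      then have "finite (range (\<lambda>n. f (int n)))" using assms finite_subset by blast
      moreover have "inj (\<lambda>n. f (int n))" using inj_compose[OF f(1) inj_of_nat] by (simp add: comp_def)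
      ultimately show False using finite_imageD infinite_UNIV_nat by blast
    qed
    then have ex: "\<exists>n. f (int n) \<notin> S" by auto
    define N where "N = (LEAST n. f (int n) \<notin> S)"
    have N: "f (int N) \<notin> S" unfolding N_def using ex by (rule LeastI_ex)
    then obtain n where n: "N = Suc n" using f assms by (cases N) auto
    have "f (int i) \<in> S" if "i \<le> n" for i
      using that n not_less_Least[of i "\<lambda>n. f (int n) \<notin> S"] unfolding N_def by auto
    then show ?thesis using N n by (intro exI[of _ n]) (auto simp: add.commute)
  qed
  obtain m where m: "\<forall>i\<le>m. int i \<in> S" "int m + 1 \<notin> S"
    using side[of "\<lambda>x. x"] by auto
  obtain n where n: "\<forall>i\<le>n. - int i \<in> S" "- (int n + 1) \<notin> S"
    using side[of uminus] by auto
  have "k \<in> S" if "k \<in> {- int n..int m}" for k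
  proof (cases "k \<ge> 0")
    case True
    then show ?thesis using m(1)[rule_format, of "nat k"] that by auto
  next
    case False
    then show ?thesis using n(1)[rule_format, of "nat (- k)"] that by auto
  qed
  then show ?thesis using m n by (intro that[of "- int n" "int m"]) auto
qed

context cartan_lie_algebra
begin

text \<open>The other root spaces are orthogonal to \<open>t = rsp 0\<close>, so nondegeneracy on
  the whole algebra descends to \<open>t\<close>.\<close>

lemma killing_cartan_nondegenerate:
  assumes "h \<in> t" "\<And>k. k \<in> t \<Longrightarrow> killing h k = 0"
  shows "h = 0"
proof -
  have "{x. killing h x = 0} = UNIV"
  proof (rule subspace_eq_UNIV_if_root_spaces)
    show "subspace {x. killing h x = 0}"
      by (rule subspaceI) (auto simp: killing_zero killing_add_right killing_scale_right)
    show "rsp \<alpha> \<subseteq> {x. killing h x = 0}" if "\<alpha> \<in> insert 0 \<Phi>" for \<alpha>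
    proof (cases "\<alpha> = 0")
      case True
      then show ?thesis using assms by (auto simp: root_space_zero)
    next
      case False
      then have "killing h x = 0" if "x \<in> rsp \<alpha>" for x
        using assms(1) that \<open>\<alpha> \<in> insert 0 \<Phi>\<close> root_space_zero
        by (intro killing_root_space_orthogonal[of h 0 x \<alpha>]) (auto simp: dual_zero root_dual)
      then show ?thesis by auto
    qed
  qed
  then show ?thesis using killing_nondegenerate by blast
qed

lemma dual_vector_eqI:
  assumes "h \<in> t" "\<And>k. k \<in> t \<Longrightarrow> killing h k = \<xi> k"
  shows "dual_vector t \<xi> = h"
  unfolding dual_vector_def
proof (rule the_equality)
  show "h \<in> t \<and> (\<forall>k\<in>t. killing h k = \<xi> k)" using assms by auto
  show "g = h" if "g \<in> t \<and> (\<forall>k\<in>t. killing g k = \<xi> k)" for g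
  proof -
    have "g - h = 0"
      using that assms subspace_cartan
      by (intro killing_cartan_nondegenerate) (auto simp: subspace_diff killing_diff_left)
    then show ?thesis by simp
  qed
qed

section \<open>Dual vectors, coroots and sl2-triples\<close>

definition represented :: "('g \<Rightarrow> complex) set" where
  "represented = {\<xi>. \<exists>h\<in>t. \<forall>k\<in>t. killing h k = \<xi> k}"

lemma dual_vector:
  assumes "\<xi> \<in> represented"
  shows "dual_vector t \<xi> \<in> t" "\<And>k. k \<in> t \<Longrightarrow> killing (dual_vector t \<xi>) k = \<xi> k"
  using assms dual_vector_eqI unfolding represented_def by auto

lemma represented_zero: "0 \<in> represented"
  unfolding represented_def using subspace_cartan subspace_0 by (auto intro!: bexI[of _ 0] simp: killing_zero)

lemma represented_add: "\<xi> \<in> represented \<Longrightarrow> \<eta> \<in> represented \<Longrightarrow> \<xi> + \<eta> \<in> represented"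
proof -
  assume "\<xi> \<in> represented" "\<eta> \<in> represented"
  then obtain h g where "h \<in> t" "\<forall>k\<in>t. killing h k = \<xi> k" "g \<in> t" "\<forall>k\<in>t. killing g k = \<eta> k"
    unfolding represented_def by auto
  then show ?thesis
    unfolding represented_def using subspace_add[OF subspace_cartan]
    by (auto intro!: bexI[of _ "h + g"] simp: killing_add_left)
qed

lemma represented_fscale: "\<xi> \<in> represented \<Longrightarrow> fscale c \<xi> \<in> represented"
proof -
  assume "\<xi> \<in> represented"
  then obtain h where "h \<in> t" "\<forall>k\<in>t. killing h k = \<xi> k"
    unfolding represented_def by auto
  then show ?thesis
    unfolding represented_def using subspace_scale[OF subspace_cartan]
    by (auto intro!: bexI[of _ "c *s h"] simp: killing_scale_left fscale_def)
qed

lemma represented_sum: "(\<And>i. i \<in> I \<Longrightarrow> f i \<in> represented) \<Longrightarrow> sum f I \<in> represented"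
  by (induction I rule: infinite_finite_induct) (auto simp: represented_zero represented_add)

text \<open>\<open>e\<close> is orthogonal to every weight space other than that of -\<alpha>, so
  nondegeneracy must be witnessed there.\<close>

lemma root_vector_pairing:
  assumes "\<alpha> \<in> \<Phi>" "e \<in> rsp \<alpha>" "e \<noteq> 0"
  shows "\<exists>f\<in>rsp (- \<alpha>). killing e f \<noteq> 0"
proof (rule ccontr)
  assume none: "\<not> (\<exists>f\<in>rsp (- \<alpha>). killing e f \<noteq> 0)"
  have "{x. killing e x = 0} = UNIV"
  proof (rule subspace_eq_UNIV_if_root_spaces)
    show "subspace {x. killing e x = 0}"
      by (rule subspaceI) (auto simp: killing_zero killing_add_right killing_scale_right)
    show "rsp \<beta> \<subseteq> {x. killing e x = 0}" if \<beta>: "\<beta> \<in> insert 0 \<Phi>" for \<beta>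
    proof (cases "\<alpha> + \<beta> = 0")
      case True
      then have "\<beta> = - \<alpha>" by (simp add: eq_neg_iff_add_eq_0 add.commute)
      then show ?thesis using none by auto
    next
      case False
      then show ?thesis
        using assms \<beta> killing_root_space_orthogonal[of e \<alpha> _ \<beta>] by (auto simp: root_dual dual_zero)
    qed
  qed
  then show False using killing_nondegenerate[OF assms(3)] by blast
qed

lemma bracket_opposite:
  assumes "e \<in> rsp \<alpha>" "f \<in> rsp (- \<alpha>)" "k \<in> t"
  shows "killing (bracket e f) k = killing e f * \<alpha> k"
proof -
  have "killing (bracket e f) k = killing k (bracket e f)" by (rule killing_commute)
  also have "\<dots> = killing (bracket k e) f" by (simp add: killing_invariant)
  also have "\<dots> = killing e f * \<alpha> k"
    using assms by (simp add: root_space_def killing_scale_left)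
  finally show ?thesis .
qed

lemma root_vector_exists: "\<alpha> \<in> \<Phi> \<Longrightarrow> \<exists>e\<in>rsp \<alpha>. e \<noteq> 0"
  using subspace_0[OF subspace_root_space] unfolding roots_def by blast

lemma root_represented:
  assumes "\<alpha> \<in> \<Phi>"
  shows "\<alpha> \<in> represented"
proof -
  obtain e where e: "e \<in> rsp \<alpha>" "e \<noteq> 0" using root_vector_exists assms by blast
  obtain f where f: "f \<in> rsp (- \<alpha>)" "killing e f \<noteq> 0"
    using root_vector_pairing[OF assms e] by blast
  have "(1 / killing e f) *s bracket e f \<in> t"
    using bracket_opposite_in_cartan e f subspace_cartan by (auto intro: subspace_scale)
  then show ?thesis
    unfolding represented_def using f bracket_opposite[OF e(1) f(1)]
    by (auto intro!: bexI[of _ "(1 / killing e f) *s bracket e f"] simp: killing_scale_left)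
qed

text \<open>The denominator is the squared length of \<alpha> in the form induced on the dual of
  \<open>t\<close>.\<close>

definition coroot :: "('g \<Rightarrow> complex) \<Rightarrow> 'g" where
  "coroot \<alpha> = (2 / \<alpha> (dual_vector t \<alpha>)) *s dual_vector t \<alpha>"

lemma bracket_opposite_eq:
  assumes "\<alpha> \<in> \<Phi>" "e \<in> rsp \<alpha>" "f \<in> rsp (- \<alpha>)" "killing e f \<noteq> 0"
  shows "bracket e f = killing e f *s dual_vector t \<alpha>"
proof -
  have "dual_vector t \<alpha> = (1 / killing e f) *s bracket e f"
    using assms bracket_opposite[OF assms(2,3)]
    by (intro dual_vector_eqI)
      (auto intro!: subspace_scale[OF subspace_cartan] bracket_opposite_in_cartan simp: killing_scale_left)
  then show ?thesis using assms by simp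
qed

text \<open>If the length were 0, then \<alpha> would vanish at [e, f], a nonzero multiple of the
  dual vector. So [e, f] = 0 by \<open>isotropic_bracket_zero\<close>, and its pairing with
  \<open>t\<close> would give \<alpha> = 0.\<close>

lemma root_dual_vector_nonzero:
  assumes "\<alpha> \<in> \<Phi>"
  shows "\<alpha> (dual_vector t \<alpha>) \<noteq> 0"
proof
  assume zero: "\<alpha> (dual_vector t \<alpha>) = 0"
  obtain e where e: "e \<in> rsp \<alpha>" "e \<noteq> 0" using root_vector_exists assms by blast
  obtain f where f: "f \<in> rsp (- \<alpha>)" "killing e f \<noteq> 0"
    using root_vector_pairing[OF assms e] by blast
  have "\<alpha> (bracket e f) = killing e f * \<alpha> (dual_vector t \<alpha>)"
    unfolding bracket_opposite_eq[OF assms e(1) f]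
    using root_dual[OF assms] dual_vector(1)[OF root_represented[OF assms]] by (auto simp: dual_def)
  then have "bracket e f = 0"
    using zero assms e f by (intro isotropic_bracket_zero) auto
  then have "\<alpha> k = 0" if "k \<in> t" for k
    using bracket_opposite[OF e(1) f(1) that] f by (simp add: killing_zero)
  then have "\<alpha> = 0"
    using assms by (intro dual_eqI[of \<alpha> t]) (auto simp: root_dual dual_zero)
  then show False using root_nonzero assms by blast
qed

lemma coroot_in_cartan: "\<alpha> \<in> \<Phi> \<Longrightarrow> coroot \<alpha> \<in> t"
  unfolding coroot_def using dual_vector(1) root_represented subspace_scale[OF subspace_cartan] by blast

lemma dual_coroot:
  assumes "\<alpha> \<in> \<Phi>" "\<xi> \<in> dual t"
  shows "\<xi> (coroot \<alpha>) = 2 * \<xi> (dual_vector t \<alpha>) / \<alpha> (dual_vector t \<alpha>)"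
  unfolding coroot_def using assms dual_vector(1)[OF root_represented[OF assms(1)]] by (auto simp: dual_def)

lemma root_coroot: "\<alpha> \<in> \<Phi> \<Longrightarrow> \<alpha> (coroot \<alpha>) = 2"
  by (simp add: dual_coroot root_dual root_dual_vector_nonzero)

lemma sl2_triple:
  assumes "\<alpha> \<in> \<Phi>"
  obtains e f where "e \<in> rsp \<alpha>" "f \<in> rsp (- \<alpha>)" "f \<noteq> 0" "bracket e f = coroot \<alpha>"
proof -
  obtain e where e: "e \<in> rsp \<alpha>" "e \<noteq> 0" using root_vector_exists assms by blast
  obtain f where f: "f \<in> rsp (- \<alpha>)" "killing e f \<noteq> 0"
    using root_vector_pairing[OF assms e] by blast
  let ?c = "2 / \<alpha> (dual_vector t \<alpha>) / killing e f"
  have "bracket e (?c *s f) = coroot \<alpha>"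
    using f by (simp add: bracket_scale_right bracket_opposite_eq[OF assms e(1) f] coroot_def)
  moreover have "?c *s f \<noteq> 0"
    using f root_dual_vector_nonzero[OF assms] by (auto simp: killing_zero)
  moreover have "?c *s f \<in> rsp (- \<alpha>)"
    using f by (intro subspace_scale[OF subspace_root_space]) auto
  ultimately show ?thesis using that e by blast
qed

lemma root_uminus:
  assumes "\<alpha> \<in> \<Phi>"
  shows "- \<alpha> \<in> \<Phi>"
proof -
  obtain e f where "f \<in> rsp (- \<alpha>)" "f \<noteq> 0" using sl2_triple[OF assms] by metis
  then show ?thesis
    using dual_uminus[OF root_dual[OF assms]] root_nonzero[OF assms]
    unfolding roots_def by auto
qed

text \<open>The trace of the coroot vanishes on \<open>\<complex>f \<oplus> t \<oplus> \<Oplus>\<^sub>k\<^sub>\<ge>\<^sub>1 g\<^sub>k\<^sub>\<alpha>\<close>, to which \<open>f\<close> contributes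
  \<open>-2\<close> and a vector of weight \<open>k \<alpha>\<close> contributes \<open>2 k\<close>.\<close>

lemma positive_multiples_bound:
  assumes \<alpha>: "\<alpha> \<in> \<Phi>" and S: "independent S"
    and k: "\<And>s. s \<in> S \<Longrightarrow> s \<in> rsp (fscale (of_nat (k s)) \<alpha>) \<and> 0 < k s"
  shows "(\<Sum>s\<in>S. k s) \<le> 1"
proof -
  obtain e f where ef: "e \<in> rsp \<alpha>" "f \<in> rsp (- \<alpha>)" "f \<noteq> 0" "bracket e f = coroot \<alpha>"
    using sl2_triple[OF \<alpha>] .
  define h where "h = coroot \<alpha>"
  have h: "h \<in> t" "\<alpha> h = 2" unfolding h_def using coroot_in_cartan root_coroot \<alpha> by auto
  define wt where "wt n = fscale (of_nat n) \<alpha>" for n :: nat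
  have wt_Suc: "\<alpha> + wt n = wt (Suc n)" "- \<alpha> + wt (Suc n) = wt n" for n
    by (auto simp: wt_def fscale_def fun_eq_iff algebra_simps)
  have wt_0: "wt 0 = 0" by (auto simp: wt_def fscale_def fun_eq_iff)
  have eig: "bracket h b = of_int (2 * int n) *s b" if "b \<in> rsp (wt n)" for b n
    using that h by (simp add: root_space_def wt_def fscale_def mult.commute)
  have eig_f: "bracket h f = of_int (- 2) *s f"
    using ef(2) h by (simp add: root_space_def)
  \<comment> \<open>The term for n = 0 is \<open>t\<close>, where [e, f] lands.\<close>
  define V where "V = insert f (\<Union>n. rsp (wt n))"
  have "S \<subseteq> V" using k unfolding V_def wt_def by blast
  then obtain B where B: "S \<subseteq> B" "B \<subseteq> V" "independent B" "V \<subseteq> span B"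
    using maximal_independent_subset_extend S by metis
  have "\<forall>b. \<exists>n. b \<in> B - {f} \<longrightarrow> b \<in> rsp (wt n)"
    using B(2) unfolding V_def by blast
  then obtain m where m: "\<And>b. b \<in> B - {f} \<Longrightarrow> b \<in> rsp (wt (m b))" by metis
  have eV: "bracket e b \<in> V" if "b \<in> B" for b
  proof (cases "b = f")
    case True
    then show ?thesis using ef h unfolding V_def h_def using wt_0 root_space_zero by (metis UNIV_I UN_I insertCI)
  next
    case False
    then show ?thesis using root_space_bracket[OF ef(1) m[of b]] that unfolding V_def wt_Suc by blast
  qed
  \<comment> \<open>Only membership in the span holds: for b in \<open>t\<close>, [f, b] is a
    multiple of f, and of that line \<open>V\<close> is only guaranteed to contain \<open>f\<close>
    itself.\<close>
  have fV: "bracket f b \<in> span V" if "b \<in> B" for b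
  proof (cases "b = f")
    case True
    then show ?thesis by (simp add: bracket_self span_zero)
  next
    case False
    then have b: "b \<in> rsp (wt (m b))" using m that by blast
    show ?thesis
    proof (cases "m b")
      case 0
      then have "b \<in> t" using b wt_0 root_space_zero by simp
      then have "bracket f b = \<alpha> b *s f"
        using ef(2) by (subst bracket_anticommute) (simp add: root_space_def)
      then show ?thesis unfolding V_def by (simp add: span_base span_scale)
    next
      case (Suc n)
      then have "bracket f b \<in> V"
        using root_space_bracket[OF ef(2) b] unfolding V_def Suc wt_Suc by blast
      then show ?thesis by (rule span_base)
    qed
  qed
  have spanVB: "span V \<subseteq> span B" using B(4) by (intro span_minimal) auto
  define c where "c b = (if b = f then - 2 else 2 * int (m b))" for b
  have "(\<Sum>b\<in>B. of_int (c b)) = (0 :: complex)"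
  proof (rule sum_eigenvalues_commutator)
    show "bracket (bracket e f) b = of_int (c b) *s b" if "b \<in> B" for b
      using eig[OF m[of b]] eig_f that unfolding ef(4) h_def[symmetric] c_def by auto
  qed (use B eV fV spanVB in auto)
  then have c0: "sum c B = 0" by (simp flip: of_int_sum)
  \<comment> \<open>The eigenvalue -2 of \<open>f\<close> differs from the positive eigenvalues on
    \<open>S\<close>, so all of \<open>S\<close> lies in the part of \<open>B\<close> counted by
    \<open>m\<close>.\<close>
  have "f \<notin> S"
  proof
    assume "f \<in> S"
    then have "of_int (- 2) *s f = of_int (2 * int (k f)) *s f"
      using eig eig_f k unfolding wt_def by metis
    then have "of_int (- 2) = (of_int (2 * int (k f)) :: complex)"
      by (rule scale_right_imp_eq[OF ef(3)])
    then have "- 2 = 2 * int (k f)" by (simp only: of_int_eq_iff)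
    then show False by simp
  qed
  have mk: "m s = k s" if "s \<in> S" for s
  proof -
    have "s \<noteq> 0" using S that dependent_zero by auto
    moreover have "of_int (2 * int (k s)) *s s = of_int (2 * int (m s)) *s s"
      using eig[of s "k s"] eig[OF m[of s]] k[OF that] that B(1) \<open>f \<notin> S\<close> unfolding wt_def by auto
    ultimately show ?thesis by simp
  qed
  have fin: "finite B" using B finiteI_independent by blast
  have "(\<Sum>b\<in>S. 2 * int (k b)) = (\<Sum>b\<in>S. 2 * int (m b))"
    using mk by simp
  also have "\<dots> \<le> (\<Sum>b\<in>B - {f}. 2 * int (m b))"
    using B(1) \<open>f \<notin> S\<close> fin by (intro sum_mono2) auto
  finally have "- 2 + (\<Sum>b\<in>S. 2 * int (k b)) \<le> - 2 + (\<Sum>b\<in>B - {f}. 2 * int (m b))"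
    by simp
  also have "\<dots> \<le> sum c B"
  proof (cases "f \<in> B")
    case True
    then show ?thesis using fin by (subst sum.remove[of B f]) (auto simp: c_def)
  next
    case False
    then have "sum c B = (\<Sum>b\<in>B. 2 * int (m b))"
      by (intro sum.cong) (auto simp: c_def)
    then show ?thesis using False by simp
  qed
  \<comment> \<open>The only possible negative contribution is the -2 of \<open>f\<close>, and the
    total is 0.\<close>
  finally have "(\<Sum>b\<in>S. 2 * int (k b)) \<le> 2" using c0 by simp
  then have "int (\<Sum>b\<in>S. k b) \<le> 1" by (simp flip: sum_distrib_left)
  then show ?thesis by linarith
qed

text \<open>Two independent vectors of weight \<alpha> would already contribute 1 + 1 to the
  bound.\<close>

lemma root_space_one_dimensional:
  assumes \<alpha>: "\<alpha> \<in> \<Phi>" and "x \<in> rsp \<alpha>" "x \<noteq> 0" "y \<in> rsp \<alpha>"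
  shows "y \<in> span {x}"
proof (rule ccontr)
  assume y: "y \<notin> span {x}"
  then have "independent {y, x}" "y \<noteq> x"
    using assms by (auto intro!: independent_insertI[OF y] span_base)
  then show False
    using positive_multiples_bound[OF \<alpha>, of "{y, x}" "\<lambda>_. 1"] assms
    by (auto simp: fscale_def)
qed

text \<open>A single root vector of weight n \<alpha> contributes n to the bound; negative multiples
  are reduced to positive ones by changing sign.\<close>

lemma root_integer_multiple:
  assumes "\<alpha> \<in> \<Phi>" "fscale (of_int k) \<alpha> \<in> \<Phi>"
  shows "k = 1 \<or> k = - 1"
proof -
  have bound: "n \<le> 1" if "fscale (of_nat n) \<alpha> \<in> \<Phi>" for n
  proof (cases "n = 0")
    case False
    obtain x where "x \<in> rsp (fscale (of_nat n) \<alpha>)" "x \<noteq> 0"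
      using root_vector_exists[OF \<open>fscale (of_nat n) \<alpha> \<in> \<Phi>\<close>] by blast
    then show ?thesis
      using positive_multiples_bound[OF assms(1), of "{x}" "\<lambda>_. n"] False by auto
  qed auto
  have "k \<noteq> 0" using root_nonzero[OF assms(2)] by (auto simp: fscale_def fun_eq_iff)
  show ?thesis
  proof (cases "k > 0")
    case True
    then have "of_int k = (of_nat (nat k) :: complex)" by simp
    then show ?thesis using bound[of "nat k"] True assms by auto
  next
    case False
    have "- fscale (of_int k) \<alpha> = fscale (of_nat (nat (- k))) \<alpha>"
      using False by (auto simp: fscale_def fun_eq_iff)
    then show ?thesis
      using bound[of "nat (- k)"] root_uminus[OF assms(2)] False \<open>k \<noteq> 0\<close> by auto
  qed
qed

text \<open>An unbroken piece of a string is stable under the \<open>sl\<^sub>2\<close>-triple of \<open>\<alpha>\<close>, so that the trace of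
  the coroot on it, which is \<open>\<Sum>\<^sub>k (\<beta>(h) + 2 k)\<close>, vanishes.\<close>

lemma root_string:
  assumes \<alpha>: "\<alpha> \<in> \<Phi>" and \<beta>: "\<beta> \<in> \<Phi>" and nm: "\<And>k::int. \<beta> \<noteq> fscale (of_int k) \<alpha>"
  obtains p q :: int where "p \<le> 0" "0 \<le> q" "\<And>k. p \<le> k \<Longrightarrow> k \<le> q \<Longrightarrow> \<beta> + fscale (of_int k) \<alpha> \<in> \<Phi>"
    "\<beta> (coroot \<alpha>) = of_int (- (p + q))"
proof -
  obtain e f where ef: "e \<in> rsp \<alpha>" "f \<in> rsp (- \<alpha>)" "f \<noteq> 0" "bracket e f = coroot \<alpha>"
    using sl2_triple[OF \<alpha>] .
  define h where "h = coroot \<alpha>"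
  have h: "h \<in> t" "\<alpha> h = 2" unfolding h_def using coroot_in_cartan root_coroot \<alpha> by auto
  define wt where "wt k = \<beta> + fscale (of_int k) \<alpha>" for k :: int
  have wt_h: "wt k h = \<beta> h + 2 * of_int k" for k by (simp add: wt_def fscale_def h)
  have "inj wt"
  proof (rule injI)
    fix k l assume "wt k = wt l"
    then have "wt k h = wt l h" by simp
    then show "k = l" by (simp add: wt_h)
  qed
  have wt_step: "\<alpha> + wt k = wt (k + 1)" "- \<alpha> + wt k = wt (k - 1)" for k
    by (auto simp: wt_def fscale_def fun_eq_iff algebra_simps)
  have wt_dual: "wt k \<in> dual t" for k
    unfolding wt_def using \<alpha> \<beta> by (intro dual_add dual_fscale root_dual)
  \<comment> \<open>The string avoids 0, so \<open>t\<close> never occurs in it: each of its weight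
    spaces is a line or zero.\<close>
  have wt_nonzero: "wt k \<noteq> 0" for k
  proof
    assume "wt k = 0"
    then have "\<beta> = fscale (of_int (- k)) \<alpha>"
      by (auto simp: wt_def fscale_def fun_eq_iff add_eq_0_iff2)
    then show False using nm by blast
  qed
  have wt_trivial: "rsp (wt k) = {0}" if "wt k \<notin> \<Phi>" for k
    using that wt_dual wt_nonzero unfolding roots_def by blast
  have "finite {k. wt k \<in> \<Phi>}"
    using finite_vimageI[OF finite_roots \<open>inj wt\<close>] by (simp add: vimage_def)
  moreover have "wt 0 = \<beta>" by (auto simp: wt_def fscale_def fun_eq_iff)
  ultimately obtain p q where pq: "p \<le> 0" "0 \<le> q" "{p..q} \<subseteq> {k. wt k \<in> \<Phi>}"
      "wt (p - 1) \<notin> \<Phi>" "wt (q + 1) \<notin> \<Phi>"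
    using int_component[of "{k. wt k \<in> \<Phi>}"] \<beta> by auto
  obtain E where E: "\<And>\<gamma>. \<gamma> \<in> \<Phi> \<Longrightarrow> E \<gamma> \<in> rsp \<gamma> \<and> E \<gamma> \<noteq> 0"
    using root_vector_exists by metis
  define v where "v k = E (wt k)" for k
  have v: "v k \<in> rsp (wt k)" "v k \<noteq> 0" if "k \<in> {p..q}" for k
    unfolding v_def using E pq(3) that by auto
  have "inj_on E (wt ` {p..q})" "independent (E ` wt ` {p..q})"
    using E pq(3) by (intro independent_weight_vectors; force simp: wt_dual)+
  then have inj: "inj_on v {p..q}" and ind: "independent (v ` {p..q})"
    using \<open>inj wt\<close> unfolding v_def image_image
    by (auto simp: inj_on_def inj_def)
  \<comment> \<open>The brackets with \<open>e\<close> and \<open>f\<close> leave the piece by at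
    most one step, and the spaces at p - 1 and q + 1 are zero. So the piece is stable.\<close>
  have in_span: "x \<in> span (v ` {p..q})" if x: "x \<in> rsp (wt k)" and k: "p - 1 \<le> k" "k \<le> q + 1" for x k
  proof (cases "k \<in> {p..q}")
    case True
    then have "x \<in> span {v k}"
      using root_space_one_dimensional[of "wt k" "v k" x] v x pq(3) by auto
    then show ?thesis using span_mono[of "{v k}" "v ` {p..q}"] True by auto
  next
    case False
    then have "k = p - 1 \<or> k = q + 1" using k by auto
    then show ?thesis using wt_trivial[of k] pq x by (auto simp: span_zero)
  qed
  have "(\<Sum>b\<in>v ` {p..q}. wt (the_inv_into {p..q} v b) h) = 0"
  proof (rule sum_eigenvalues_commutator[OF ind])
    show "bracket e ` v ` {p..q} \<subseteq> span (v ` {p..q})"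
    proof clarify
      fix k assume k: "k \<in> {p..q}"
      show "bracket e (v k) \<in> span (v ` {p..q})"
        using root_space_bracket[OF ef(1) v(1)[OF k]] k unfolding wt_step by (intro in_span[of _ "k + 1"]) auto
    qed
    show "bracket f ` v ` {p..q} \<subseteq> span (v ` {p..q})"
    proof clarify
      fix k assume k: "k \<in> {p..q}"
      show "bracket f (v k) \<in> span (v ` {p..q})"
        using root_space_bracket[OF ef(2) v(1)[OF k]] k unfolding wt_step by (intro in_span[of _ "k - 1"]) auto
    qed
    fix b assume "b \<in> v ` {p..q}"
    then obtain k where k: "k \<in> {p..q}" "b = v k" by auto
    then show "bracket (bracket e f) b = wt (the_inv_into {p..q} v b) h *s b"
      using v(1)[OF k(1)] h unfolding ef(4) h_def[symmetric] k(2) the_inv_into_f_f[OF inj k(1)]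
      by (simp add: root_space_def)
  qed
  then have "(\<Sum>k\<in>{p..q}. \<beta> h + 2 * of_int k) = 0"
    using inj by (simp add: sum.reindex the_inv_into_f_f wt_h)
  \<comment> \<open>Reversing the interval evaluates the sum of an arithmetic progression without a
    division.\<close>
  moreover have "(\<Sum>k\<in>{p..q}. of_int k) = (\<Sum>k\<in>{p..q}. of_int (p + q - k) :: complex)"
    by (rule sum.reindex_bij_witness[of _ "\<lambda>k. p + q - k" "\<lambda>k. p + q - k"]) auto
  then have "(\<Sum>k\<in>{p..q}. 2 * of_int k) = of_nat (card {p..q}) * (of_int (p + q) :: complex)"
    unfolding sum_distrib_left[symmetric] by (simp add: sum_subtractf algebra_simps)
  ultimately have "of_nat (card {p..q}) * (\<beta> h + of_int (p + q)) = 0"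
    by (simp add: sum.distrib algebra_simps)
  moreover have "card {p..q} \<noteq> 0" using pq by auto
  ultimately have "\<beta> h = of_int (- (p + q))"
    by (simp add: add_eq_0_iff2 del: card_atLeastAtMost_int)
  then show ?thesis
    using pq unfolding h_def wt_def by (intro that[of p q]) auto
qed

lemma root_multiple_cases:
  assumes "\<alpha> \<in> \<Phi>" "\<beta> \<in> \<Phi>"
  obtains "\<beta> = \<alpha>" | "\<beta> = - \<alpha>" | "\<And>k::int. \<beta> \<noteq> fscale (of_int k) \<alpha>"
proof (cases "\<exists>k::int. \<beta> = fscale (of_int k) \<alpha>")
  case True
  then obtain k :: int where k: "\<beta> = fscale (of_int k) \<alpha>" by blast
  then have "k = 1 \<or> k = - 1" using root_integer_multiple assms by blast
  then show ?thesis
    using k that(1,2) by (auto simp: fscale_def fun_eq_iff)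
qed (use that in blast)

lemma pairing_integer:
  assumes "\<alpha> \<in> \<Phi>" "\<beta> \<in> \<Phi>"
  obtains n :: int where "\<beta> (coroot \<alpha>) = of_int n"
  using assms
proof (cases rule: root_multiple_cases)
  case 1
  then show ?thesis using that[of 2] root_coroot assms by simp
next
  case 2
  then show ?thesis using that[of "- 2"] root_coroot assms by simp
next
  case 3
  then show ?thesis using root_string[OF assms] that by metis
qed

text \<open>A negative pairing means p + q > 0; with p \<le> 0 this gives q \<ge> 1, so the string
  contains its next element.\<close>

lemma root_add_if_negative:
  assumes "\<alpha> \<in> \<Phi>" "\<beta> \<in> \<Phi>" "\<beta> (coroot \<alpha>) = of_int n" "n < 0" "\<beta> \<noteq> - \<alpha>"
  shows "\<beta> + \<alpha> \<in> \<Phi>"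
  using assms(1,2)
proof (cases rule: root_multiple_cases)
  case 1
  then have "of_int n = (of_int 2 :: complex)" using assms(3) root_coroot[OF assms(1)] by simp
  then have "n = 2" by (simp only: of_int_eq_iff)
  then show ?thesis using assms(4) by simp
next
  case 2
  then show ?thesis using assms by simp
next
  case 3
  obtain p q :: int where pq: "p \<le> 0" "0 \<le> q" "\<And>k. p \<le> k \<Longrightarrow> k \<le> q \<Longrightarrow> \<beta> + fscale (of_int k) \<alpha> \<in> \<Phi>"
    "\<beta> (coroot \<alpha>) = of_int (- (p + q))"
    using root_string[OF assms(1,2) 3] by blast
  have "n = - (p + q)" using pq(4) assms(3) by (simp only: of_int_eq_iff)
  then have "\<beta> + fscale (of_int 1) \<alpha> \<in> \<Phi>" using pq assms(4) by (intro pq(3)) auto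
  moreover have "fscale (of_int 1) \<alpha> = \<alpha>" by (simp add: fscale_def)
  ultimately show ?thesis by simp
qed

section \<open>Reflections and their action on roots\<close>

definition refl :: "('g \<Rightarrow> complex) \<Rightarrow> ('g \<Rightarrow> complex) \<Rightarrow> 'g \<Rightarrow> complex" where
  "refl \<alpha> \<xi> = \<xi> - fscale (\<xi> (coroot \<alpha>)) \<alpha>"

lemma root_reflection_eq_refl:
  assumes "\<alpha> \<in> \<Phi>" "\<xi> \<in> represented" "\<xi> \<in> dual t"
  shows "root_reflection t \<alpha> \<xi> = refl \<alpha> \<xi>"
  unfolding root_reflection_def refl_def dual_form_def
  using assms root_represented[OF assms(1)]
  by (simp add: dual_coroot dual_vector)

lemma refl_add: "refl \<alpha> (\<xi> + \<eta>) = refl \<alpha> \<xi> + refl \<alpha> \<eta>"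
  by (simp add: refl_def fscale_def fun_eq_iff algebra_simps)

lemma refl_fscale: "refl \<alpha> (fscale c \<xi>) = fscale c (refl \<alpha> \<xi>)"
  by (simp add: refl_def fscale_def fun_eq_iff algebra_simps)

lemma refl_uminus: "refl \<alpha> (- \<xi>) = - refl \<alpha> \<xi>"
  by (simp add: refl_def fscale_def fun_eq_iff algebra_simps)

lemma refl_sum: "refl \<alpha> (sum f I) = (\<Sum>i\<in>I. refl \<alpha> (f i))"
proof -
  have "refl \<alpha> 0 = 0" by (simp add: refl_def fscale_def fun_eq_iff)
  then show ?thesis
    by (induction I rule: infinite_finite_induct) (auto simp: refl_add)
qed

lemma refl_refl: "\<alpha> \<in> \<Phi> \<Longrightarrow> refl \<alpha> (refl \<alpha> \<xi>) = \<xi>"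
  by (simp add: refl_def fscale_def fun_eq_iff root_coroot algebra_simps)

text \<open>The reflection moves \<beta> to \<beta> + (p + q) \<alpha>, and p \<le> p + q \<le> q
  because p \<le> 0 \<le> q.\<close>

lemma refl_root:
  assumes "\<alpha> \<in> \<Phi>" "\<beta> \<in> \<Phi>"
  shows "refl \<alpha> \<beta> \<in> \<Phi>"
  using assms
proof (cases rule: root_multiple_cases)
  case 1
  then have "refl \<alpha> \<beta> = - \<alpha>"
    using root_coroot[OF assms(1)] by (simp add: refl_def fscale_def fun_eq_iff)
  then show ?thesis using root_uminus assms by simp
next
  case 2
  then have "refl \<alpha> \<beta> = \<alpha>"
    using root_coroot[OF assms(1)] by (simp add: refl_def fscale_def fun_eq_iff)
  then show ?thesis using assms by simp
next
  case 3
  obtain p q :: int where pq: "p \<le> 0" "0 \<le> q" "\<And>k. p \<le> k \<Longrightarrow> k \<le> q \<Longrightarrow> \<beta> + fscale (of_int k) \<alpha> \<in> \<Phi>"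
    "\<beta> (coroot \<alpha>) = of_int (- (p + q))"
    using root_string[OF assms 3] by blast
  have "refl \<alpha> \<beta> = \<beta> + fscale (of_int (p + q)) \<alpha>"
    unfolding refl_def pq(4) by (simp add: fscale_def fun_eq_iff algebra_simps)
  also have "\<dots> \<in> \<Phi>" using pq(1,2) by (intro pq(3)) auto
  finally show ?thesis .
qed

end


section \<open>Positive systems\<close>

lemma sum_list_apply: "sum_list xs x = sum_list (map (\<lambda>f. f x) xs)"
  for xs :: "('a \<Rightarrow> 'b::comm_monoid_add) list"
  by (induction xs) auto

lemma double_eq_zero:
  fixes x :: "'a \<Rightarrow> complex"
  shows "x = - x \<Longrightarrow> x = 0"
  by (auto simp: fun_eq_iff)

lemma fscale_half_eq_iff: "fscale (1 / 2) x = fscale (1 / 2) y \<longleftrightarrow> x = y"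
  by (auto simp: fscale_def fun_eq_iff)

context cartan_lie_algebra
begin

lemma positive_subset: "positive_system t P \<Longrightarrow> P \<subseteq> \<Phi>"
  and positive_choice: "positive_system t P \<Longrightarrow> \<alpha> \<in> \<Phi> \<Longrightarrow> - \<alpha> \<in> P \<longleftrightarrow> \<alpha> \<notin> P"
  and positive_closed: "positive_system t P \<Longrightarrow> \<alpha> \<in> P \<Longrightarrow> \<beta> \<in> P \<Longrightarrow> \<alpha> + \<beta> \<in> \<Phi> \<Longrightarrow> \<alpha> + \<beta> \<in> P"
  unfolding positive_system_def by blast+

lemma positive_finite: "positive_system t P \<Longrightarrow> finite P"
  using positive_subset finite_roots finite_subset by blast

lemma positive_root: "positive_system t P \<Longrightarrow> \<alpha> \<in> P \<Longrightarrow> \<alpha> \<in> \<Phi>"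
  using positive_subset by blast

lemma positive_uminus: "positive_system t P \<Longrightarrow> \<alpha> \<in> P \<Longrightarrow> - \<alpha> \<notin> P"
  using positive_choice positive_root by blast

text \<open>Pairing a vanishing sum with the coroot of its first term \<open>a\<close> yields a term \<open>y\<close> with
  negative pairing; then \<open>y + a\<close> is a positive root and the sum gets shorter.\<close>

lemma positive_list_sum_nonzero:
  assumes P: "positive_system t P" and "set xs \<subseteq> P" "sum_list xs = 0"
  shows "xs = []"
  using assms(2,3)
proof (induction "length xs" arbitrary: xs rule: less_induct)
  case less
  show ?case
  proof (cases xs)
    case (Cons a ys)
    have a: "a \<in> P" "a \<in> \<Phi>" using less.prems Cons positive_root[OF P] by auto
    have ys: "set ys \<subseteq> P" "set ys \<subseteq> \<Phi>" using less.prems Cons positive_subset[OF P] by auto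
    define n where "n y = (SOME n::int. y (coroot a) = of_int n)" for y :: "'g \<Rightarrow> complex"
    have n: "y (coroot a) = of_int (n y)" if y: "y \<in> \<Phi>" for y
    proof -
      have "\<exists>n::int. y (coroot a) = of_int n" using pairing_integer[OF a(2) y] by blast
      then show ?thesis unfolding n_def by (rule someI_ex)
    qed
    have "of_int (sum_list (map n zs)) = sum_list zs (coroot a)" if "set zs \<subseteq> \<Phi>" for zs
      using that by (induction zs) (auto simp: n)
    then have "of_int (sum_list (map n ys)) = (- 2 :: complex)"
      using less.prems(2) root_coroot[OF a(2)] ys unfolding Cons
      by (simp add: fun_eq_iff sum_list_apply) (metis add_eq_0_iff)
    then have "of_int (sum_list (map n ys)) = (of_int (- 2) :: complex)" by simp
    then have "sum_list (map n ys) = - 2" by (simp only: of_int_eq_iff)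
    then have "\<exists>y\<in>set ys. n y < 0"
      using sum_list_nonneg[of "map n ys"] by force
    then obtain y where y: "y \<in> set ys" "n y < 0" by blast
    then obtain us vs where split: "ys = us @ y # vs" by (meson split_list)
    have yP: "y \<in> P" "y \<in> \<Phi>" using y ys by auto
    then have "y \<noteq> - a" using positive_uminus[OF P a(1)] by auto
    then have "y + a \<in> \<Phi>"
      using root_add_if_negative[OF a(2) yP(2) n[OF yP(2)] y(2)] by simp
    then have "y + a \<in> P" using positive_closed[OF P yP(1) a(1)] by simp
    \<comment> \<open>Two terms are merged into one. The root \<open>y + a\<close> may already occur
      in the list, which is why lists and not sets of roots are used.\<close>
    moreover have "sum_list ((y + a) # us @ vs) = sum_list xs"
      unfolding Cons split by (simp add: add.assoc add.left_commute)
    then have "sum_list ((y + a) # us @ vs) = 0" using less.prems(2) by (simp only:)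
    moreover have "set (us @ vs) \<subseteq> P" using ys split by auto
    moreover have "length ((y + a) # us @ vs) < length xs" unfolding Cons split by simp
    ultimately have "(y + a) # us @ vs = []"
      by (intro less.hyps) auto
    then show ?thesis by simp
  qed
qed

lemma positive_sum_nonzero:
  assumes "positive_system t P" "T \<subseteq> P" "(\<Sum>\<alpha>\<in>T. \<alpha>) = 0"
  shows "T = {}"
proof -
  obtain xs where xs: "set xs = T" "distinct xs"
    using finite_distinct_list[of T] finite_subset positive_finite assms by metis
  then have "sum_list xs = 0"
    using assms(3) sum_list_distinct_conv_sum_set[of xs "\<lambda>\<alpha>. \<alpha>"] by simp
  then show ?thesis using positive_list_sum_nonzero assms xs by auto
qed

text \<open>Both sets pick one root of each pair, so \<open>R - Q\<close> is the negative of
  \<open>Q - R\<close>. Equal sums make the sum over \<open>Q - R\<close> equal to its own negative,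
  hence 0, and \<open>Q - R\<close> is a set of positive roots for \<open>Q\<close>.\<close>

lemma choice_eq_positive_if_sum_eq:
  assumes Q: "positive_system t Q" and R: "R \<subseteq> \<Phi>" "\<And>\<alpha>. \<alpha> \<in> \<Phi> \<Longrightarrow> - \<alpha> \<in> R \<longleftrightarrow> \<alpha> \<notin> R"
    and eq: "(\<Sum>\<alpha>\<in>R. \<alpha>) = (\<Sum>\<alpha>\<in>Q. \<alpha>)"
  shows "R = Q"
proof -
  have fin: "finite Q" "finite R" using finite_roots positive_finite[OF Q] R(1) finite_subset by auto
  have swap: "R - Q = uminus ` (Q - R)"
  proof -
    have "x \<in> uminus ` (Q - R)" if "x \<in> R - Q" for x
      using that R positive_choice[OF Q, of x] by (intro image_eqI[of _ _ "- x"]) auto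
    moreover have "- x \<in> R - Q" if "x \<in> Q - R" for x
      using that R(2)[of x] positive_choice[OF Q, of x] positive_root[OF Q] by auto
    ultimately show ?thesis by blast
  qed
  have "(\<Sum>\<alpha>\<in>R - Q. \<alpha>) = - (\<Sum>\<alpha>\<in>Q - R. \<alpha>)"
    unfolding swap by (subst sum.reindex) (auto simp: sum_negf)
  moreover have "(\<Sum>\<alpha>\<in>R. \<alpha>) = (\<Sum>\<alpha>\<in>R \<inter> Q. \<alpha>) + (\<Sum>\<alpha>\<in>R - Q. \<alpha>)"
    using fin by (rule_tac sum.Int_Diff) auto
  moreover have "(\<Sum>\<alpha>\<in>Q. \<alpha>) = (\<Sum>\<alpha>\<in>R \<inter> Q. \<alpha>) + (\<Sum>\<alpha>\<in>Q - R. \<alpha>)"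
    using fin by (subst Int_commute) (rule_tac sum.Int_Diff, auto)
  ultimately have "(\<Sum>\<alpha>\<in>Q - R. \<alpha>) = - (\<Sum>\<alpha>\<in>Q - R. \<alpha>)"
    using eq by simp
  then have "(\<Sum>\<alpha>\<in>Q - R. \<alpha>) = 0" by (rule double_eq_zero)
  then have "Q - R = {}" using positive_sum_nonzero[OF Q] by blast
  moreover have "R - Q = {}" unfolding swap \<open>Q - R = {}\<close> by simp
  ultimately show ?thesis by blast
qed

definition flip :: "('g \<Rightarrow> complex) set \<Rightarrow> ('g \<Rightarrow> complex) set \<Rightarrow> ('g \<Rightarrow> complex) set" where
  "flip P A = (P - A) \<union> uminus ` A"

lemma flip_choice:
  assumes P: "positive_system t P" and "A \<subseteq> P"
  shows "flip P A \<subseteq> \<Phi>" "\<And>\<alpha>. \<alpha> \<in> \<Phi> \<Longrightarrow> - \<alpha> \<in> flip P A \<longleftrightarrow> \<alpha> \<notin> flip P A"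
    "\<And>\<alpha>. \<alpha> \<in> P \<Longrightarrow> \<alpha> \<in> flip P A \<longleftrightarrow> \<alpha> \<notin> A"
proof -
  have mem: "\<alpha> \<in> flip P A \<longleftrightarrow> (\<alpha> \<in> P \<and> \<alpha> \<notin> A) \<or> - \<alpha> \<in> A" for \<alpha>
    unfolding flip_def by force
  show "flip P A \<subseteq> \<Phi>"
  proof
    fix \<alpha> assume "\<alpha> \<in> flip P A"
    then consider "\<alpha> \<in> P" | "- \<alpha> \<in> P" using mem assms(2) by blast
    then show "\<alpha> \<in> \<Phi>" using positive_root[OF P] root_uminus[of "- \<alpha>"] by cases auto
  qed
  show "- \<alpha> \<in> flip P A \<longleftrightarrow> \<alpha> \<notin> flip P A" if "\<alpha> \<in> \<Phi>" for \<alpha>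
    unfolding mem using assms(2) positive_choice[OF P that] by auto
  show "\<alpha> \<in> flip P A \<longleftrightarrow> \<alpha> \<notin> A" if "\<alpha> \<in> P" for \<alpha>
    unfolding mem using assms(2) positive_uminus[OF P that] that by auto
qed

lemma mu_of_eq_rho_flip:
  assumes P: "positive_system t P" and "A \<subseteq> P"
  shows "mu_of P A = rho (flip P A)"
proof -
  have fin: "finite P" "finite A" using positive_finite[OF P] assms(2) finite_subset by auto
  have "(P - A) \<inter> uminus ` A = {}"
    using assms(2) positive_uminus[OF P] by auto
  then have "(\<Sum>\<alpha>\<in>flip P A. \<alpha>) = (\<Sum>\<alpha>\<in>P - A. \<alpha>) + (\<Sum>\<alpha>\<in>uminus ` A. \<alpha>)"
    unfolding flip_def using fin by (intro sum.union_disjoint) auto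
  also have "(\<Sum>\<alpha>\<in>uminus ` A. \<alpha>) = - (\<Sum>\<alpha>\<in>A. \<alpha>)"
    by (subst sum.reindex) (auto simp: sum_negf)
  finally show ?thesis unfolding mu_of_def rho_def diff_conv_add_uminus by (simp only:)
qed

lemma mu_of_eq_rho_iff:
  assumes P: "positive_system t P" and "A \<subseteq> P" and Q: "positive_system t Q"
  shows "mu_of P A = rho Q \<longleftrightarrow> flip P A = Q"
proof
  assume "mu_of P A = rho Q"
  then have "(\<Sum>\<alpha>\<in>flip P A. \<alpha>) = (\<Sum>\<alpha>\<in>Q. \<alpha>)"
    unfolding mu_of_eq_rho_flip[OF assms(1,2)] rho_def fscale_half_eq_iff .
  then show "flip P A = Q"
    using flip_choice[OF assms(1,2)] by (intro choice_eq_positive_if_sum_eq[OF Q]) auto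
qed (use mu_of_eq_rho_flip assms in simp)

text \<open>The two clauses of saturation express closedness of \<open>flip P A\<close> for two
  roots from the same part, \<open>-A\<close> or \<open>P - A\<close>. The mixed case is a
  consequence of these.\<close>

lemma saturated_iff_flip_positive:
  assumes P: "positive_system t P" and A: "A \<subseteq> P"
  shows "saturated t P A \<longleftrightarrow> positive_system t (flip P A)"
proof
  assume sat: "saturated t P A"
  have mem: "\<alpha> \<in> flip P A \<longleftrightarrow> (\<alpha> \<in> P - A) \<or> - \<alpha> \<in> A" for \<alpha>
    unfolding flip_def by force
  have sA: "\<alpha> + \<beta> \<in> A" if "\<alpha> \<in> A" "\<beta> \<in> A" "\<alpha> + \<beta> \<in> \<Phi>" for \<alpha> \<beta>
    using sat that unfolding saturated_def by blast
  have sP: "\<alpha> + \<beta> \<in> P - A" if "\<alpha> \<in> P - A" "\<beta> \<in> P - A" "\<alpha> + \<beta> \<in> \<Phi>" for \<alpha> \<beta>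
    using sat that positive_closed[OF P, of \<alpha> \<beta>] unfolding saturated_def by blast
  \<comment> \<open>If \<gamma> + \<beta> were in \<open>A\<close>, adding -\<beta> would put
    \<gamma> in \<open>A\<close>. If -(\<gamma> + \<beta>) were in \<open>P - A\<close>, adding
    \<gamma> would put -\<beta> in \<open>P - A\<close>.\<close>
  have mixed: "\<gamma> + \<beta> \<in> flip P A" if g: "\<gamma> \<in> P - A" and b: "- \<beta> \<in> A" and s: "\<gamma> + \<beta> \<in> \<Phi>" for \<gamma> \<beta>
  proof (cases "\<gamma> + \<beta> \<in> P")
    case True
    have "\<gamma> + \<beta> \<notin> A"
      using sA[of "\<gamma> + \<beta>" "- \<beta>"] b g positive_root[OF P] by auto
    then show ?thesis using True mem by blast
  next
    case False
    then have "- (\<gamma> + \<beta>) \<in> P" using positive_choice[OF P s] by blast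
    moreover have "- (\<gamma> + \<beta>) \<in> A"
    proof (rule ccontr)
      assume "- (\<gamma> + \<beta>) \<notin> A"
      then have "\<gamma> + - (\<gamma> + \<beta>) \<in> P - A"
        using g calculation b A positive_root[OF P, of "- \<beta>"] by (intro sP) auto
      then show False using b by simp
    qed
    ultimately show ?thesis using mem by blast
  qed
  have "\<alpha> + \<beta> \<in> flip P A" if ab: "\<alpha> \<in> flip P A" "\<beta> \<in> flip P A" "\<alpha> + \<beta> \<in> \<Phi>" for \<alpha> \<beta>
  proof -
    consider "\<alpha> \<in> P - A" "\<beta> \<in> P - A" | "\<alpha> \<in> P - A" "- \<beta> \<in> A" | "- \<alpha> \<in> A" "\<beta> \<in> P - A" | "- \<alpha> \<in> A" "- \<beta> \<in> A"
      using ab mem by blast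
    then show ?thesis
    proof cases
      case 1
      then show ?thesis using sP ab mem by blast
    next
      case 2
      then show ?thesis using mixed ab by blast
    next
      case 3
      then show ?thesis using mixed[of \<beta> \<alpha>] ab by (simp add: add.commute)
    next
      case 4
      have "- \<alpha> + - \<beta> = - (\<alpha> + \<beta>)" by simp
      then show ?thesis using sA[OF 4] root_uminus[OF ab(3)] mem by metis
    qed
  qed
  then show "positive_system t (flip P A)"
    using flip_choice[OF assms] unfolding positive_system_def by blast
next
  assume pos: "positive_system t (flip P A)"
  note mem = flip_choice(3)[OF assms]
  have "\<alpha> + \<beta> \<in> A" if "\<alpha> \<in> A" "\<beta> \<in> A" "\<alpha> + \<beta> \<in> \<Phi>" for \<alpha> \<beta>
  proof -
    have "- \<alpha> \<in> flip P A" "- \<beta> \<in> flip P A" using that unfolding flip_def by auto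
    then have "- \<alpha> + - \<beta> \<in> flip P A"
      using root_uminus[OF that(3)] by (intro positive_closed[OF pos]) (auto simp: add.commute)
    then have "\<alpha> + \<beta> \<notin> flip P A"
      using flip_choice(2)[OF assms that(3)] by (simp add: add.commute)
    moreover have "\<alpha> + \<beta> \<in> P" using that A positive_closed[OF P] by blast
    ultimately show ?thesis using mem by blast
  qed
  moreover have "\<gamma> + \<delta> \<notin> A" if "\<gamma> \<in> P - A" "\<delta> \<in> P - A" "\<gamma> + \<delta> \<in> \<Phi>" for \<gamma> \<delta>
  proof -
    have "\<gamma> + \<delta> \<in> flip P A"
      using that mem by (intro positive_closed[OF pos]) auto
    moreover have "\<gamma> + \<delta> \<in> P" using that positive_closed[OF P, of \<gamma> \<delta>] by simp
    ultimately show ?thesis using mem by blast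
  qed
  ultimately show "saturated t P A" unfolding saturated_def by blast
qed

lemma root_double: "\<alpha> \<in> \<Phi> \<Longrightarrow> \<alpha> + \<alpha> \<notin> \<Phi>"
proof
  assume a: "\<alpha> \<in> \<Phi>" "\<alpha> + \<alpha> \<in> \<Phi>"
  have "\<alpha> + \<alpha> = fscale (of_int 2) \<alpha>" by (auto simp: fscale_def)
  then show False using root_integer_multiple[OF a(1), of 2] a(2) by simp
qed

lemma mu_of_eq_if_sum_eq:
  assumes "finite P" "A \<subseteq> P" "B \<subseteq> P" "(\<Sum>\<alpha>\<in>A. \<alpha>) = (\<Sum>\<alpha>\<in>B. \<alpha>)"
  shows "mu_of P A = mu_of P B"
  using assms unfolding mu_of_def by (simp add: sum_diff finite_subset)

text \<open>Without saturation, exchanging \<alpha> and \<beta> for \<alpha> + \<beta>, in either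
  direction, gives a second subset of the same weight. With it, \<open>flip P A\<close> is a
  positive system and is recovered from its half sum.\<close>

lemma saturated_iff_unique:
  assumes P: "positive_system t P" and A: "A \<subseteq> P"
  shows "card {B. B \<subseteq> P \<and> mu_of P B = mu_of P A} = 1 \<longleftrightarrow> saturated t P A"
proof
  assume "card {B. B \<subseteq> P \<and> mu_of P B = mu_of P A} = 1"
  then obtain C where C: "{B. B \<subseteq> P \<and> mu_of P B = mu_of P A} = {C}" by (rule card_1_singletonE)
  have eqC: "B = C" if "B \<subseteq> P" "mu_of P B = mu_of P A" for B
  proof -
    have "B \<in> {C}" unfolding C[symmetric] using that by simp
    then show ?thesis by simp
  qed
  have uniq: "B = A" if "B \<subseteq> P" "mu_of P B = mu_of P A" for B
    using eqC[OF that] eqC[OF A] by simp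
  have fin: "finite P" "finite A" using positive_finite[OF P] A finite_subset by auto
  show "saturated t P A"
    unfolding saturated_def
  proof (intro conjI ballI impI)
    fix \<alpha> \<beta> assume ab: "\<alpha> \<in> A" "\<beta> \<in> A" "\<alpha> + \<beta> \<in> \<Phi>"
    have "\<alpha> + \<beta> \<in> P" using positive_closed[OF P] ab A by blast
    \<comment> \<open>Needed so that two different elements are traded for their sum.\<close>
    have "\<alpha> \<noteq> \<beta>" using root_double ab A positive_root[OF P] by blast
    show "\<alpha> + \<beta> \<in> A"
    proof (rule ccontr)
      assume nin: "\<alpha> + \<beta> \<notin> A"
      have "(\<Sum>\<gamma>\<in>A. \<gamma>) = \<alpha> + (\<Sum>\<gamma>\<in>A - {\<alpha>}. \<gamma>)"
        using fin ab by (intro sum.remove) auto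
      also have "(\<Sum>\<gamma>\<in>A - {\<alpha>}. \<gamma>) = \<beta> + (\<Sum>\<gamma>\<in>A - {\<alpha>} - {\<beta>}. \<gamma>)"
        using fin ab \<open>\<alpha> \<noteq> \<beta>\<close> by (intro sum.remove) auto
      also have "\<alpha> + (\<beta> + (\<Sum>\<gamma>\<in>A - {\<alpha>} - {\<beta>}. \<gamma>)) = (\<Sum>\<gamma>\<in>insert (\<alpha> + \<beta>) (A - {\<alpha>} - {\<beta>}). \<gamma>)"
        using fin nin by (subst sum.insert) (auto simp: add.assoc)
      finally have "insert (\<alpha> + \<beta>) (A - {\<alpha>} - {\<beta>}) = A"
        using A fin \<open>\<alpha> + \<beta> \<in> P\<close> by (intro uniq mu_of_eq_if_sum_eq) auto
      then show False using nin by blast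
    qed
  next
    fix \<gamma> \<delta> assume gd: "\<gamma> \<in> P - A" "\<delta> \<in> P - A" "\<gamma> + \<delta> \<in> \<Phi>"
    have "\<gamma> \<noteq> \<delta>" using root_double gd positive_root[OF P] by blast
    show "\<gamma> + \<delta> \<notin> A"
    proof
      assume "\<gamma> + \<delta> \<in> A"
      then have "(\<Sum>\<alpha>\<in>A. \<alpha>) = \<gamma> + \<delta> + (\<Sum>\<alpha>\<in>A - {\<gamma> + \<delta>}. \<alpha>)"
        using fin by (intro sum.remove) auto
      also have "\<dots> = (\<Sum>\<alpha>\<in>insert \<gamma> (insert \<delta> (A - {\<gamma> + \<delta>})). \<alpha>)"
        using fin gd \<open>\<gamma> \<noteq> \<delta>\<close> by (simp add: add.assoc)
      finally have "insert \<gamma> (insert \<delta> (A - {\<gamma> + \<delta>})) = A"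
        using A fin gd by (intro uniq mu_of_eq_if_sum_eq) auto
      then show False using gd by blast
    qed
  qed
next
  assume "saturated t P A"
  then have Q: "positive_system t (flip P A)" using saturated_iff_flip_positive assms by blast
  have "B = A" if B: "B \<subseteq> P" "mu_of P B = mu_of P A" for B
  proof -
    have "flip P B = flip P A"
      using mu_of_eq_rho_iff[OF P B(1) Q] mu_of_eq_rho_flip[OF assms] B(2) by simp
    then show ?thesis using flip_choice(3)[OF P A] flip_choice(3)[OF P B(1)] A B(1) by blast
  qed
  then have "{B. B \<subseteq> P \<and> mu_of P B = mu_of P A} = {A}" using A by blast
  then show "card {B. B \<subseteq> P \<and> mu_of P B = mu_of P A} = 1" by simp
qed

section \<open>Reflections of positive systems and transitivity of the Weyl group\<close>

lemma refl_in_positive_image: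
  assumes "\<alpha> \<in> \<Phi>"
  shows "\<gamma> \<in> refl \<alpha> ` Q \<longleftrightarrow> refl \<alpha> \<gamma> \<in> Q"
proof
  assume "refl \<alpha> \<gamma> \<in> Q"
  then have "refl \<alpha> (refl \<alpha> \<gamma>) \<in> refl \<alpha> ` Q" by (rule imageI)
  then show "\<gamma> \<in> refl \<alpha> ` Q" by (simp add: refl_refl assms)
qed (auto simp: refl_refl assms)

lemma positive_system_refl:
  assumes \<alpha>: "\<alpha> \<in> \<Phi>" and Q: "positive_system t Q"
  shows "positive_system t (refl \<alpha> ` Q)"
  unfolding positive_system_def
proof (intro conjI ballI impI)
  show "refl \<alpha> ` Q \<subseteq> \<Phi>" using refl_root[OF \<alpha>] positive_root[OF Q] by blast
  show "(\<gamma> \<in> refl \<alpha> ` Q) \<noteq> (- \<gamma> \<in> refl \<alpha> ` Q)" if "\<gamma> \<in> \<Phi>" for \<gamma>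
    unfolding refl_in_positive_image[OF \<alpha>] refl_uminus
    using positive_choice[OF Q refl_root[OF \<alpha> that]] by blast
  show "\<beta> + \<gamma> \<in> refl \<alpha> ` Q" if "\<beta> \<in> refl \<alpha> ` Q" "\<gamma> \<in> refl \<alpha> ` Q" "\<beta> + \<gamma> \<in> \<Phi>" for \<beta> \<gamma>
    using that refl_root[OF \<alpha> that(3)] positive_closed[OF Q]
    unfolding refl_in_positive_image[OF \<alpha>] refl_add by blast
qed

lemma rho_refl:
  assumes "\<alpha> \<in> \<Phi>"
  shows "rho (refl \<alpha> ` Q) = refl \<alpha> (rho Q)"
proof -
  have "inj_on (refl \<alpha>) Q" by (rule inj_on_inverseI[of _ "refl \<alpha>"]) (simp add: refl_refl assms)
  then have "(\<Sum>\<beta>\<in>refl \<alpha> ` Q. \<beta>) = (\<Sum>\<beta>\<in>Q. refl \<alpha> \<beta>)"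
    by (rule sum.reindex_cong) auto
  then show ?thesis
    unfolding rho_def refl_fscale using refl_sum[of \<alpha> "\<lambda>\<beta>. \<beta>" Q] by (simp only:)
qed

text \<open>\<open>root_reflection\<close> is computed with the dual vector of its argument; \<rho>
  has one, being a combination of roots, so there it agrees with the linear map
  \<open>refl\<close>.\<close>

lemma root_reflection_rho:
  assumes "\<alpha> \<in> \<Phi>" "positive_system t Q"
  shows "root_reflection t \<alpha> (rho Q) = rho (refl \<alpha> ` Q)"
proof -
  have "rho Q \<in> represented" "rho Q \<in> dual t"
    unfolding rho_def using assms positive_root root_represented root_dual
    by (auto intro!: represented_fscale represented_sum dual_fscale dual_sum)
  then show ?thesis using root_reflection_eq_refl rho_refl assms by simp
qed

text \<open>Only the value at \<open>rho P\<close> is tracked: each reflection carries the half sum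
  of one positive system to that of another.\<close>

lemma weyl_rho_positive:
  assumes "w \<in> weyl_group t" and P: "positive_system t P"
  shows "\<exists>Q. positive_system t Q \<and> w (rho P) = rho Q"
  using assms(1)
proof (induction rule: weyl_group.induct)
  case weyl_id
  then show ?case using P by auto
next
  case (weyl_reflection w \<alpha>)
  then show ?case using positive_system_refl root_reflection_rho by (metis o_apply)
qed

text \<open>Order \<open>Q\<close> by letting \<beta> precede \<alpha> when \<alpha> is \<beta> plus
  a nonempty sum from \<open>Q\<close>. If a minimal \<alpha> outside \<open>P\<close> were \<beta>
  + \<gamma>, both summands would lie in \<open>P\<close>, and so would \<alpha>.\<close>

lemma minimal_positive_outside:
  assumes Q: "positive_system t Q" and "\<not> Q \<subseteq> P"
    and P: "positive_system t P"
  obtains \<alpha> where "\<alpha> \<in> Q - P" "\<And>\<beta> \<gamma>. \<beta> \<in> Q \<Longrightarrow> \<gamma> \<in> Q \<Longrightarrow> \<alpha> \<noteq> \<beta> + \<gamma>"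
proof -
  \<comment> \<open>Sums of arbitrary lists make the relation transitive; it is irreflexive because
    no nonempty sum of roots in \<open>Q\<close> vanishes.\<close>
  define r where "r = {(\<beta>, \<alpha>). \<beta> \<in> Q \<and> \<alpha> \<in> Q \<and> (\<exists>xs. xs \<noteq> [] \<and> set xs \<subseteq> Q \<and> \<alpha> = \<beta> + sum_list xs)}"
  have "finite r"
    by (rule finite_subset[of _ "Q \<times> Q"]) (use positive_finite[OF Q] in \<open>auto simp: r_def\<close>)
  moreover have "trans r"
  proof (rule transI)
    fix a b c assume "(a, b) \<in> r" "(b, c) \<in> r"
    then obtain xs ys where "a \<in> Q" "c \<in> Q" "xs \<noteq> []" "set xs \<subseteq> Q" "set ys \<subseteq> Q" "c = a + sum_list xs + sum_list ys"
      unfolding r_def by auto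
    then show "(a, c) \<in> r"
      unfolding r_def by (auto intro!: exI[of _ "xs @ ys"] simp: add.assoc)
  qed
  moreover have "(a, a) \<notin> r" for a
    using positive_list_sum_nonzero[OF Q] unfolding r_def by auto
  ultimately have "wf r"
    by (intro finite_acyclic_wf) (auto simp: acyclic_def trancl_id)
  then obtain \<alpha> where \<alpha>: "\<alpha> \<in> Q - P" "\<And>\<beta>. (\<beta>, \<alpha>) \<in> r \<Longrightarrow> \<beta> \<notin> Q - P"
    using assms(2) wfE_min[of r _ "Q - P"] by blast
  have "\<alpha> \<noteq> \<beta> + \<gamma>" if "\<beta> \<in> Q" "\<gamma> \<in> Q" for \<beta> \<gamma>
  proof
    assume eq: "\<alpha> = \<beta> + \<gamma>"
    have "(\<beta>, \<alpha>) \<in> r" unfolding r_def using that \<alpha> eq by (auto intro!: exI[of _ "[\<gamma>]"])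
    moreover have "(\<gamma>, \<alpha>) \<in> r"
      unfolding r_def using that \<alpha> eq by (auto intro!: exI[of _ "[\<beta>]"] simp: add.commute)
    ultimately have "\<beta> \<in> P" "\<gamma> \<in> P" using \<alpha>(2) that by blast+
    then have "\<alpha> \<in> P" using positive_closed[OF P] eq \<alpha>(1) positive_root[OF Q] by blast
    then show False using \<alpha> by blast
  qed
  then show ?thesis using that \<alpha>(1) by blast
qed

text \<open>The reflection in an indecomposable root moves along root strings which cannot cross from
  \<open>Q\<close> to \<open>-Q\<close>.\<close>

lemma refl_indecomposable:
  assumes Q: "positive_system t Q" and \<alpha>: "\<alpha> \<in> Q"
    and ind: "\<And>\<beta> \<gamma>. \<beta> \<in> Q \<Longrightarrow> \<gamma> \<in> Q \<Longrightarrow> \<alpha> \<noteq> \<beta> + \<gamma>"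
    and \<beta>: "\<beta> \<in> Q" "\<beta> \<noteq> \<alpha>"
  shows "refl \<alpha> \<beta> \<in> Q"
proof -
  have roots: "\<alpha> \<in> \<Phi>" "\<beta> \<in> \<Phi>" using \<alpha> \<beta> positive_root[OF Q] by auto
  then show ?thesis
  proof (cases rule: root_multiple_cases)
    case 1
    then show ?thesis using \<beta> by simp
  next
    case 2
    then show ?thesis using positive_uminus[OF Q \<alpha>] \<beta> by simp
  next
    case 3
    obtain p q :: int where pq: "p \<le> 0" "0 \<le> q" "\<And>k. p \<le> k \<Longrightarrow> k \<le> q \<Longrightarrow> \<beta> + fscale (of_int k) \<alpha> \<in> \<Phi>"
      "\<beta> (coroot \<alpha>) = of_int (- (p + q))"
      using root_string[OF roots 3] by blast
    \<comment> \<open>Climbing the string adds \<alpha> from \<open>Q\<close>, so closedness of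
      \<open>Q\<close> suffices.\<close>
    have up: "int n \<le> q \<longrightarrow> \<beta> + fscale (of_int (int n)) \<alpha> \<in> Q" for n
    proof (induction n)
      case 0
      have "\<beta> + fscale (of_int (int 0)) \<alpha> = \<beta>" by (simp add: fscale_def fun_eq_iff)
      then show ?case using \<beta> by simp
    next
      case (Suc n)
      have eq: "\<beta> + fscale (of_int (int (Suc n))) \<alpha> = (\<beta> + fscale (of_int (int n)) \<alpha>) + \<alpha>"
        by (simp add: fscale_def fun_eq_iff algebra_simps)
      show ?case
      proof
        assume le: "int (Suc n) \<le> q"
        then have "(\<beta> + fscale (of_int (int n)) \<alpha>) + \<alpha> \<in> \<Phi>"
          using pq(3)[of "int (Suc n)"] pq(1) unfolding eq by simp
        then show "\<beta> + fscale (of_int (int (Suc n))) \<alpha> \<in> Q"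
          unfolding eq using Suc.IH le by (intro positive_closed[OF Q _ \<alpha>]) linarith+
      qed
    qed
    \<comment> \<open>Descending is where indecomposability enters: if \<open>?x\<close> is in
      \<open>Q\<close> but \<open>?y\<close> = \<open>?x\<close> - \<alpha> is not, then \<alpha> is
      the sum of \<open>?x\<close> and -\<open>?y\<close>, both in \<open>Q\<close>.\<close>
    have down: "p \<le> - int n \<longrightarrow> \<beta> + fscale (of_int (- int n)) \<alpha> \<in> Q" for n
    proof (induction n)
      case 0
      have "\<beta> + fscale (of_int (- int 0)) \<alpha> = \<beta>" by (simp add: fscale_def fun_eq_iff)
      then show ?case using \<beta> by simp
    next
      case (Suc n)
      let ?x = "\<beta> + fscale (of_int (- int n)) \<alpha>" and ?y = "\<beta> + fscale (of_int (- int (Suc n))) \<alpha>"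
      have eq: "\<alpha> = ?x + - ?y"
        by (simp add: fscale_def fun_eq_iff algebra_simps)
      show ?case
      proof
        assume le: "p \<le> - int (Suc n)"
        then have y: "?y \<in> \<Phi>" using pq by (intro pq(3)) auto
        show "?y \<in> Q"
        proof (rule ccontr)
          assume "?y \<notin> Q"
          then have "- ?y \<in> Q" using positive_choice[OF Q y] by blast
          moreover have "?x \<in> Q" by (rule mp[OF Suc.IH]) (use le in simp)
          ultimately show False using ind eq by blast
        qed
      qed
    qed
    have refl: "refl \<alpha> \<beta> = \<beta> + fscale (of_int (p + q)) \<alpha>"
      unfolding refl_def pq(4) by (simp add: fscale_def fun_eq_iff algebra_simps)
    show ?thesis
    proof (cases "p + q \<ge> 0")
      case True
      then show ?thesis using up[of "nat (p + q)"] pq unfolding refl by simp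
    next
      case False
      then have "- int (nat (- (p + q))) = p + q" by simp
      then show ?thesis using down[of "nat (- (p + q))"] pq unfolding refl by simp
    qed
  qed
qed

text \<open>Reflecting in an indecomposable root \<alpha> of \<open>Q\<close> outside
  \<open>P\<close> replaces \<alpha> by -\<alpha>, which lies in \<open>P\<close>, and permutes the
  rest of \<open>Q\<close>. So \<open>Q - P\<close> loses an element.\<close>

lemma weyl_transitive:
  assumes P: "positive_system t P" and Q: "positive_system t Q"
  shows "\<exists>w\<in>weyl_group t. rho Q = w (rho P)"
  using Q
proof (induction "card (Q - P)" arbitrary: Q rule: less_induct)
  case less
  note Q = less.prems
  show ?case
  proof (cases "Q \<subseteq> P")
    case True
    have "P \<subseteq> Q"
    proof
      fix \<alpha> assume \<alpha>: "\<alpha> \<in> P"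
      then show "\<alpha> \<in> Q"
        using positive_choice[OF Q positive_root[OF P \<alpha>]] positive_uminus[OF P \<alpha>] True by blast
    qed
    then have "Q = P" using True by blast
    then show ?thesis using weyl_group.weyl_id[of t] by (metis id_apply)
  next
    case False
    obtain \<alpha> where \<alpha>: "\<alpha> \<in> Q - P" and ind: "\<And>\<beta> \<gamma>. \<beta> \<in> Q \<Longrightarrow> \<gamma> \<in> Q \<Longrightarrow> \<alpha> \<noteq> \<beta> + \<gamma>"
      using minimal_positive_outside[OF Q False P] by blast
    have root: "\<alpha> \<in> \<Phi>" using \<alpha> positive_root[OF Q] by blast
    have "- \<alpha> \<in> P" using \<alpha> positive_choice[OF P root] by blast
    have "refl \<alpha> \<alpha> = - \<alpha>"
      using root_coroot[OF root] by (simp add: refl_def fscale_def fun_eq_iff)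
    have "refl \<alpha> ` Q - P \<subseteq> (Q - P) - {\<alpha>}"
    proof clarify
      fix \<beta> assume \<beta>: "\<beta> \<in> Q" "refl \<alpha> \<beta> \<notin> P"
      have "\<beta> \<noteq> \<alpha>" using \<beta> \<open>refl \<alpha> \<alpha> = - \<alpha>\<close> \<open>- \<alpha> \<in> P\<close> by auto
      then have "refl \<alpha> \<beta> \<in> Q" using refl_indecomposable[OF Q] \<alpha> ind \<beta> by blast
      moreover have "refl \<alpha> \<beta> \<noteq> \<alpha>"
      proof
        assume "refl \<alpha> \<beta> = \<alpha>"
        then have "\<beta> = - \<alpha>" using refl_refl[OF root, of \<beta>] \<open>refl \<alpha> \<alpha> = - \<alpha>\<close> by simp
        then show False using \<beta> \<alpha> positive_uminus[OF Q, of \<alpha>] by blast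
      qed
      ultimately show "refl \<alpha> \<beta> \<in> (Q - P) - {\<alpha>}" using \<beta> by blast
    qed
    then have "card (refl \<alpha> ` Q - P) < card (Q - P)"
      using \<alpha> positive_finite[OF Q] by (intro psubset_card_mono) auto
    then obtain w where w: "w \<in> weyl_group t" "rho (refl \<alpha> ` Q) = w (rho P)"
      using less.hyps positive_system_refl[OF root Q] by blast
    have "rho Q = root_reflection t \<alpha> (rho (refl \<alpha> ` Q))"
    proof -
      have "refl \<alpha> ` refl \<alpha> ` Q = Q" using refl_refl[OF root] by (simp add: image_image)
      then show ?thesis
        using root_reflection_rho[OF root positive_system_refl[OF root Q]] by simp
    qed
    then have "rho Q = (root_reflection t \<alpha> \<circ> w) (rho P)" using w by simp
    then show ?thesis using weyl_group.weyl_reflection[OF w(1) root] by blast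
  qed
qed

lemma saturated_iff_weyl:
  assumes P: "positive_system t P" and A: "A \<subseteq> P"
  shows "saturated t P A \<longleftrightarrow> (\<exists>w\<in>weyl_group t. mu_of P A = w (rho P))"
proof
  assume "saturated t P A"
  then have "positive_system t (flip P A)" using saturated_iff_flip_positive assms by blast
  then show "\<exists>w\<in>weyl_group t. mu_of P A = w (rho P)"
    using weyl_transitive[OF P] mu_of_eq_rho_flip[OF assms] by simp
next
  assume "\<exists>w\<in>weyl_group t. mu_of P A = w (rho P)"
  then obtain Q where Q: "positive_system t Q" "mu_of P A = rho Q"
    using weyl_rho_positive[OF _ P] by metis
  then have "flip P A = Q" using mu_of_eq_rho_iff[OF assms] by blast
  then show "saturated t P A" using saturated_iff_flip_positive assms Q by blast
qed

end


section \<open>Exterior powers\<close>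

lemma sum_fun_apply: "(\<Sum>i\<in>I. f i) x = (\<Sum>i\<in>I. f i x)"
  for f :: "'i \<Rightarrow> 'a \<Rightarrow> 'b::comm_monoid_add"
  by (induction I rule: infinite_finite_induct) auto

context complex_vector_space
begin

lemma exterior_outside: "\<omega> \<in> exterior V \<Longrightarrow> \<not> set \<phi>s \<subseteq> dual V \<Longrightarrow> \<omega> \<phi>s = 0"
  and exterior_add: "\<omega> \<in> exterior V \<Longrightarrow> set xs \<union> set ys \<union> {\<phi>, \<psi>} \<subseteq> dual V \<Longrightarrow>
    \<omega> (xs @ (\<phi> + \<psi>) # ys) = \<omega> (xs @ \<phi> # ys) + \<omega> (xs @ \<psi> # ys)"
  and exterior_fscale: "\<omega> \<in> exterior V \<Longrightarrow> set xs \<union> set ys \<union> {\<phi>} \<subseteq> dual V \<Longrightarrow>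
    \<omega> (xs @ fscale c \<phi> # ys) = c * \<omega> (xs @ \<phi> # ys)"
  and exterior_alternating: "\<omega> \<in> exterior V \<Longrightarrow> \<not> distinct \<phi>s \<Longrightarrow> \<omega> \<phi>s = 0"
  unfolding exterior_def by blast+

lemma exteriorI:
  assumes "\<And>\<phi>s. \<not> set \<phi>s \<subseteq> dual V \<Longrightarrow> \<omega> \<phi>s = 0"
    and "\<And>xs ys \<phi> \<psi>. set xs \<union> set ys \<union> {\<phi>, \<psi>} \<subseteq> dual V \<Longrightarrow>
        \<omega> (xs @ (\<phi> + \<psi>) # ys) = \<omega> (xs @ \<phi> # ys) + \<omega> (xs @ \<psi> # ys)"
    and "\<And>xs ys c \<phi>. set xs \<union> set ys \<union> {\<phi>} \<subseteq> dual V \<Longrightarrow>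
        \<omega> (xs @ fscale c \<phi> # ys) = c * \<omega> (xs @ \<phi> # ys)"
    and "\<And>\<phi>s. set \<phi>s \<subseteq> dual V \<Longrightarrow> \<not> distinct \<phi>s \<Longrightarrow> \<omega> \<phi>s = 0"
  shows "\<omega> \<in> exterior V"
proof -
  have "\<omega> \<phi>s = 0" if "\<not> distinct \<phi>s" for \<phi>s
    using assms(1,4) that by blast
  then show ?thesis
    unfolding exterior_def by (intro CollectI conjI allI impI) (simp_all add: assms(1,2,3))
qed

lemma subspace_exterior: "fun_vs.subspace (exterior V)"
proof (rule fun_vs.subspaceI)
  show "0 \<in> exterior V" by (rule exteriorI) auto
  show "\<omega> + \<eta> \<in> exterior V" if "\<omega> \<in> exterior V" "\<eta> \<in> exterior V" for \<omega> \<eta>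
    by (rule exteriorI) (use that in \<open>simp_all add: exterior_outside exterior_add exterior_fscale exterior_alternating algebra_simps\<close>)
  show "fscale c \<omega> \<in> exterior V" if "\<omega> \<in> exterior V" for c \<omega>
    by (rule exteriorI) (use that in \<open>simp_all add: fscale_def[of c] exterior_outside exterior_add exterior_fscale exterior_alternating algebra_simps\<close>)
qed

lemma contract_exterior:
  assumes "\<omega> \<in> exterior V" "\<phi> \<in> dual V"
  shows "contract \<phi> \<omega> \<in> exterior V"
proof (rule exteriorI)
  show "contract \<phi> \<omega> \<phi>s = 0" if "\<not> set \<phi>s \<subseteq> dual V" for \<phi>s
    using that assms exterior_outside[of \<omega> V "\<phi> # \<phi>s"] by (simp add: contract_def)
  show "contract \<phi> \<omega> (xs @ (\<chi> + \<psi>) # ys) = contract \<phi> \<omega> (xs @ \<chi> # ys) + contract \<phi> \<omega> (xs @ \<psi> # ys)"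
    if "set xs \<union> set ys \<union> {\<chi>, \<psi>} \<subseteq> dual V" for xs ys \<chi> \<psi>
    using that assms exterior_add[of \<omega> V "\<phi> # xs" ys \<chi> \<psi>] by (simp add: contract_def)
  show "contract \<phi> \<omega> (xs @ fscale c \<psi> # ys) = c * contract \<phi> \<omega> (xs @ \<psi> # ys)"
    if "set xs \<union> set ys \<union> {\<psi>} \<subseteq> dual V" for xs ys c \<psi>
    using that assms exterior_fscale[of \<omega> V "\<phi> # xs" ys \<psi> c] by (simp add: contract_def)
  show "contract \<phi> \<omega> \<phi>s = 0" if "\<not> distinct \<phi>s" for \<phi>s
    using that assms exterior_alternating[of \<omega> V "\<phi> # \<phi>s"] by (simp add: contract_def)
qed

text \<open>Polarization of the vanishing value with a + b in both places.\<close>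

lemma exterior_swap:
  assumes "\<omega> \<in> exterior V"
  shows "\<omega> (us @ a # b # vs) = - \<omega> (us @ b # a # vs)"
proof (cases "set us \<union> set vs \<union> {a, b} \<subseteq> dual V")
  case True
  then have ab: "a + b \<in> dual V" using dual_add by auto
  have "0 = \<omega> (us @ (a + b) # (a + b) # vs)"
    using assms by (subst exterior_alternating) auto
  also have "\<dots> = \<omega> ((us @ [a]) @ (a + b) # vs) + \<omega> ((us @ [b]) @ (a + b) # vs)"
    using True ab assms by (subst exterior_add) auto
  also have "\<dots> = \<omega> (us @ a # a # vs) + \<omega> (us @ a # b # vs) + (\<omega> (us @ b # a # vs) + \<omega> (us @ b # b # vs))"
    using True ab assms by (subst (1 2) exterior_add) auto
  also have "\<omega> (us @ a # a # vs) = 0" using assms by (rule exterior_alternating) simp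
  also have "\<omega> (us @ b # b # vs) = 0" using assms by (rule exterior_alternating) simp
  finally show ?thesis by (simp add: eq_neg_iff_add_eq_0)
next
  case False
  then show ?thesis using assms by (subst (1 2) exterior_outside) auto
qed

lemma exterior_move:
  assumes "\<omega> \<in> exterior V"
  shows "\<omega> (us @ x # vs) = (- 1) ^ length us * \<omega> (x # us @ vs)"
proof (induction us arbitrary: vs rule: rev_induct)
  case (snoc u us)
  have "\<omega> ((us @ [u]) @ x # vs) = - \<omega> (us @ x # u # vs)"
    using exterior_swap[OF assms, of us u x vs] by simp
  then show ?case using snoc[of "u # vs"] by simp
qed simp

lemma wedge_outside: "\<not> set \<phi>s \<subseteq> dual V \<Longrightarrow> wedge V u \<omega> \<phi>s = 0"
  by (simp add: wedge_def)

text \<open>The Clifford relation between exterior multiplication and contraction, written on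
  arguments; it lets proofs about \<open>wedge\<close> proceed by induction on the list of
  functionals.\<close>

lemma wedge_Cons:
  assumes "\<phi> \<in> dual V" "set \<phi>s \<subseteq> dual V"
  shows "wedge V u \<omega> (\<phi> # \<phi>s) = \<phi> u * \<omega> \<phi>s - wedge V u (contract \<phi> \<omega>) \<phi>s"
  using assms unfolding wedge_def contract_def
  by (simp add: sum.lessThan_Suc_shift sum_negf del: sum.lessThan_Suc)

lemma wedge_vanish: "(\<And>\<phi>. \<phi> \<in> set \<phi>s \<Longrightarrow> \<phi> u = 0) \<Longrightarrow> wedge V u \<omega> \<phi>s = 0"
  using nth_mem by (fastforce simp: wedge_def intro!: sum.neutral)

lemma wedge_add: "wedge V u (\<omega> + \<eta>) = wedge V u \<omega> + wedge V u \<eta>"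
  by (auto simp: wedge_def fun_eq_iff algebra_simps sum.distrib)

lemma wedge_fscale: "wedge V u (fscale c \<omega>) = fscale c (wedge V u \<omega>)"
  by (auto simp: wedge_def fun_eq_iff fscale_def sum_distrib_left mult_ac)

lemma wedge_zero: "wedge V u 0 = 0"
  by (auto simp: wedge_def fun_eq_iff)

lemma contract_add_left:
  assumes "\<omega> \<in> exterior V" "\<phi> \<in> dual V" "\<psi> \<in> dual V"
  shows "contract (\<phi> + \<psi>) \<omega> = contract \<phi> \<omega> + contract \<psi> \<omega>"
proof
  fix \<phi>s
  show "contract (\<phi> + \<psi>) \<omega> \<phi>s = (contract \<phi> \<omega> + contract \<psi> \<omega>) \<phi>s"
  proof (cases "set \<phi>s \<subseteq> dual V")
    case True
    then show ?thesis using assms exterior_add[of \<omega> V "[]" \<phi>s \<phi> \<psi>] by (simp add: contract_def)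
  next
    case False
    then show ?thesis using assms by (simp add: contract_def exterior_outside)
  qed
qed

lemma contract_fscale_left:
  assumes "\<omega> \<in> exterior V" "\<phi> \<in> dual V"
  shows "contract (fscale c \<phi>) \<omega> = fscale c (contract \<phi> \<omega>)"
proof
  fix \<phi>s
  show "contract (fscale c \<phi>) \<omega> \<phi>s = fscale c (contract \<phi> \<omega>) \<phi>s"
  proof (cases "set \<phi>s \<subseteq> dual V")
    case True
    then show ?thesis using assms exterior_fscale[of \<omega> V "[]" \<phi>s \<phi> c] by (simp add: contract_def fscale_def)
  next
    case False
    then show ?thesis using assms by (simp add: contract_def exterior_outside fscale_def)
  qed
qed

lemma contract_sum_left:
  assumes "\<omega> \<in> exterior V" "\<And>i. i \<in> I \<Longrightarrow> \<phi> i \<in> dual V"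
  shows "contract (\<Sum>i\<in>I. fscale (c i) (\<phi> i)) \<omega> = (\<Sum>i\<in>I. fscale (c i) (contract (\<phi> i) \<omega>))"
proof -
  have zero: "contract 0 \<omega> = 0"
    using contract_fscale_left[OF assms(1) dual_zero, of 0] by (simp only: fun_vs.scale_zero_left)
  show ?thesis
    using assms(2)
  proof (induction I rule: infinite_finite_induct)
    case (insert i I)
    have "contract (fscale (c i) (\<phi> i) + (\<Sum>i\<in>I. fscale (c i) (\<phi> i))) \<omega> =
        contract (fscale (c i) (\<phi> i)) \<omega> + contract (\<Sum>i\<in>I. fscale (c i) (\<phi> i)) \<omega>"
      using assms(1) insert by (intro contract_add_left) (auto intro!: dual_sum dual_fscale)
    also have "contract (fscale (c i) (\<phi> i)) \<omega> = fscale (c i) (contract (\<phi> i) \<omega>)"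
      using insert assms(1) by (intro contract_fscale_left) auto
    also have "contract (\<Sum>i\<in>I. fscale (c i) (\<phi> i)) \<omega> = (\<Sum>i\<in>I. fscale (c i) (contract (\<phi> i) \<omega>))"
      using insert by auto
    finally show ?case unfolding sum.insert[OF insert.hyps] .
  qed (auto simp: zero)
qed

text \<open>In the expansion of \<open>wedge\<close>, only the term that omits this occurrence of
  \<phi> can survive, since \<eta> vanishes on every list containing \<phi>. It is meant for \<eta>
  = contraction by \<phi>.\<close>

lemma wedge_repeated:
  assumes "set us \<union> set vs \<union> {\<phi>} \<subseteq> dual V" "\<And>xs. \<phi> \<in> set xs \<Longrightarrow> \<eta> xs = 0"
  shows "wedge V u \<eta> (us @ \<phi> # vs) = (- 1) ^ length us * \<phi> u * \<eta> (us @ vs)"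
  using assms
proof (induction us arbitrary: \<eta>)
  case Nil
  then have "contract \<phi> \<eta> = 0" by (auto simp: contract_def fun_eq_iff)
  then show ?case using Nil by (simp add: wedge_Cons wedge_zero)
next
  case (Cons a us)
  have "wedge V u (contract a \<eta>) (us @ \<phi> # vs) = (- 1) ^ length us * \<phi> u * contract a \<eta> (us @ vs)"
    using Cons by (intro Cons.IH) (auto simp: contract_def)
  then show ?case using Cons.prems by (simp add: wedge_Cons contract_def)
qed

lemma wedge_exterior:
  assumes "\<omega> \<in> exterior V"
  shows "wedge V u \<omega> \<in> exterior V"
proof (rule exteriorI)
  show "wedge V u \<omega> (xs @ (\<phi> + \<psi>) # ys) = wedge V u \<omega> (xs @ \<phi> # ys) + wedge V u \<omega> (xs @ \<psi> # ys)"
    if "set xs \<union> set ys \<union> {\<phi>, \<psi>} \<subseteq> dual V" for xs ys \<phi> \<psi>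
    using that assms
  proof (induction xs arbitrary: \<omega>)
    case Nil
    have "wedge V u \<omega> ((\<phi> + \<psi>) # ys) = (\<phi> + \<psi>) u * \<omega> ys - wedge V u (contract (\<phi> + \<psi>) \<omega>) ys"
      using Nil by (intro wedge_Cons dual_add) auto
    also have "contract (\<phi> + \<psi>) \<omega> = contract \<phi> \<omega> + contract \<psi> \<omega>"
      using Nil by (intro contract_add_left) auto
    finally have eq: "wedge V u \<omega> ((\<phi> + \<psi>) # ys) =
        (\<phi> + \<psi>) u * \<omega> ys - wedge V u (contract \<phi> \<omega> + contract \<psi> \<omega>) ys" .
    show ?case
      unfolding append_Nil eq unfolding wedge_add
      using Nil by (simp add: wedge_Cons algebra_simps)
  next
    case (Cons a xs)
    have "wedge V u (contract a \<omega>) (xs @ (\<phi> + \<psi>) # ys) =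
        wedge V u (contract a \<omega>) (xs @ \<phi> # ys) + wedge V u (contract a \<omega>) (xs @ \<psi> # ys)"
      using Cons.prems by (intro Cons.IH contract_exterior) auto
    then show ?case
      using Cons.prems by (simp add: wedge_Cons dual_add exterior_add algebra_simps del: plus_fun_apply)
  qed
  show "wedge V u \<omega> (xs @ fscale c \<phi> # ys) = c * wedge V u \<omega> (xs @ \<phi> # ys)"
    if "set xs \<union> set ys \<union> {\<phi>} \<subseteq> dual V" for xs ys c \<phi>
    using that assms
  proof (induction xs arbitrary: \<omega>)
    case Nil
    then show ?case
      by (simp add: wedge_Cons dual_fscale contract_fscale_left wedge_fscale)
        (simp add: fscale_def algebra_simps)
  next
    case (Cons a xs)
    have "wedge V u (contract a \<omega>) (xs @ fscale c \<phi> # ys) = c * wedge V u (contract a \<omega>) (xs @ \<phi> # ys)"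
      using Cons.prems by (intro Cons.IH contract_exterior) auto
    then show ?case
      using Cons.prems by (simp add: wedge_Cons dual_fscale exterior_fscale algebra_simps)
  qed
  show "wedge V u \<omega> \<phi>s = 0" if "set \<phi>s \<subseteq> dual V" "\<not> distinct \<phi>s" for \<phi>s
    using that assms
  proof (induction \<phi>s arbitrary: \<omega>)
    case (Cons \<phi> \<phi>s)
    show ?case
    proof (cases "\<phi> \<in> set \<phi>s")
      case False
      then have "wedge V u (contract \<phi> \<omega>) \<phi>s = 0"
        using Cons.prems by (intro Cons.IH contract_exterior) auto
      then show ?thesis
        using Cons.prems False by (simp add: wedge_Cons exterior_alternating)
    next
      case True
      then obtain us vs where split: "\<phi>s = us @ \<phi> # vs" by (meson split_list)
      \<comment> \<open>Moving \<phi> back into its place costs the same sign, so this term cancels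
        the leading term of \<open>wedge_Cons\<close>.\<close>
      have "wedge V u (contract \<phi> \<omega>) \<phi>s = (- 1) ^ length us * \<phi> u * contract \<phi> \<omega> (us @ vs)"
        unfolding split using Cons.prems split
        by (intro wedge_repeated) (auto simp: contract_def intro!: exterior_alternating)
      also have "\<dots> = \<phi> u * \<omega> \<phi>s"
        using exterior_move[OF Cons.prems(3), of us \<phi> vs] by (simp add: split contract_def)
      finally show ?thesis using Cons.prems by (simp add: wedge_Cons)
    qed
  qed simp
qed (rule wedge_outside)

lemma dual_sum_scale:
  assumes "\<phi> \<in> dual V" "subspace V" "\<And>i. i \<in> I \<Longrightarrow> v i \<in> V"
  shows "\<phi> (\<Sum>i\<in>I. c i *s v i) = (\<Sum>i\<in>I. c i * \<phi> (v i))"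
proof -
  have "\<phi> (0 *s 0) = 0 * \<phi> 0" using assms(1) subspace_0[OF assms(2)] unfolding dual_def by blast
  then have zero: "\<phi> 0 = 0" by simp
  show ?thesis
    using assms(3)
  proof (induction I rule: infinite_finite_induct)
    case (insert i I)
    then have "c i *s v i \<in> V" "(\<Sum>i\<in>I. c i *s v i) \<in> V"
      by (auto intro!: subspace_scale[OF assms(2)] subspace_sum[OF assms(2)])
    then have "\<phi> (c i *s v i + (\<Sum>i\<in>I. c i *s v i)) = \<phi> (c i *s v i) + \<phi> (\<Sum>i\<in>I. c i *s v i)"
      using assms(1) unfolding dual_def by simp
    then show ?case using insert assms(1) unfolding dual_def by auto
  qed (auto simp: zero)
qed

lemma wedge_sum_left:
  assumes "subspace V" "\<And>i. i \<in> I \<Longrightarrow> v i \<in> V"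
  shows "wedge V (\<Sum>i\<in>I. c i *s v i) \<omega> = (\<Sum>i\<in>I. fscale (c i) (wedge V (v i) \<omega>))"
proof
  fix \<phi>s
  show "wedge V (\<Sum>i\<in>I. c i *s v i) \<omega> \<phi>s = (\<Sum>i\<in>I. fscale (c i) (wedge V (v i) \<omega>)) \<phi>s"
  proof (cases "set \<phi>s \<subseteq> dual V")
    case True
    then have "(\<phi>s ! k) (\<Sum>i\<in>I. c i *s v i) = (\<Sum>i\<in>I. c i * (\<phi>s ! k) (v i))" if "k < length \<phi>s" for k
      using that assms nth_mem by (intro dual_sum_scale) auto
    then show ?thesis
      using True unfolding sum_fun_apply fscale_def wedge_def
      by (simp add: sum_distrib_left sum_distrib_right mult_ac sum.swap[of _ I])
  qed (simp add: sum_fun_apply fscale_def wedge_outside)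
qed

end

section \<open>The monomial basis of the exterior algebra\<close>

locale finite_dual_basis = complex_vector_space scale
  for scale :: "complex \<Rightarrow> 'v::ab_group_add \<Rightarrow> 'v" (infixr \<open>*s\<close> 75) +
  fixes V :: "'v set" and I :: "'i set" and e :: "'i \<Rightarrow> 'v" and d :: "'i \<Rightarrow> 'v \<Rightarrow> complex"
  assumes finite_index: "finite I"
    and basis_dual: "i \<in> I \<Longrightarrow> d i \<in> dual V"
    and basis_pairing: "i \<in> I \<Longrightarrow> j \<in> I \<Longrightarrow> d i (e j) = (if i = j then 1 else 0)"
    and dual_expansion: "\<phi> \<in> dual V \<Longrightarrow> \<phi> = (\<Sum>i\<in>I. fscale (\<phi> (e i)) (d i))"
begin

lemma map_dual: "set is \<subseteq> I \<Longrightarrow> set (map d is) \<subseteq> dual V"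
  using basis_dual by auto

lemma basis_inj: "inj_on d I"
  using basis_pairing by (intro inj_onI) (metis zero_neq_one)

lemma distinct_map_basis: "set is \<subseteq> I \<Longrightarrow> distinct (map d is) \<longleftrightarrow> distinct is"
  using basis_inj by (auto simp: distinct_map inj_on_subset)

text \<open>Expand the first functional in the dual basis and apply induction to the
  contractions.\<close>

lemma exterior_eq_zeroI:
  assumes "\<omega> \<in> exterior V" "\<And>is. set is \<subseteq> I \<Longrightarrow> \<omega> (map d is) = 0"
  shows "\<omega> \<phi>s = 0"
  using assms
proof (induction \<phi>s arbitrary: \<omega>)
  case Nil
  then show ?case using Nil(2)[of "[]"] by simp
next
  case (Cons \<phi> \<phi>s)
  show ?case
  proof (cases "\<phi> \<in> dual V")
    case True
    have "contract (d i) \<omega> \<phi>s = 0" if "i \<in> I" for i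
    proof (rule Cons.IH)
      show "contract (d i) \<omega> \<in> exterior V"
        using Cons.prems(1) basis_dual that by (intro contract_exterior)
      show "contract (d i) \<omega> (map d is) = 0" if "set is \<subseteq> I" for "is"
        using Cons.prems(2)[of "i # is"] that \<open>i \<in> I\<close> by (simp add: contract_def)
    qed
    moreover have "contract \<phi> \<omega> = (\<Sum>i\<in>I. fscale (\<phi> (e i)) (contract (d i) \<omega>))"
      using contract_sum_left[OF Cons.prems(1), of I d "\<lambda>i. \<phi> (e i)"] basis_dual dual_expansion[OF True] by simp
    then have "\<omega> (\<phi> # \<phi>s) = (\<Sum>i\<in>I. \<phi> (e i) * contract (d i) \<omega> \<phi>s)"
      by (simp add: contract_def fun_eq_iff sum_fun_apply fscale_def)
    ultimately show ?thesis by simp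
  next
    case False
    then show ?thesis using Cons.prems(1) by (simp add: exterior_outside)
  qed
qed

lemma exterior_eqI:
  assumes "\<omega> \<in> exterior V" "\<eta> \<in> exterior V"
    and "\<And>is. set is \<subseteq> I \<Longrightarrow> distinct is \<Longrightarrow> \<omega> (map d is) = \<eta> (map d is)"
  shows "\<omega> = \<eta>"
proof
  fix \<phi>s
  have "(\<omega> - \<eta>) \<phi>s = 0"
  proof (rule exterior_eq_zeroI)
    show "\<omega> - \<eta> \<in> exterior V" using assms by (intro fun_vs.subspace_diff subspace_exterior)
    show "(\<omega> - \<eta>) (map d is) = 0" if "set is \<subseteq> I" for "is"
      using assms that distinct_map_basis[OF that]
      by (cases "distinct is") (auto simp: exterior_alternating)
  qed
  then show "\<omega> \<phi>s = \<eta> \<phi>s" by simp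
qed

text \<open>The two compositions act as complementary projections, onto the components that contain
  index \<open>i\<close> and onto those that do not.\<close>

lemma wedge_contract_eval:
  assumes "\<omega> \<in> exterior V" "i \<in> I" "set js \<subseteq> I"
  shows "wedge V (e i) (contract (d i) \<omega>) (map d js) = (if i \<in> set js then \<omega> (map d js) else 0)"
    and "contract (d i) (wedge V (e i) \<omega>) (map d js) = (if i \<in> set js then 0 else \<omega> (map d js))"
proof -
  have anticommute: "contract (d i) (wedge V (e i) \<omega>) (map d js) =
      \<omega> (map d js) - wedge V (e i) (contract (d i) \<omega>) (map d js)"
    unfolding contract_def[of "d i" "wedge V (e i) \<omega>"]
    using assms map_dual basis_dual basis_pairing by (subst wedge_Cons) auto
  have "wedge V (e i) (contract (d i) \<omega>) (map d js) = 0" if "i \<notin> set js"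
    using assms that basis_pairing by (intro wedge_vanish) auto
  moreover have "contract (d i) (wedge V (e i) \<omega>) (map d js) = 0" if "i \<in> set js"
    unfolding contract_def using wedge_exterior[OF assms(1)] that by (rule_tac exterior_alternating) auto
  ultimately show "wedge V (e i) (contract (d i) \<omega>) (map d js) = (if i \<in> set js then \<omega> (map d js) else 0)"
    and "contract (d i) (wedge V (e i) \<omega>) (map d js) = (if i \<in> set js then 0 else \<omega> (map d js))"
    using anticommute by auto
qed

lemma exterior_permute:
  assumes "distinct xs" "distinct ys" "set xs = set ys"
  shows "\<exists>s. \<forall>\<omega>\<in>exterior V. \<omega> (map d xs) = s * \<omega> (map d ys)"
proof -
  \<comment> \<open>\<open>s\<close> is a sign, but only its independence of \<omega> matters. The
    prefix \<open>zs\<close> keeps the induction going after the first entries have been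
    matched.\<close>
  have "\<exists>s. \<forall>\<omega>\<in>exterior V. \<omega> (zs @ map d xs) = s * \<omega> (zs @ map d ys)" for zs
    using assms
  proof (induction xs arbitrary: ys zs)
    case Nil
    then show ?case by (auto intro: exI[of _ 1])
  next
    case (Cons x xs)
    then obtain us vs where ys: "ys = us @ x # vs" by (metis list.set_intros(1) split_list)
    have "\<exists>s. \<forall>\<omega>\<in>exterior V. \<omega> ((zs @ [d x]) @ map d xs) = s * \<omega> ((zs @ [d x]) @ map d (us @ vs))"
      using Cons.prems ys by (intro Cons.IH) auto
    then obtain s where s: "\<And>\<omega>. \<omega> \<in> exterior V \<Longrightarrow> \<omega> (zs @ d x # map d xs) = s * \<omega> (zs @ d x # map d us @ map d vs)"
      by auto
    have "\<omega> (zs @ map d (x # xs)) = (s * (- 1) ^ length us) * \<omega> (zs @ map d ys)" if w: "\<omega> \<in> exterior V" for \<omega>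
    proof -
      have "\<omega> (zs @ map d ys) = (- 1) ^ (length zs + length us) * \<omega> (d x # zs @ map d us @ map d vs)"
        using exterior_move[OF w, of "zs @ map d us" "d x" "map d vs"] by (simp add: ys)
      moreover have "\<omega> (zs @ d x # map d us @ map d vs) = (- 1) ^ length zs * \<omega> (d x # zs @ map d us @ map d vs)"
        by (rule exterior_move[OF w])
      ultimately show ?thesis using s[OF w] by (simp add: power_add flip: power_mult_distrib)
    qed
    then show ?case by blast
  qed
  from this[of "[]"] show ?thesis by simp
qed

text \<open>The product of the \<open>e i\<close> in the order of the list; the innermost function
  is the unit of degree 0.\<close>

definition monomial :: "'i list \<Rightarrow> ('v \<Rightarrow> complex) list \<Rightarrow> complex" where
  "monomial is = foldr (\<lambda>i. wedge V (e i)) is (\<lambda>\<phi>s. if \<phi>s = [] then 1 else 0)"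

lemma monomial_exterior: "monomial is \<in> exterior V"
proof (induction "is")
  case Nil
  show ?case by (rule exteriorI) (auto simp: monomial_def)
next
  case (Cons i "is")
  then show ?case by (simp add: monomial_def wedge_exterior)
qed

lemma monomial_eval:
  assumes "distinct is" "set is \<subseteq> I"
  shows "monomial is (map d is) = 1"
  using assms
proof (induction "is")
  case (Cons i "is")
  have "wedge V (e i) (contract (d i) (monomial is)) (map d is) = 0"
    using Cons.prems basis_pairing by (intro wedge_vanish) auto
  then have "wedge V (e i) (monomial is) (map d (i # is)) = 1"
    using Cons basis_dual basis_pairing map_dual by (simp add: wedge_Cons)
  then show ?case by (simp add: monomial_def)
qed (simp add: monomial_def)

text \<open>If the first factor \<open>i\<close> does not occur in \<open>js\<close>, every
  coefficient in the expansion is 0. Otherwise \<open>d i\<close> is moved to the front and both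
  lists lose \<open>i\<close>.\<close>

lemma monomial_vanish:
  assumes "distinct is" "set is \<subseteq> I" "distinct js" "set js \<subseteq> I" "set is \<noteq> set js"
  shows "monomial is (map d js) = 0"
  using assms
proof (induction "is" arbitrary: js)
  case (Cons i "is")
  have mono: "monomial (i # is) = wedge V (e i) (monomial is)" by (simp add: monomial_def)
  show ?case
  proof (cases "i \<in> set js")
    case False
    have "d j (e i) = 0" if "j \<in> set js" for j
      using that False Cons.prems by (subst basis_pairing) auto
    then show ?thesis
      unfolding mono by (intro wedge_vanish) auto
  next
    case True
    then obtain us vs where js: "js = us @ i # vs" by (meson split_list)
    have "monomial is (map d (us @ vs)) = 0"
      using Cons.prems js by (intro Cons.IH) auto
    moreover have "wedge V (e i) (contract (d i) (monomial is)) (map d (us @ vs)) = 0"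
    proof (rule wedge_vanish)
      fix \<phi> assume "\<phi> \<in> set (map d (us @ vs))"
      then obtain j where j: "j \<in> set (us @ vs)" "\<phi> = d j" by auto
      then show "\<phi> (e i) = 0"
        unfolding j(2) using Cons.prems js by (subst basis_pairing) auto
    qed
    ultimately have "monomial (i # is) (d i # map d (us @ vs)) = 0"
      unfolding mono using Cons.prems js basis_dual by (subst wedge_Cons) auto
    then show ?thesis
      using exterior_move[OF monomial_exterior, of "i # is" "map d us" "d i" "map d vs"] by (simp add: js)
  qed
qed (simp add: monomial_def)

text \<open>The monomials over the sets in \<open>T\<close>, each enumerated in one fixed order,
  form a basis; evaluation at the enumerations gives the coefficients.\<close>

lemma dim_exterior_support:
  assumes "T \<subseteq> Pow I"
  shows "fun_vs.dim {\<omega> \<in> exterior V. \<forall>js. set js \<subseteq> I \<and> distinct js \<and> set js \<notin> T \<longrightarrow> \<omega> (map d js) = 0} = card T"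
    (is "fun_vs.dim ?W = _")
proof -
  have finT: "finite T" using assms finite_index finite_subset by blast
  have "\<forall>A\<in>T. \<exists>xs. distinct xs \<and> set xs = A"
    using assms finite_index finite_distinct_list finite_subset by (metis PowD subset_iff)
  then obtain L where L: "\<And>A. A \<in> T \<Longrightarrow> distinct (L A) \<and> set (L A) = A" by metis
  define m where "m A = monomial (L A)" for A
  have TI: "A \<subseteq> I" if "A \<in> T" for A using that assms by blast
  have m_eval: "m A (map d (L B)) = (if A = B then 1 else 0)" if "A \<in> T" "B \<in> T" for A B
    using that L TI monomial_eval[of "L A"] monomial_vanish[of "L A" "L B"] unfolding m_def by auto
  have inj: "inj_on m T"
    using m_eval by (intro inj_onI) (metis zero_neq_one)
  have m_vanish: "m A (map d js) = 0" if "A \<in> T" "set js \<subseteq> I" "distinct js" "set js \<notin> T" for A js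
    using monomial_vanish[of "L A" js] L[OF that(1)] TI[OF that(1)] that unfolding m_def by auto
  have mW: "m ` T \<subseteq> ?W"
    using monomial_exterior m_vanish unfolding m_def by auto
  have WB: "?W \<subseteq> fun_vs.span (m ` T)"
  proof
    fix \<omega> assume w: "\<omega> \<in> ?W"
    have "\<omega> = (\<Sum>A\<in>T. fscale (\<omega> (map d (L A))) (m A))"
    proof (rule exterior_eqI)
      show "\<omega> \<in> exterior V" using w by blast
      show "(\<Sum>A\<in>T. fscale (\<omega> (map d (L A))) (m A)) \<in> exterior V"
        using monomial_exterior unfolding m_def
        by (intro fun_vs.subspace_sum[OF subspace_exterior] fun_vs.subspace_scale[OF subspace_exterior])
      fix js assume js: "set js \<subseteq> I" "distinct js"
      show "\<omega> (map d js) = (\<Sum>A\<in>T. fscale (\<omega> (map d (L A))) (m A)) (map d js)"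
      proof (cases "set js \<in> T")
        case True
        \<comment> \<open>Values at \<open>js\<close> and at the chosen enumeration of the same set
          differ by a common factor for all elements, so comparison at the enumeration is
          enough.\<close>
        obtain s where s: "\<And>\<eta>. \<eta> \<in> exterior V \<Longrightarrow> \<eta> (map d js) = s * \<eta> (map d (L (set js)))"
          using exterior_permute[of js "L (set js)"] js L[OF True] by auto
        have "m A (map d js) = (if A = set js then s else 0)" if "A \<in> T" for A
          using s[of "m A"] monomial_exterior m_eval[OF that True] unfolding m_def by auto
        then have "(\<Sum>A\<in>T. fscale (\<omega> (map d (L A))) (m A)) (map d js)
            = (\<Sum>A\<in>T. if A = set js then s * \<omega> (map d (L A)) else 0)"
          unfolding sum_fun_apply fscale_def by (intro sum.cong) auto
        then show ?thesis using True finT s w by simp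
      next
        case False
        then show ?thesis using w js m_vanish by (simp add: sum_fun_apply fscale_def)
      qed
    qed
    also have "\<dots> \<in> fun_vs.span (m ` T)"
      by (intro fun_vs.span_sum fun_vs.span_scale fun_vs.span_base) auto
    finally show "\<omega> \<in> fun_vs.span (m ` T)" .
  qed
  have "fun_vs.independent (m ` T)"
  proof (rule fun_vs.independent_if_scalars_zero)
    show "finite (m ` T)" using finT by simp
    fix f x assume sum0: "(\<Sum>x\<in>m ` T. fscale (f x) x) = 0" and "x \<in> m ` T"
    then obtain B where B: "B \<in> T" "x = m B" by blast
    have "0 = (\<Sum>A\<in>T. fscale (f (m A)) (m A)) (map d (L B))"
      using sum0 inj by (simp add: sum.reindex)
    also have "\<dots> = (\<Sum>A\<in>T. if A = B then f (m A) else 0)"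
      unfolding sum_fun_apply fscale_def using m_eval B by (intro sum.cong) auto
    also have "\<dots> = f x" using finT B by simp
    finally show "f x = 0" by simp
  qed
  then have "card (m ` T) = fun_vs.dim ?W"
    using fun_vs.basis_card_eq_dim mW WB by blast
  then show ?thesis using inj by (simp add: card_image)
qed

end


section \<open>Weights of the spin module\<close>

locale root_basis = cartan_lie_algebra scale bracket t
  for scale :: "complex \<Rightarrow> 'g::ab_group_add \<Rightarrow> 'g" (infixr \<open>*s\<close> 75)
    and bracket :: "'g \<Rightarrow> 'g \<Rightarrow> 'g" and t :: "'g set" +
  fixes P :: "('g \<Rightarrow> complex) set" and e :: "('g \<Rightarrow> complex) \<Rightarrow> 'g"
  assumes pos: "positive_system t P"
    and root_vector: "\<alpha> \<in> \<Phi> \<Longrightarrow> e \<alpha> \<in> rsp \<alpha>"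
    and root_vector_killing: "\<alpha> \<in> \<Phi> \<Longrightarrow> killing (e \<alpha>) (e (- \<alpha>)) = 1"
begin

abbreviation U :: "'g set" where "U \<equiv> u_plus t P"
abbreviation Q :: "'g set" where "Q \<equiv> q_space t"

lemma killing_e:
  assumes "\<alpha> \<in> \<Phi>" "\<beta> \<in> \<Phi>"
  shows "killing (e \<alpha>) (e (- \<beta>)) = (if \<alpha> = \<beta> then 1 else 0)"
proof (cases "\<alpha> = \<beta>")
  case False
  then show ?thesis
    using assms root_uminus[OF assms(2)] root_vector
    by (auto intro!: killing_root_space_orthogonal[of _ \<alpha> _ "- \<beta>"] root_dual simp: eq_neg_iff_add_eq_0)
qed (use assms root_vector_killing in simp)

definition span_of :: "('g \<Rightarrow> complex) set \<Rightarrow> 'g set" where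
  "span_of S = span (\<Union>\<alpha>\<in>S. rsp \<alpha>)"

text \<open>By the normalization, pairing with \<open>e (- \<alpha>)\<close> reads off the
  coordinate at \<open>e \<alpha>\<close>; one-dimensional root spaces make these vectors a spanning
  set.\<close>

lemma span_of_expansion:
  assumes S: "S \<subseteq> \<Phi>" and x: "x \<in> span_of S"
  shows "x = (\<Sum>\<alpha>\<in>S. killing x (e (- \<alpha>)) *s e \<alpha>)"
proof -
  have fin: "finite S" using S finite_roots finite_subset by blast
  let ?X = "{x. x = (\<Sum>\<alpha>\<in>S. killing x (e (- \<alpha>)) *s e \<alpha>)}"
  have "subspace ?X"
  proof (rule subspaceI)
    show "0 \<in> ?X" by (simp add: killing_zero)
    show "x + y \<in> ?X" if "x \<in> ?X" "y \<in> ?X" for x y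
      using that by (simp add: killing_add_left scale_left_distrib sum.distrib)
    show "c *s x \<in> ?X" if "x \<in> ?X" for c x
    proof -
      have "c *s x = c *s (\<Sum>\<alpha>\<in>S. killing x (e (- \<alpha>)) *s e \<alpha>)"
        by (rule arg_cong) (use that in blast)
      also have "\<dots> = (\<Sum>\<alpha>\<in>S. killing (c *s x) (e (- \<alpha>)) *s e \<alpha>)"
        by (simp add: killing_scale_left scale_sum_right)
      finally show ?thesis by blast
    qed
  qed
  moreover have "rsp \<beta> \<subseteq> ?X" if \<beta>: "\<beta> \<in> S" for \<beta>
  proof
    fix y assume y: "y \<in> rsp \<beta>"
    have root: "\<beta> \<in> \<Phi>" using S \<beta> by blast
    have "e \<beta> \<noteq> 0" using root_vector_killing[OF root] by (auto simp: killing_zero)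
    then have "y \<in> span {e \<beta>}"
      using root_space_one_dimensional[OF root root_vector[OF root] _ y] by simp
    moreover have "e \<beta> \<in> ?X"
    proof -
      have "(\<Sum>\<alpha>\<in>S. killing (e \<beta>) (e (- \<alpha>)) *s e \<alpha>) = (\<Sum>\<alpha>\<in>S. if \<beta> = \<alpha> then e \<alpha> else 0)"
        using S root by (intro sum.cong) (auto simp: killing_e)
      then show ?thesis using fin \<beta> by simp
    qed
    then have "span {e \<beta>} \<subseteq> ?X" using \<open>subspace ?X\<close> by (intro span_minimal) auto
    ultimately show "y \<in> ?X" by blast
  qed
  ultimately have "span_of S \<subseteq> ?X" unfolding span_of_def by (intro span_minimal) auto
  then show ?thesis using x by blast
qed

lemma span_of_orthogonal:
  assumes "S \<subseteq> \<Phi>" "x \<in> span_of S" "\<alpha> \<in> \<Phi>" "\<alpha> \<notin> S"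
  shows "killing x (e (- \<alpha>)) = 0"
proof -
  have "killing x (e (- \<alpha>)) = (\<Sum>\<beta>\<in>S. killing x (e (- \<beta>)) * killing (e \<beta>) (e (- \<alpha>)))"
    by (subst span_of_expansion[OF assms(1,2)]) (simp add: killing_sum_left killing_scale_left)
  also have "\<dots> = 0"
  proof (intro sum.neutral ballI)
    fix \<beta> assume "\<beta> \<in> S"
    then show "killing x (e (- \<beta>)) * killing (e \<beta>) (e (- \<alpha>)) = 0"
      using assms by (subst killing_e) auto
  qed
  finally show ?thesis .
qed

lemma e_in_span_of: "\<alpha> \<in> S \<Longrightarrow> S \<subseteq> \<Phi> \<Longrightarrow> e \<alpha> \<in> span_of S"
  unfolding span_of_def using root_vector by (intro span_base) blast

lemma U_eq: "U = span_of P" and u_minus_eq: "u_minus t P = span_of (uminus ` P)"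
  and Q_eq: "Q = span_of \<Phi>"
  unfolding u_plus_def u_minus_def q_space_def span_of_def by simp_all

lemma roots_split: "\<Phi> = P \<union> uminus ` P" "P \<inter> uminus ` P = {}"
proof -
  have "\<alpha> \<in> uminus ` P" if "\<alpha> \<in> \<Phi>" "\<alpha> \<notin> P" for \<alpha>
    using positive_choice[OF pos that(1)] that(2) by (intro image_eqI[of _ _ "- \<alpha>"]) auto
  moreover have "uminus ` P \<subseteq> \<Phi>" using root_uminus positive_root[OF pos] by blast
  ultimately show "\<Phi> = P \<union> uminus ` P" using positive_subset[OF pos] by blast
  show "P \<inter> uminus ` P = {}" using positive_uminus[OF pos] by blast
qed

lemma sum_roots:
  fixes f :: "('g \<Rightarrow> complex) \<Rightarrow> 'b::comm_monoid_add"
  shows "(\<Sum>\<gamma>\<in>\<Phi>. f \<gamma>) = (\<Sum>\<gamma>\<in>P. f \<gamma>) + (\<Sum>\<gamma>\<in>P. f (- \<gamma>))"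
proof -
  have "(\<Sum>\<gamma>\<in>\<Phi>. f \<gamma>) = (\<Sum>\<gamma>\<in>P. f \<gamma>) + (\<Sum>\<gamma>\<in>uminus ` P. f \<gamma>)"
    using roots_split positive_finite[OF pos] by (metis finite_imageI sum.union_disjoint)
  moreover have "(\<Sum>\<gamma>\<in>uminus ` P. f \<gamma>) = (\<Sum>\<gamma>\<in>P. f (- \<gamma>))"
    by (subst sum.reindex) auto
  ultimately show ?thesis by simp
qed

lemma Q_expansion: "x \<in> Q \<Longrightarrow> x = (\<Sum>\<alpha>\<in>\<Phi>. killing x (e (- \<alpha>)) *s e \<alpha>)"
  using span_of_expansion[of \<Phi>] Q_eq by simp

lemma U_expansion: "x \<in> U \<Longrightarrow> x = (\<Sum>\<alpha>\<in>P. killing x (e (- \<alpha>)) *s e \<alpha>)"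
  using span_of_expansion[OF positive_subset[OF pos]] U_eq by simp

lemma subspace_U: "subspace U" and subspace_Q: "subspace Q"
  by (simp_all add: u_plus_def q_space_def)

lemma plus_part_eq:
  assumes x: "x \<in> Q"
  shows "plus_part t P x = (\<Sum>\<alpha>\<in>P. killing x (e (- \<alpha>)) *s e \<alpha>)"
  unfolding plus_part_def
proof (rule the_equality)
  let ?p = "\<Sum>\<alpha>\<in>P. killing x (e (- \<alpha>)) *s e \<alpha>"
  have "?p \<in> U"
    unfolding U_eq span_of_def[symmetric] using e_in_span_of[of _ P] positive_subset[OF pos]
    by (auto simp: span_of_def intro!: span_sum span_scale)
  moreover have "x - ?p = (\<Sum>\<alpha>\<in>P. killing x (e \<alpha>) *s e (- \<alpha>))"
    by (subst (1) Q_expansion[OF x]) (simp add: sum_roots)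
  then have "x - ?p \<in> u_minus t P"
    unfolding u_minus_eq using e_in_span_of[of _ "uminus ` P"] roots_split(1)
    by (auto simp: span_of_def intro!: span_sum span_scale)
  ultimately show "?p \<in> U \<and> x - ?p \<in> u_minus t P" by blast
  show "p = ?p" if p: "p \<in> U \<and> x - p \<in> u_minus t P" for p
  proof -
    have "killing p (e (- \<alpha>)) = killing x (e (- \<alpha>))" if "\<alpha> \<in> P" for \<alpha>
    proof -
      have "\<alpha> \<notin> uminus ` P" using that roots_split(2) by blast
      then have "killing (x - p) (e (- \<alpha>)) = 0"
        using p that roots_split(1) u_minus_eq by (intro span_of_orthogonal[of "uminus ` P"]) auto
      then show ?thesis by (simp add: killing_diff_left)
    qed
    then show ?thesis using U_expansion[of p] p by simp
  qed
qed

definition d :: "('g \<Rightarrow> complex) \<Rightarrow> 'g \<Rightarrow> complex" where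
  "d \<alpha> = (\<lambda>u. if u \<in> U then killing (e (- \<alpha>)) u else 0)"

lemma d_dual: "d \<alpha> \<in> dual U"
  unfolding dual_def d_def using subspace_U
  by (auto simp: subspace_add subspace_scale killing_add_right killing_scale_right)

lemma e_in_U: "\<alpha> \<in> P \<Longrightarrow> e \<alpha> \<in> U"
  unfolding U_eq using e_in_span_of positive_subset[OF pos] by blast

sublocale finite_dual_basis scale U P e d
proof
  show "finite P" using positive_finite[OF pos] .
  show "d \<alpha> \<in> dual U" for \<alpha> by (rule d_dual)
  show "d \<alpha> (e \<beta>) = (if \<alpha> = \<beta> then 1 else 0)" if "\<alpha> \<in> P" "\<beta> \<in> P" for \<alpha> \<beta>
    using that e_in_U killing_e[of \<beta> \<alpha>] positive_root[OF pos] by (auto simp: d_def killing_commute[of "e (- \<alpha>)"])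
  show "\<phi> = (\<Sum>\<alpha>\<in>P. fscale (\<phi> (e \<alpha>)) (d \<alpha>))" if \<phi>: "\<phi> \<in> dual U" for \<phi>
  proof (rule dual_eqI[OF \<phi>])
    show "(\<Sum>\<alpha>\<in>P. fscale (\<phi> (e \<alpha>)) (d \<alpha>)) \<in> dual U"
      by (intro dual_sum dual_fscale d_dual)
    fix u assume u: "u \<in> U"
    have "\<phi> u = (\<Sum>\<alpha>\<in>P. killing u (e (- \<alpha>)) * \<phi> (e \<alpha>))"
      using dual_sum_scale[OF \<phi> subspace_U, of P e "\<lambda>\<alpha>. killing u (e (- \<alpha>))"] e_in_U U_expansion[OF u] by simp
    then show "\<phi> u = (\<Sum>\<alpha>\<in>P. fscale (\<phi> (e \<alpha>)) (d \<alpha>)) u"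
      using u by (simp add: sum_fun_apply fscale_def d_def killing_commute[of _ u] mult.commute)
  qed
qed

text \<open>The Clifford action of the root vector of weight \<gamma>. For negative \<gamma> the
  functional \<open>killing (e \<gamma>)\<close> on \<open>U\<close> is
  \<open>d (- \<gamma>)\<close>, and the factor 2 is that of \<open>clifford\<close>.\<close>

definition cl :: "('g \<Rightarrow> complex) \<Rightarrow> (('g \<Rightarrow> complex) list \<Rightarrow> complex) \<Rightarrow> ('g \<Rightarrow> complex) list \<Rightarrow> complex" where
  "cl \<gamma> \<omega> = (if \<gamma> \<in> P then wedge U (e \<gamma>) \<omega> else fscale 2 (contract (d (- \<gamma>)) \<omega>))"

lemma cl_exterior: "\<omega> \<in> exterior U \<Longrightarrow> cl \<gamma> \<omega> \<in> exterior U"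
  unfolding cl_def using wedge_exterior contract_exterior d_dual fun_vs.subspace_scale[OF subspace_exterior] by auto

lemma cl_add: "cl \<gamma> (\<omega> + \<eta>) = cl \<gamma> \<omega> + cl \<gamma> \<eta>"
  by (auto simp: cl_def wedge_add contract_def fscale_def fun_eq_iff algebra_simps)

lemma cl_fscale: "cl \<gamma> (fscale c \<omega>) = fscale c (cl \<gamma> \<omega>)"
  by (auto simp: cl_def wedge_fscale contract_def) (auto simp: fscale_def fun_eq_iff)

lemma cl_zero: "cl \<gamma> 0 = 0"
  using cl_fscale[of \<gamma> 0 0] by (simp only: fun_vs.scale_zero_left)

lemma cl_sum: "cl \<gamma> (\<Sum>i\<in>I. fscale (c i) (\<omega> i)) = (\<Sum>i\<in>I. fscale (c i) (cl \<gamma> (\<omega> i)))"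
proof (induction I rule: infinite_finite_induct)
  case (insert i I)
  show ?case unfolding sum.insert[OF insert.hyps] cl_add cl_fscale insert.IH ..
qed (simp_all only: sum.infinite sum.empty cl_zero not_False_eq_True)

lemma clifford_expansion:
  assumes x: "x \<in> Q" and w: "\<omega> \<in> exterior U"
  shows "clifford t P x \<omega> = (\<Sum>\<gamma>\<in>\<Phi>. fscale (killing x (e (- \<gamma>))) (cl \<gamma> \<omega>))"
proof -
  define p where "p = plus_part t P x"
  have p: "p = (\<Sum>\<alpha>\<in>P. killing x (e (- \<alpha>)) *s e \<alpha>)"
    unfolding p_def by (rule plus_part_eq[OF x])
  have "(\<lambda>u. if u \<in> U then killing (x - p) u else 0) = (\<Sum>\<alpha>\<in>P. fscale (killing x (e \<alpha>)) (d \<alpha>))"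
  proof
    fix u
    show "(if u \<in> U then killing (x - p) u else 0) = (\<Sum>\<alpha>\<in>P. fscale (killing x (e \<alpha>)) (d \<alpha>)) u"
    proof (cases "u \<in> U")
      case True
      \<comment> \<open>\<open>U\<close> is isotropic, so subtracting the positive part
        \<open>p\<close> does not change the functional \<open>killing x\<close> on
        \<open>U\<close>.\<close>
      have "killing (e \<alpha>) u = 0" if \<alpha>: "\<alpha> \<in> P" for \<alpha>
      proof -
        have "killing u (e (- (- \<alpha>))) = 0"
          using True \<alpha> positive_uminus[OF pos \<alpha>] root_uminus[OF positive_root[OF pos \<alpha>]] U_eq
          by (intro span_of_orthogonal[OF positive_subset[OF pos]]) auto
        then show ?thesis by (simp add: killing_commute[of _ u])
      qed
      then have "killing (x - p) u = killing x u"
        by (simp add: killing_diff_left p killing_sum_left killing_scale_left)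
      also have "\<dots> = (\<Sum>\<alpha>\<in>P. killing u (e (- \<alpha>)) * killing x (e \<alpha>))"
        by (subst U_expansion[OF True]) (simp add: killing_sum_right killing_scale_right)
      finally show ?thesis
        using True by (simp add: sum_fun_apply fscale_def d_def killing_commute[of _ u] mult.commute)
    qed (simp add: sum_fun_apply fscale_def d_def)
  qed
  then have "clifford t P x \<omega> = wedge U p \<omega> + fscale 2 (contract (\<Sum>\<alpha>\<in>P. fscale (killing x (e \<alpha>)) (d \<alpha>)) \<omega>)"
    unfolding clifford_def Let_def p_def by (simp only:)
  also have "wedge U p \<omega> = (\<Sum>\<gamma>\<in>P. fscale (killing x (e (- \<gamma>))) (wedge U (e \<gamma>) \<omega>))"
    unfolding p using subspace_U e_in_U by (rule wedge_sum_left)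
  also have "\<dots> = (\<Sum>\<gamma>\<in>P. fscale (killing x (e (- \<gamma>))) (cl \<gamma> \<omega>))"
    by (intro sum.cong) (auto simp: cl_def)
  also have "fscale 2 (contract (\<Sum>\<alpha>\<in>P. fscale (killing x (e \<alpha>)) (d \<alpha>)) \<omega>) =
      (\<Sum>\<alpha>\<in>P. fscale 2 (fscale (killing x (e \<alpha>)) (contract (d \<alpha>) \<omega>)))"
    by (subst contract_sum_left[OF w d_dual]) (rule fun_vs.scale_sum_right)
  also have "\<dots> = (\<Sum>\<gamma>\<in>P. fscale (killing x (e (- (- \<gamma>)))) (cl (- \<gamma>) \<omega>))"
    using positive_uminus[OF pos] by (intro sum.cong) (auto simp: cl_def mult.commute)
  finally show ?thesis unfolding sum_roots[of "\<lambda>\<gamma>. fscale (killing x (e (- \<gamma>))) (cl \<gamma> \<omega>)"] .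
qed

section \<open>The action of the Cartan subalgebra on the spin module\<close>

lemma dual_basis_vector_killing:
  assumes B: "independent B" "span B = Q" and b: "b \<in> B"
  shows "dual_basis_vector t B b \<in> Q"
    and "\<delta> \<in> \<Phi> \<Longrightarrow> killing (dual_basis_vector t B b) (e (- \<delta>)) = representation B (e (- \<delta>)) b"
proof -
  have finB: "finite B" using B finiteI_independent by blast
  have e_Q: "e \<gamma> \<in> Q" if "\<gamma> \<in> \<Phi>" for \<gamma> using e_in_span_of[OF that] Q_eq by simp
  \<comment> \<open>The vector representing the \<open>b\<close>-coordinate functional on
    \<open>Q\<close>: its pairing with \<open>e \<gamma>\<close> has to be the
    \<open>b\<close>-coordinate of \<open>e \<gamma>\<close>, and \<open>e (- \<gamma>)\<close> is
    dual to \<open>e \<gamma>\<close>.\<close>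
  define y where "y = (\<Sum>\<gamma>\<in>\<Phi>. representation B (e \<gamma>) b *s e (- \<gamma>))"
  have yQ: "y \<in> Q"
    unfolding y_def using root_uminus e_Q by (intro subspace_sum[OF subspace_Q] subspace_scale[OF subspace_Q]) auto
  have y_killing: "killing c y = (if c = b then 1 else 0)" if c: "c \<in> B" for c
  proof -
    have cQ: "c \<in> Q" using B(2) c span_base by blast
    have "killing c y = (\<Sum>\<gamma>\<in>\<Phi>. killing c (e (- \<gamma>)) * representation B (e \<gamma>) b)"
      unfolding y_def by (simp add: killing_sum_right killing_scale_right mult.commute)
    also have "\<dots> = (\<Sum>\<gamma>\<in>\<Phi>. representation B (killing c (e (- \<gamma>)) *s e \<gamma>) b)"
      using B e_Q by (intro sum.cong) (auto simp: representation_scale)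
    also have "\<dots> = representation B (\<Sum>\<gamma>\<in>\<Phi>. killing c (e (- \<gamma>)) *s e \<gamma>) b"
      using B e_Q subspace_scale[OF subspace_Q] by (subst representation_sum) auto
    also have "\<dots> = representation B c b" using Q_expansion[OF cQ] by simp
    finally show ?thesis using B c by (simp add: representation_basis)
  qed
  have eq: "dual_basis_vector t B b = y"
    unfolding dual_basis_vector_def
  proof (rule the_equality)
    show "y \<in> Q \<and> (\<forall>b'\<in>B. killing b' y = (if b' = b then 1 else 0))" using yQ y_killing by blast
    fix z assume z: "z \<in> Q \<and> (\<forall>b'\<in>B. killing b' z = (if b' = b then 1 else 0))"
    have "subspace {x. killing x (z - y) = 0}"
      by (rule subspaceI) (auto simp: killing_zero killing_add_left killing_scale_left)
    moreover have "killing c (z - y) = 0" if "c \<in> B" for c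
      using z y_killing[OF that] that
      by (simp add: killing_commute[of c "z - y"] killing_diff_left killing_commute[of z c] killing_commute[of y c])
    ultimately have "span B \<subseteq> {x. killing x (z - y) = 0}"
      by (intro span_minimal) auto
    then have "killing (z - y) (e (- \<gamma>)) = 0" if "\<gamma> \<in> \<Phi>" for \<gamma>
      using e_Q[OF root_uminus[OF that]] B(2) by (auto simp: killing_commute[of "z - y"])
    then have "z - y = 0"
      using Q_expansion[of "z - y"] z yQ subspace_diff[OF subspace_Q] by simp
    then show "z = y" by simp
  qed
  show "dual_basis_vector t B b \<in> Q" using yQ eq by simp
  show "killing (dual_basis_vector t B b) (e (- \<delta>)) = representation B (e (- \<delta>)) b" if \<delta>: "\<delta> \<in> \<Phi>"
  proof -
    have "killing y (e (- \<delta>)) = (\<Sum>\<gamma>\<in>\<Phi>. if \<gamma> = - \<delta> then representation B (e \<gamma>) b else 0)"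
      unfolding y_def killing_sum_left killing_scale_left
      using \<delta> root_uminus by (intro sum.cong) (auto simp: killing_e)
    also have "\<dots> = representation B (e (- \<delta>)) b"
      using finite_roots root_uminus[OF \<delta>] by simp
    finally show ?thesis using eq by simp
  qed
qed

lemma bracket_cartan_Q:
  assumes "h \<in> t" "x \<in> Q"
  shows "bracket h x \<in> Q"
proof -
  have "span (\<Union>\<alpha>\<in>\<Phi>. rsp \<alpha>) \<subseteq> {x. bracket h x \<in> Q}"
  proof (intro span_minimal bracket_right.subspace_linear_preimage subspace_Q)
    have "bracket h x \<in> Q" if "\<alpha> \<in> \<Phi>" "x \<in> rsp \<alpha>" for \<alpha> x
    proof -
      have "bracket h x = \<alpha> h *s x" using that(2) assms(1) by (simp add: root_space_def)
      moreover have "x \<in> Q" unfolding q_space_def using that by (intro span_base) blast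
      ultimately show ?thesis using subspace_scale[OF subspace_Q] by simp
    qed
    then show "(\<Union>\<alpha>\<in>\<Phi>. rsp \<alpha>) \<subseteq> {x. bracket h x \<in> Q}" by blast
  qed
  then show ?thesis using assms(2) unfolding q_space_def by blast
qed

text \<open>Expanding \<open>b\<close> and its dual basis vector in the root vectors, the sum over the chosen
  basis collapses to a sum over the basis of root vectors.\<close>

lemma so_action_eq:
  assumes h: "h \<in> t" and w: "\<omega> \<in> exterior U"
  shows "so_action t P (bracket h) \<omega> = fscale (1 / 4) (\<Sum>\<gamma>\<in>\<Phi>. fscale (\<gamma> h) (cl \<gamma> (cl (- \<gamma>) \<omega>)))"
proof -
  define B where "B = (SOME B. independent B \<and> span B = Q)"
  have "\<exists>B. independent B \<and> span B = Q" using basis_subspace_exists[OF subspace_Q] by metis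
  then have B: "independent B" "span B = Q"
    unfolding B_def by (metis (mono_tags, lifting) someI_ex)+
  have finB: "finite B" using B finiteI_independent by blast
  have BQ: "b \<in> Q" if "b \<in> B" for b using B(2) that span_base by blast
  define db where "db = dual_basis_vector t B"
  have e_Q: "e \<gamma> \<in> Q" if "\<gamma> \<in> \<Phi>" for \<gamma> using e_in_span_of[OF that] Q_eq by simp
  have weight: "killing (bracket h b) (e (- \<gamma>)) = \<gamma> h * killing b (e (- \<gamma>))" if "\<gamma> \<in> \<Phi>" for b \<gamma>
  proof -
    have "killing (bracket h b) (e (- \<gamma>)) = - killing b (bracket h (e (- \<gamma>)))"
      by (simp add: bracket_anticommute[of h b] killing_uminus killing_invariant)
    also have "bracket h (e (- \<gamma>)) = (- \<gamma>) h *s e (- \<gamma>)"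
      using root_vector[OF root_uminus[OF that]] h unfolding root_space_def by blast
    also have "(- \<gamma>) h = - \<gamma> h" by simp
    finally show ?thesis by (simp only: killing_scale_right mult_minus_left minus_minus)
  qed
  have summand: "clifford t P (bracket h b) (clifford t P (db b) \<omega>) \<phi>s =
      (\<Sum>\<gamma>\<in>\<Phi>. \<Sum>\<delta>\<in>\<Phi>. \<gamma> h * (killing b (e (- \<gamma>)) * representation B (e (- \<delta>)) b) * cl \<gamma> (cl \<delta> \<omega>) \<phi>s)"
    if b: "b \<in> B" for b \<phi>s
  proof -
    have inner: "clifford t P (db b) \<omega> = (\<Sum>\<delta>\<in>\<Phi>. fscale (representation B (e (- \<delta>)) b) (cl \<delta> \<omega>))"
      unfolding db_def using dual_basis_vector_killing[OF B b] w
      by (subst clifford_expansion) (auto intro!: sum.cong)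
    have ext: "clifford t P (db b) \<omega> \<in> exterior U"
      unfolding inner using w
      by (intro fun_vs.subspace_sum[OF subspace_exterior] fun_vs.subspace_scale[OF subspace_exterior] cl_exterior)
    have "clifford t P (bracket h b) (clifford t P (db b) \<omega>) =
        (\<Sum>\<gamma>\<in>\<Phi>. fscale (killing (bracket h b) (e (- \<gamma>))) (cl \<gamma> (clifford t P (db b) \<omega>)))"
      by (rule clifford_expansion[OF bracket_cartan_Q[OF h BQ[OF b]] ext])
    also have "\<dots> = (\<Sum>\<gamma>\<in>\<Phi>. fscale (\<gamma> h * killing b (e (- \<gamma>)))
        (\<Sum>\<delta>\<in>\<Phi>. fscale (representation B (e (- \<delta>)) b) (cl \<gamma> (cl \<delta> \<omega>))))"
      unfolding inner cl_sum using weight by (intro sum.cong) auto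
    finally have expand: "clifford t P (bracket h b) (clifford t P (db b) \<omega>) = \<dots>" .
    show ?thesis
      unfolding expand sum_fun_apply fscale_def sum_distrib_left by (simp add: mult_ac)
  qed
  \<comment> \<open>Summing over \<open>B\<close> reassembles \<open>e (- \<delta>)\<close> from its
    coordinates, leaving its pairing with \<open>e (- \<gamma>)\<close>; only opposite roots
    survive.\<close>
  have collapse: "(\<Sum>b\<in>B. killing b (e (- \<gamma>)) * representation B (e (- \<delta>)) b) = (if \<delta> = - \<gamma> then 1 else 0)"
    if g: "\<gamma> \<in> \<Phi>" and dl: "\<delta> \<in> \<Phi>" for \<gamma> \<delta>
  proof -
    have "e (- \<delta>) = (\<Sum>b\<in>B. representation B (e (- \<delta>)) b *s b)"
      using sum_representation_eq[OF B(1) _ finB subset_refl, of "e (- \<delta>)"] B(2) e_Q root_uminus[OF dl] by simp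
    then have "killing (e (- \<delta>)) (e (- \<gamma>)) = killing (\<Sum>b\<in>B. representation B (e (- \<delta>)) b *s b) (e (- \<gamma>))"
      by (rule arg_cong)
    also have "\<dots> = (\<Sum>b\<in>B. representation B (e (- \<delta>)) b * killing b (e (- \<gamma>)))"
      by (simp only: killing_scale_left killing_sum_left)
    finally have "killing (e (- \<delta>)) (e (- \<gamma>)) = (\<Sum>b\<in>B. representation B (e (- \<delta>)) b * killing b (e (- \<gamma>)))" .
    then show ?thesis
      using killing_e[OF root_uminus[OF dl] g] by (auto simp: mult.commute minus_equation_iff[of \<delta>])
  qed
  show ?thesis
  proof
    fix \<phi>s
    have "so_action t P (bracket h) \<omega> \<phi>s =
        1 / 4 * (\<Sum>b\<in>B. clifford t P (bracket h b) (clifford t P (db b) \<omega>) \<phi>s)"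
      unfolding so_action_def Let_def B_def[symmetric] db_def by (simp add: fscale_def sum_fun_apply)
    also have "(\<Sum>b\<in>B. clifford t P (bracket h b) (clifford t P (db b) \<omega>) \<phi>s) =
        (\<Sum>b\<in>B. \<Sum>\<gamma>\<in>\<Phi>. \<Sum>\<delta>\<in>\<Phi>. \<gamma> h * (killing b (e (- \<gamma>)) * representation B (e (- \<delta>)) b) * cl \<gamma> (cl \<delta> \<omega>) \<phi>s)"
      by (intro sum.cong summand refl)
    also have "\<dots> = (\<Sum>\<gamma>\<in>\<Phi>. \<Sum>\<delta>\<in>\<Phi>. \<Sum>b\<in>B. \<gamma> h * (killing b (e (- \<gamma>)) * representation B (e (- \<delta>)) b) * cl \<gamma> (cl \<delta> \<omega>) \<phi>s)"
      by (subst sum.swap, rule sum.cong[OF refl], rule sum.swap)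
    also have "\<dots> = (\<Sum>\<gamma>\<in>\<Phi>. \<Sum>\<delta>\<in>\<Phi>. if \<delta> = - \<gamma> then \<gamma> h * cl \<gamma> (cl \<delta> \<omega>) \<phi>s else 0)"
      using collapse by (intro sum.cong refl) (simp flip: sum_distrib_left sum_distrib_right)
    also have "\<dots> = (\<Sum>\<gamma>\<in>\<Phi>. \<gamma> h * cl \<gamma> (cl (- \<gamma>) \<omega>) \<phi>s)"
      using finite_roots root_uminus by (intro sum.cong) auto
    finally show "so_action t P (bracket h) \<omega> \<phi>s =
        fscale (1 / 4) (\<Sum>\<gamma>\<in>\<Phi>. fscale (\<gamma> h) (cl \<gamma> (cl (- \<gamma>) \<omega>))) \<phi>s"
      by (simp add: fscale_def sum_fun_apply)
  qed
qed

lemma so_action_exterior: "h \<in> t \<Longrightarrow> \<omega> \<in> exterior U \<Longrightarrow> so_action t P (bracket h) \<omega> \<in> exterior U"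
  by (subst so_action_eq)
    (auto intro!: fun_vs.subspace_sum[OF subspace_exterior] fun_vs.subspace_scale[OF subspace_exterior] cl_exterior)

text \<open>For each positive \<alpha> exactly one of the two orders of multiplication and
  contraction survives, with sign + if \<alpha> is in \<open>js\<close> and - otherwise. The factors
  1/4 and 2 leave half the signed sum of positive roots, which is \<mu> of the complement of
  \<open>js\<close>.\<close>

lemma so_action_eval:
  assumes h: "h \<in> t" and w: "\<omega> \<in> exterior U" and js: "set js \<subseteq> P"
  shows "so_action t P (bracket h) \<omega> (map d js) = mu_of P (P - set js) h * \<omega> (map d js)"
proof -
  have summands: "cl \<alpha> (cl (- \<alpha>) \<omega>) (map d js) = (if \<alpha> \<in> set js then 2 * \<omega> (map d js) else 0)"
    "cl (- \<alpha>) (cl \<alpha> \<omega>) (map d js) = (if \<alpha> \<in> set js then 0 else 2 * \<omega> (map d js))" if \<alpha>: "\<alpha> \<in> P" for \<alpha>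
  proof -
    have "cl \<alpha> (cl (- \<alpha>) \<omega>) = fscale 2 (wedge U (e \<alpha>) (contract (d \<alpha>) \<omega>))"
      using \<alpha> positive_uminus[OF pos \<alpha>] by (simp add: cl_def wedge_fscale)
    then show "cl \<alpha> (cl (- \<alpha>) \<omega>) (map d js) = (if \<alpha> \<in> set js then 2 * \<omega> (map d js) else 0)"
      using wedge_contract_eval(1)[OF w \<alpha> js] by (simp add: fscale_def)
    have "cl (- \<alpha>) (cl \<alpha> \<omega>) = fscale 2 (contract (d \<alpha>) (wedge U (e \<alpha>) \<omega>))"
      using \<alpha> positive_uminus[OF pos \<alpha>] by (simp add: cl_def)
    then show "cl (- \<alpha>) (cl \<alpha> \<omega>) (map d js) = (if \<alpha> \<in> set js then 0 else 2 * \<omega> (map d js))"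
      using wedge_contract_eval(2)[OF w \<alpha> js] by (simp add: fscale_def)
  qed
  have "so_action t P (bracket h) \<omega> (map d js) =
      1 / 4 * ((\<Sum>\<alpha>\<in>P. \<alpha> h * cl \<alpha> (cl (- \<alpha>) \<omega>) (map d js)) + (\<Sum>\<alpha>\<in>P. (- \<alpha>) h * cl (- \<alpha>) (cl \<alpha> \<omega>) (map d js)))"
    unfolding so_action_eq[OF h w] fscale_def sum_fun_apply
    by (subst sum_roots) simp
  also have "\<dots> = 1 / 4 * (\<Sum>\<alpha>\<in>P. 2 * (if \<alpha> \<in> set js then \<alpha> h else - \<alpha> h) * \<omega> (map d js))"
    unfolding sum.distrib[symmetric] by (intro arg_cong2[where f = "(*)"] sum.cong refl) (simp add: summands)
  also have "\<dots> = 1 / 2 * (\<Sum>\<alpha>\<in>P. if \<alpha> \<in> set js then \<alpha> h else - \<alpha> h) * \<omega> (map d js)"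
    by (simp add: sum_distrib_left sum_distrib_right mult.commute)
  also have "(\<Sum>\<alpha>\<in>P. if \<alpha> \<in> set js then \<alpha> h else - \<alpha> h) = (\<Sum>\<alpha>\<in>set js. \<alpha> h) - (\<Sum>\<alpha>\<in>P - set js. \<alpha> h)"
  proof -
    have "P \<inter> set js = set js" "P \<inter> - set js = P - set js" using js by auto
    then show ?thesis using finite_index by (simp add: sum.If_cases sum_negf)
  qed
  also have "1 / 2 * \<dots> = mu_of P (P - set js) h"
    using js by (simp add: mu_of_def fscale_def sum_fun_apply double_diff)
  finally show ?thesis .
qed

lemma mu_of_dual: "A \<subseteq> P \<Longrightarrow> mu_of P A \<in> dual t"
  unfolding mu_of_def using positive_root[OF pos] root_dual
  by (intro dual_fscale dual_diff dual_sum) auto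

text \<open>\<open>t\<close> acts diagonally on the values at dual basis lists, so a weight vector
  is one whose support consists of sets of the right weight.\<close>

lemma spin_weight_space_eq:
  assumes "\<mu> \<in> dual t"
  shows "spin_weight_space t P \<mu> = {\<omega> \<in> exterior U. \<forall>js. set js \<subseteq> P \<and> distinct js \<and>
    set js \<notin> {B. B \<subseteq> P \<and> mu_of P (P - B) = \<mu>} \<longrightarrow> \<omega> (map d js) = 0}"
  unfolding spin_weight_space_def spin_module_def
proof (intro Collect_cong conj_cong refl iffI allI impI ballI)
  fix \<omega> js
  assume w: "\<omega> \<in> exterior U" and act: "\<forall>h\<in>t. so_action t P (bracket h) \<omega> = fscale (\<mu> h) \<omega>"
    and js: "set js \<subseteq> P \<and> distinct js \<and> set js \<notin> {B. B \<subseteq> P \<and> mu_of P (P - B) = \<mu>}"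
  have "mu_of P (P - set js) \<noteq> \<mu>" using js by blast
  then obtain h where h: "h \<in> t" "mu_of P (P - set js) h \<noteq> \<mu> h"
    using weights_distinct[OF mu_of_dual assms, of "P - set js"] by auto
  have "\<mu> h * \<omega> (map d js) = mu_of P (P - set js) h * \<omega> (map d js)"
    using so_action_eval[OF h(1) w, of js] act h(1) js by (simp add: fscale_def)
  then show "\<omega> (map d js) = 0" using h by simp
next
  fix \<omega> h
  assume w: "\<omega> \<in> exterior U" and h: "h \<in> t"
    and van: "\<forall>js. set js \<subseteq> P \<and> distinct js \<and> set js \<notin> {B. B \<subseteq> P \<and> mu_of P (P - B) = \<mu>} \<longrightarrow> \<omega> (map d js) = 0"
  show "so_action t P (bracket h) \<omega> = fscale (\<mu> h) \<omega>"
  proof (rule exterior_eqI)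
    show "so_action t P (bracket h) \<omega> \<in> exterior U" using so_action_exterior h w .
    show "fscale (\<mu> h) \<omega> \<in> exterior U" using fun_vs.subspace_scale[OF subspace_exterior w] .
    fix js assume js: "set js \<subseteq> P" "distinct js"
    show "so_action t P (bracket h) \<omega> (map d js) = fscale (\<mu> h) \<omega> (map d js)"
      using van[rule_format, of js] js so_action_eval[OF h w js(1)]
      by (cases "mu_of P (P - set js) = \<mu>") (auto simp: fscale_def)
  qed
qed

lemma spin_mult_eq_card:
  assumes "\<mu> \<in> dual t"
  shows "spin_mult t P \<mu> = card {A. A \<subseteq> P \<and> mu_of P A = \<mu>}"
proof -
  have "spin_mult t P \<mu> = card {B. B \<subseteq> P \<and> mu_of P (P - B) = \<mu>}"
    unfolding spin_mult_def spin_weight_space_eq[OF assms] by (rule dim_exterior_support) auto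
  \<comment> \<open>Complementation in \<open>P\<close> passes from supports of monomials to the
    subsets in the definition of \<mu>.\<close>
  also have "\<dots> = card {A. A \<subseteq> P \<and> mu_of P A = \<mu>}"
    by (rule bij_betw_same_card[of "\<lambda>B. P - B"])
      (auto simp: bij_betw_def inj_on_def double_diff image_iff intro!: exI[of _ "P - _"])
  finally show ?thesis .
qed

end

context cartan_lie_algebra
begin

lemma root_basis_exists:
  assumes P: "positive_system t P"
  shows "\<exists>e. root_basis scale bracket t P e"
proof -
  have "\<exists>x y. x \<in> rsp \<alpha> \<and> y \<in> rsp (- \<alpha>) \<and> killing x y = 1" if \<alpha>: "\<alpha> \<in> \<Phi>" for \<alpha>
  proof -
    obtain x where x: "x \<in> rsp \<alpha>" "x \<noteq> 0" using root_vector_exists[OF \<alpha>] by blast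
    obtain y where y: "y \<in> rsp (- \<alpha>)" "killing x y \<noteq> 0" using root_vector_pairing[OF \<alpha> x] by blast
    then have "(1 / killing x y) *s y \<in> rsp (- \<alpha>)" "killing x ((1 / killing x y) *s y) = 1"
      by (auto intro: subspace_scale[OF subspace_root_space] simp: killing_scale_right)
    then show ?thesis using x by blast
  qed
  then obtain x y where xy: "\<And>\<alpha>. \<alpha> \<in> \<Phi> \<Longrightarrow> x \<alpha> \<in> rsp \<alpha> \<and> y \<alpha> \<in> rsp (- \<alpha>) \<and> killing (x \<alpha>) (y \<alpha>) = 1"
    by metis
  \<comment> \<open>One dual pair is used for each positive root and supplies the vectors for both
    signs; symmetry of the Killing form gives the normalization at -\<alpha>.\<close>
  define e where "e \<alpha> = (if \<alpha> \<in> P then x \<alpha> else y (- \<alpha>))" for \<alpha>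
  have "root_basis scale bracket t P e"
  proof
    show "positive_system t P" by (rule P)
    fix \<alpha> assume \<alpha>: "\<alpha> \<in> \<Phi>"
    show "e \<alpha> \<in> rsp \<alpha>"
      using xy[OF \<alpha>] xy[OF root_uminus[OF \<alpha>]] by (simp add: e_def)
    show "killing (e \<alpha>) (e (- \<alpha>)) = 1"
      using xy[OF \<alpha>] xy[OF root_uminus[OF \<alpha>]] positive_choice[OF P \<alpha>]
      by (auto simp: e_def killing_commute)
  qed
  then show ?thesis by blast
qed

end

theorem proposition2p8:
  fixes scale :: "complex \<Rightarrow> 'g::ab_group_add \<Rightarrow> 'g"
    and bracket :: "'g \<Rightarrow> 'g \<Rightarrow> 'g"
    and t :: "'g set"
    and P A :: "('g \<Rightarrow> complex) set"
    and \<mu> :: "'g \<Rightarrow> complex"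
  assumes "complex_lie_algebra scale bracket"
    and "complex_lie_algebra.semisimple scale bracket"
    and "complex_lie_algebra.cartan_subalgebra scale bracket t"
    and "complex_lie_algebra.positive_system scale bracket t P"
    and "\<mu> \<in> complex_lie_algebra.spin_weights scale bracket t P"
    and "A \<subseteq> P"
    and "\<mu> = complex_lie_algebra.mu_of P A"
  shows "(complex_lie_algebra.spin_mult scale bracket t P \<mu> = 1
            \<longleftrightarrow> complex_lie_algebra.saturated scale bracket t P A) \<and>
         (complex_lie_algebra.saturated scale bracket t P A
            \<longleftrightarrow> (\<exists>w \<in> complex_lie_algebra.weyl_group scale bracket t.
                   \<mu> = w (complex_lie_algebra.rho P)))"
proof -
  interpret complex_lie_algebra scale bracket by fact
  interpret cartan_lie_algebra scale bracket t
    by unfold_locales (use assms in auto)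
  obtain e where "root_basis scale bracket t P e"
    using root_basis_exists assms(4) by blast
  then interpret root_basis scale bracket t P e .
  have "spin_mult t P \<mu> = card {B. B \<subseteq> P \<and> mu_of P B = mu_of P A}"
    using spin_mult_eq_card[of \<mu>] mu_of_dual[OF assms(6)] assms(7) by simp
  then show ?thesis
    using saturated_iff_unique[OF pos assms(6)] saturated_iff_weyl[OF pos assms(6)] assms(7) by simp
qed

end
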